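(* Let $X$ be a Čech-complete topological group and $Y$ be any topological group. Every universally measurable homomorphism $h:X\to Y$ is continuous.
   Context: A Tychonoff space is Čech-complete if it is homeomorphic to a $G_\delta$-subset of some compact Hausdorff space; a topological group is Čech-complete if its underlying space is. A probability Radon measure on a Tychonoff space $X$ is a $\sigma$-additive measure $\mu$ on the Borel $\sigma$-algebra of $X$ with $\mu(X)=1$ such that for every Borel $B$ and every $a<\mu(B)$ there is a compact $K\subseteq B$ with $\mu(K)>a$. A set $A\subseteq X$ is universally measurable if it is $\mu$-measurable for every probability Radon measure $\mu$ on $X$ (i.e. there are Borel sets $B\subseteq A\subseteq B'$ with $\mu(B'\setminus B)=0$). A function $f:X\to Y$ is universally measurable if $f^{-1}[U]$ is universally measurable for every open $U\subseteq Y$. *)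

theory Defs
  imports "HOL-Probability.Probability"
begin

definition cech_complete_in :: "'a::topological_space itself \<Rightarrow> 'k::t2_space itself \<Rightarrow> bool" where
  "cech_complete_in _ _ \<longleftrightarrow> compact (UNIV :: 'k set) \<and>
     (\<exists>S :: 'k set. gdelta_in euclidean S \<and> (UNIV :: 'a set) homeomorphic S)"

definition radon_prob_measure :: "'a::topological_space measure \<Rightarrow> bool" where
  "radon_prob_measure M \<longleftrightarrow> sets M = sets borel \<and> prob_space M \<and>
     (\<forall>B \<in> sets borel. \<forall>a. a < emeasure M B \<longrightarrow>
        (\<exists>K. compact K \<and> K \<subseteq> B \<and> a < emeasure M K))"

definition universally_measurable_set :: "'a::topological_space set \<Rightarrow> bool" where
  "universally_measurable_set A \<longleftrightarrow> (\<forall>M. radon_prob_measure M \<longrightarrow>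
     (\<exists>B B'. B \<in> sets borel \<and> B' \<in> sets borel \<and> B \<subseteq> A \<and> A \<subseteq> B' \<and>
        emeasure M (B' - B) = 0))"

definition universally_measurable_fun :: "('a::topological_space \<Rightarrow> 'b::topological_space) \<Rightarrow> bool" where
  "universally_measurable_fun f \<longleftrightarrow> (\<forall>U. open U \<longrightarrow> universally_measurable_set (f -` U))"

end

theory Submission
  imports Defs
begin

text \<open>
  Suppose \<open>h\<close> is discontinuous. Whether or not the closures of preimages of neighbourhoods of \<open>0\<close> are
  always neighbourhoods of \<open>0\<close>, one can choose letters \<open>g\<^sub>0, g\<^sub>1, \<dots>\<close>, each as
  small as desired, such that \<open>h\<close> keeps all conjugates of \<open>g\<^sub>n\<close> by products of earlier letters away
  from \<open>0\<close>. By Cech-completeness the infinite products of letters, modulo a compact subgroup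
  \<open>K\<close>, fill a compact set \<open>C\<close>. Since \<open>X\<close> need not be metrizable, \<open>C\<close> carries no obvious measure; limits
  of covering-number ratios as in the construction of Haar measure give a Radon measure that is
  invariant under all partial left translations of \<open>C\<close>.

  Some preimage \<open>h\<^sup>-\<^sup>1(W + y)\<close> has positive measure: otherwise Stone's refinement of the cover by the
  sets \<open>W + y\<close> yields a partition of a set of positive measure into null sets with all unions
  measurable, and a Radon measure admits no such partition. Hence a Steinhaus argument applies, also to
  maps of \<open>C\<close> that are left translations by small elements on each of finitely many pieces. For a
  compact subgroup this makes \<open>h\<close> continuous there, so \<open>h\<close> may be assumed small on \<open>K\<close>. For \<open>C\<close>,
  exchanging the \<open>n\<close>-th letter is such a map after a correction in \<open>K\<close>, and the Steinhaus argument
  contradicts the choice of \<open>g\<^sub>n\<close>.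
\<close>

section \<open>Radon measures from contents\<close>

text \<open>In a locally compact group, Steinhaus's theorem for Haar measure would suffice. Here
  \<open>X\<close> need not carry an invariant measure, and a small left translation may push
  \<open>C\<close> off itself. So invariance is only asked where a relatively open part of
  \<open>C\<close> is carried onto another one, and small elements have to be assembled into a
  bijection of \<open>C\<close> that is a left translation on each of finitely many pieces.
  Exchanging one letter is such a map: it multiplies an infinite product on the left by the
  conjugate of the letter under the preceding prefix, whatever the later letters are. This is why
  letters must stay bad under conjugation. The target need not be metrizable, so a cover by
  translates of a neighbourhood may have no countable subcover; hence the null partitions of
  arbitrary cardinality, treated separately for atomless index measures and for atoms. Conjugates of
  letters are kept out of the preimage of \<open>W + W\<close>: one summand is for the correction in
  the compact subgroup, the other for the translation found by Steinhaus. Hausdorffness is a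
  hypothesis on \<open>euclidean\<close> because it is deduced from the embedding.\<close>

lemma Hausdorff_compact_closed:
  fixes K :: "'a::topological_space set"
  assumes "Hausdorff_space (euclidean :: 'a topology)" "compact K"
  shows "closed K"
  using compactin_imp_closedin[OF assms(1), of K] assms(2) by simp

lemma Hausdorff_compact_separation:
  fixes K L :: "'a::topological_space set"
  assumes "Hausdorff_space (euclidean :: 'a topology)" "compact K" "compact L" "K \<inter> L = {}"
  obtains U V where "open U" "open V" "K \<subseteq> U" "L \<subseteq> V" "U \<inter> V = {}"
  using assms(1)[unfolded Hausdorff_space_compact_sets, rule_format, of K L] assms(2-) that
  by (auto simp: disjnt_def)

lemma compact_Diff_open: "compact K \<Longrightarrow> open U \<Longrightarrow> compact (K - U)"
  by (simp add: Diff_eq closed_Compl compact_Int_closed)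

text \<open>Separate \<open>K - U\<close> from \<open>K - V\<close> by disjoint open sets; removing
  either of these from \<open>K\<close> leaves a compact part inside \<open>U\<close> or
  \<open>V\<close>.\<close>

lemma Hausdorff_compact_split:
  fixes K :: "'a::topological_space set"
  assumes T2: "Hausdorff_space (euclidean :: 'a topology)" and K: "compact K"
    and U: "open U" and V: "open V" and sub: "K \<subseteq> U \<union> V"
  obtains K1 K2 where "compact K1" "compact K2" "K1 \<subseteq> U" "K2 \<subseteq> V" "K = K1 \<union> K2"
proof -
  obtain P Q where PQ: "open P" "open Q" "K - U \<subseteq> P" "K - V \<subseteq> Q" "P \<inter> Q = {}"
    by (rule Hausdorff_compact_separation[OF T2 compact_Diff_open[OF K U] compact_Diff_open[OF K V]])
       (use sub in auto)
  show thesis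
    by (rule that[of "K - P" "K - Q"]) (use PQ K compact_Diff_open in auto)
qed

text \<open>Additivity appears as subadditivity together with superadditivity on disjoint sets,
  since these are the two halves that come from covering numbers by different arguments.\<close>

locale compact_content =
  fixes C :: "'a::topological_space set" and l :: "'a set \<Rightarrow> real"
  assumes T2: "Hausdorff_space (euclidean :: 'a topology)"
    and compact_C: "compact C"
    and mono: "\<And>K L. compact K \<Longrightarrow> compact L \<Longrightarrow> K \<subseteq> L \<Longrightarrow> L \<subseteq> C \<Longrightarrow> l K \<le> l L"
    and subadd: "\<And>K L. compact K \<Longrightarrow> compact L \<Longrightarrow> K \<subseteq> C \<Longrightarrow> L \<subseteq> C \<Longrightarrow> l (K \<union> L) \<le> l K + l L"
    and superadd: "\<And>K L. compact K \<Longrightarrow> compact L \<Longrightarrow> K \<subseteq> C \<Longrightarrow> L \<subseteq> C \<Longrightarrow> K \<inter> L = {} \<Longrightarrow>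
      l K + l L \<le> l (K \<union> L)"
    and nonneg: "\<And>K. 0 \<le> l K"
    and l_C: "l C = 1"
begin

text \<open>Intersecting with \<open>C\<close> keeps the measure a Borel measure on the whole space
  while all its mass sits on \<open>C\<close>.\<close>

definition inner_content :: "'a set \<Rightarrow> ennreal" where
  "inner_content U = (SUP K\<in>{K. compact K \<and> K \<subseteq> U \<inter> C}. ennreal (l K))"

definition outer_content :: "'a set \<Rightarrow> ennreal" where
  "outer_content E = (INF U\<in>{U. open U \<and> E \<inter> C \<subseteq> U}. inner_content U)"

lemma l_empty: "l {} = 0"
  using superadd[of "{}" "{}"] nonneg[of "{}"] by simp

lemma inner_content_ge: "compact K \<Longrightarrow> K \<subseteq> U \<Longrightarrow> K \<subseteq> C \<Longrightarrow> ennreal (l K) \<le> inner_content U"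
  unfolding inner_content_def by (rule SUP_upper) auto

lemma inner_content_mono: "U \<inter> C \<subseteq> V \<Longrightarrow> inner_content U \<le> inner_content V"
  unfolding inner_content_def by (rule SUP_subset_mono) auto

lemma inner_content_empty: "inner_content {} = 0"
proof -
  have "{K. compact K \<and> K \<subseteq> {} \<inter> C} = {{}}" by auto
  then show ?thesis by (simp add: inner_content_def l_empty)
qed

lemma inner_content_Un:
  assumes "open U" "open V"
  shows "inner_content (U \<union> V) \<le> inner_content U + inner_content V"
  unfolding inner_content_def[of "U \<union> V"]
proof (rule SUP_least, clarify)
  fix K assume K: "compact K" "K \<subseteq> (U \<union> V) \<inter> C"
  obtain K1 K2 where k: "compact K1" "compact K2" "K1 \<subseteq> U" "K2 \<subseteq> V" "K = K1 \<union> K2"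
    using Hausdorff_compact_split[OF T2 K(1) assms] K(2) by blast
  have "ennreal (l K) \<le> ennreal (l K1 + l K2)"
    using subadd[of K1 K2] k K by (intro ennreal_leI) auto
  also have "\<dots> = ennreal (l K1) + ennreal (l K2)"
    by (simp add: nonneg)
  also have "\<dots> \<le> inner_content U + inner_content V"
    using k K by (intro add_mono inner_content_ge) auto
  finally show "ennreal (l K) \<le> inner_content U + inner_content V" .
qed

lemma inner_content_UN:
  fixes U :: "nat \<Rightarrow> 'a set"
  assumes "\<And>n. open (U n)"
  shows "inner_content (\<Union>n. U n) \<le> (\<Sum>n. inner_content (U n))"
  unfolding inner_content_def[of "\<Union>n. U n"]
proof (rule SUP_least, clarify)
  fix K assume K: "compact K" "K \<subseteq> (\<Union>n. U n) \<inter> C"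
  then obtain N where N: "finite N" "K \<subseteq> (\<Union>n\<in>N. U n)"
    using assms by (metis (no_types, lifting) compactE_image le_infE)
  have "inner_content (\<Union>n\<in>N. U n) \<le> (\<Sum>n\<in>N. inner_content (U n))"
    using N(1)
  proof induct
    case empty then show ?case by (simp add: inner_content_empty)
  next
    case (insert x F)
    have "inner_content (U x \<union> (\<Union>n\<in>F. U n)) \<le> inner_content (U x) + inner_content (\<Union>n\<in>F. U n)"
      by (intro inner_content_Un assms open_UN) (simp add: assms)
    with insert show ?case by (simp add: order.trans[OF _ add_left_mono])
  qed
  also have "\<dots> \<le> (\<Sum>n. inner_content (U n))"
    using N(1) by (intro sum_le_suminf) auto
  finally show "ennreal (l K) \<le> (\<Sum>n. inner_content (U n))"
    using inner_content_ge[of K "\<Union>n\<in>N. U n"] K N by (meson inf.boundedE order_trans)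
qed

lemma outer_content_le: "open U \<Longrightarrow> E \<inter> C \<subseteq> U \<Longrightarrow> outer_content E \<le> inner_content U"
  unfolding outer_content_def by (rule INF_lower) auto

lemma outer_content_open: "open U \<Longrightarrow> outer_content U = inner_content U"
  unfolding outer_content_def
  by (intro antisym INF_lower INF_greatest) (auto intro: inner_content_mono)

lemma inner_content_le_1: "inner_content U \<le> 1"
  unfolding inner_content_def
proof (rule SUP_least, clarify)
  fix K assume "compact K" "K \<subseteq> U \<inter> C"
  then show "ennreal (l K) \<le> 1"
    using mono[of K C] compact_C l_C ennreal_leI[of "l K" 1] by simp
qed

lemma outer_content_le_1: "outer_content E \<le> 1"
  using outer_content_le[of UNIV E] inner_content_le_1[of UNIV] by auto

lemma outer_content_mono: "A \<subseteq> B \<Longrightarrow> outer_content A \<le> outer_content B"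
  unfolding outer_content_def by (rule INF_superset_mono) auto

lemma outer_content_empty: "outer_content {} = 0"
  using outer_content_open[of "{}"] inner_content_empty by simp

lemma outer_content_approx:
  assumes "e > 0"
  obtains U where "open U" "E \<inter> C \<subseteq> U" "inner_content U \<le> outer_content E + ennreal e"
proof -
  have "outer_content E < \<top>"
    using outer_content_le_1[of E] by (metis ennreal_one_less_top order.strict_trans1)
  then have "outer_content E < outer_content E + ennreal e"
    using assms by (simp add: ennreal_add_left_cancel_less less_top ennreal_less_zero_iff)
  then show thesis
    using that less_imp_le unfolding outer_content_def[of E] INF_less_iff by blast
qed

lemma outer_content_UN:
  fixes A :: "nat \<Rightarrow> 'a set"
  shows "outer_content (\<Union>n. A n) \<le> (\<Sum>n. outer_content (A n))"
proof (rule ennreal_le_epsilon)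
  fix e :: real assume "e > 0"
  have "\<exists>U. open U \<and> A n \<inter> C \<subseteq> U \<and> inner_content U \<le> outer_content (A n) + ennreal (e * (1/2)^Suc n)" for n
    by (rule outer_content_approx[of "e * (1/2)^Suc n" "A n"]) (use \<open>e > 0\<close> in auto)
  then obtain U where U: "\<And>n. open (U n)" "\<And>n. A n \<inter> C \<subseteq> U n"
      "\<And>n. inner_content (U n) \<le> outer_content (A n) + ennreal (e * (1/2)^Suc n)"
    by metis
  have "outer_content (\<Union>n. A n) \<le> inner_content (\<Union>n. U n)"
    using U by (intro outer_content_le) auto
  also have "\<dots> \<le> (\<Sum>n. inner_content (U n))"
    by (rule inner_content_UN[OF U(1)])
  also have "\<dots> \<le> (\<Sum>n. outer_content (A n) + ennreal (e * (1/2)^Suc n))"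
    by (intro suminf_le U(3)) auto
  also have "\<dots> = (\<Sum>n. outer_content (A n)) + (\<Sum>n. ennreal (e * (1/2)^Suc n))"
    by (rule suminf_add[symmetric]) auto
  also have "(\<Sum>n. ennreal (e * (1/2)^Suc n)) = ennreal e"
  proof (rule suminf_ennreal_eq)
    show "(\<lambda>n. e * (1/2)^Suc n) sums e"
      using sums_mult[OF power_half_series, of e] by simp
  qed (use \<open>e > 0\<close> in auto)
  finally show "outer_content (\<Union>n. A n) \<le> (\<Sum>n. outer_content (A n)) + ennreal e" .
qed

text \<open>Caratheodory's condition for open sets. Exhaust \<open>U \<inter> G\<close> by a compact
  \<open>K\<close> first and then \<open>U - K\<close> by a compact \<open>L\<close>: the two are
  disjoint, so superadditivity bounds the sum of their contents by the inner content of
  \<open>U\<close>.\<close>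

lemma outer_content_split:
  assumes G: "open G"
  shows "outer_content (T \<inter> G) + outer_content (T - G) \<le> outer_content T"
proof (rule ennreal_le_epsilon)
  fix e :: real assume e: "e > 0"
  obtain U where U: "open U" "T \<inter> C \<subseteq> U" "inner_content U \<le> outer_content T + ennreal e"
    using outer_content_approx[OF e] by blast
  have *: "ennreal (l K) + outer_content (T - G) \<le> inner_content U"
    if K: "compact K" "K \<subseteq> U \<inter> G \<inter> C" for K
  proof -
    have op: "open (U - K)"
      using U(1) Hausdorff_compact_closed[OF T2 K(1)] by (rule open_Diff)
    have KL: "ennreal (l K) + ennreal (l L) \<le> inner_content U"
      if L: "compact L" "L \<subseteq> (U - K) \<inter> C" for L
    proof -
      have "ennreal (l K) + ennreal (l L) = ennreal (l K + l L)"
        by (simp add: nonneg)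
      also have "\<dots> \<le> ennreal (l (K \<union> L))"
        using K L by (intro ennreal_leI superadd) blast+
      also have "\<dots> \<le> inner_content U"
        using K L by (intro inner_content_ge compact_Un) blast+
      finally show ?thesis .
    qed
    have "outer_content (T - G) \<le> inner_content (U - K)"
      using U(2) K by (intro outer_content_le op) blast
    then have "ennreal (l K) + outer_content (T - G) \<le> ennreal (l K) + inner_content (U - K)"
      by (rule add_left_mono)
    also have "\<dots> = (SUP L\<in>{L. compact L \<and> L \<subseteq> (U - K) \<inter> C}. ennreal (l K) + ennreal (l L))"
      unfolding inner_content_def[of "U - K"] by (rule ennreal_SUP_add_right) blast
    also have "\<dots> \<le> inner_content U"
      by (rule SUP_least, elim CollectE conjE, rule KL)
    finally show ?thesis .
  qed
  have "outer_content (T \<inter> G) + outer_content (T - G) \<le> inner_content (U \<inter> G) + outer_content (T - G)"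
    using U(1,2) G by (intro add_right_mono outer_content_le open_Int) blast+
  also have "\<dots> = (SUP K\<in>{K. compact K \<and> K \<subseteq> U \<inter> G \<inter> C}. ennreal (l K) + outer_content (T - G))"
    unfolding inner_content_def[of "U \<inter> G"] by (rule ennreal_SUP_add_left[symmetric]) blast
  also have "\<dots> \<le> inner_content U"
    by (rule SUP_least, elim CollectE conjE, rule *)
  also note U(3)
  finally show "outer_content (T \<inter> G) + outer_content (T - G) \<le> outer_content T + ennreal e" .
qed

definition content_measure :: "'a measure" where
  "content_measure = measure_of UNIV (sets borel) outer_content"

lemma outer_measure_space_outer_content: "outer_measure_space (Pow UNIV) outer_content"
  unfolding outer_measure_space_def positive_def increasing_def countably_subadditive_def
  by (auto simp: outer_content_empty outer_content_mono outer_content_UN)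

lemma measure_space_outer_content: "measure_space UNIV (sets borel) outer_content"
proof -
  interpret sigma_algebra UNIV "Pow UNIV :: 'a set set" by (rule sigma_algebra_Pow)
  have ms: "measure_space UNIV (lambda_system UNIV (Pow UNIV) outer_content) outer_content"
    by (rule caratheodory_lemma[OF outer_measure_space_outer_content])
  have "G \<in> lambda_system UNIV (Pow UNIV) outer_content" if G: "open G" for G
    unfolding lambda_system_eq
  proof (intro CollectI conjI ballI)
    fix T
    have "outer_content T \<le> outer_content (T \<inter> G) + outer_content (T - G)"
    proof -
      let ?A = "\<lambda>n::nat. if n = 0 then T \<inter> G else if n = 1 then T - G else {}"
      have "T = (\<Union>n. ?A n)" by (auto split: if_splits)
      then have "outer_content T = outer_content (\<Union>n. ?A n)" by simp
      also have "\<dots> \<le> (\<Sum>n. outer_content (?A n))" by (rule outer_content_UN)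
      also have "\<dots> = (\<Sum>n\<in>{0,1}. outer_content (?A n))"
        by (rule suminf_finite) (auto simp: outer_content_empty)
      finally show ?thesis by simp
    qed
    with outer_content_split[OF G] show "outer_content (T \<inter> G) + outer_content (T - G) = outer_content T"
      by (metis antisym)
  qed auto
  moreover have "sigma_algebra UNIV (lambda_system UNIV (Pow UNIV) outer_content)"
    using ms by (simp add: measure_space_def)
  ultimately have "sets (borel :: 'a measure) \<subseteq> lambda_system UNIV (Pow UNIV) outer_content"
    unfolding borel_def sets_measure_of[OF subset_UNIV[of "Collect open", unfolded Pow_UNIV[symmetric]]]
    by (intro sigma_algebra.sigma_sets_subset) auto
  then show ?thesis
    by (intro measure_down[OF ms]) (metis sets.sigma_algebra_axioms space_borel)
qed

lemma sets_content_measure [simp]: "sets content_measure = sets borel"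
  and space_content_measure [simp]: "space content_measure = UNIV"
  unfolding content_measure_def using sets.sets_measure_of_eq[of borel] sets.space_measure_of_eq[of borel]
  by simp_all

lemma emeasure_content_measure: "A \<in> sets borel \<Longrightarrow> emeasure content_measure A = outer_content A"
  unfolding content_measure_def using measure_space_outer_content
  by (intro emeasure_measure_of_sigma) (auto simp: measure_space_def)

lemma emeasure_content_measure_C: "emeasure content_measure C = 1"
proof -
  have "1 \<le> outer_content C"
    unfolding outer_content_def
  proof (rule INF_greatest, elim CollectE conjE)
    fix U assume "C \<inter> C \<subseteq> U"
    then show "1 \<le> inner_content U"
      using inner_content_ge[OF compact_C, of U] by (simp add: l_C)
  qed
  then show ?thesis
    using outer_content_le_1[of C] Hausdorff_compact_closed[OF T2 compact_C]
    by (intro antisym) (simp_all add: emeasure_content_measure)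
qed

lemma prob_space_content_measure: "prob_space content_measure"
proof
  have "1 \<le> emeasure content_measure UNIV"
    using emeasure_content_measure_C by (metis emeasure_mono sets.top sets_content_measure space_content_measure subset_UNIV)
  then show "emeasure content_measure (space content_measure) = 1"
    using outer_content_le_1[of UNIV] by (intro antisym) (simp_all add: emeasure_content_measure)
qed

text \<open>Inner regularity by complementation: an open \<open>U\<close> that covers
  \<open>- B\<close> within \<open>C\<close> with little excess leaves the compact subset
  \<open>C - U\<close> of \<open>B\<close>.\<close>

lemma radon_content_measure: "radon_prob_measure content_measure"
  unfolding radon_prob_measure_def
proof (intro conjI ballI allI impI)
  interpret prob_space content_measure by (rule prob_space_content_measure)
  have CB: "C \<in> sets borel" using Hausdorff_compact_closed[OF T2 compact_C] by simp
  fix B :: "'a set" and a :: ennreal assume B: "B \<in> sets borel" and a: "a < emeasure content_measure B"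
  have BC: "emeasure content_measure (B \<inter> C) = emeasure content_measure B"
  proof -
    have "emeasure content_measure (- C) = 0"
      using emeasure_compl[of C content_measure] emeasure_content_measure_C CB emeasure_space_1
      by (simp add: Compl_eq_Diff_UNIV)
    then have "- C \<in> null_sets content_measure" using CB by (simp add: null_sets_def)
    then have "emeasure content_measure (B - (- C)) = emeasure content_measure B"
      using B by (intro emeasure_Diff_null_set) auto
    then show ?thesis by (simp add: Diff_eq)
  qed
  define b where "b = measure content_measure (B \<inter> C)"
  have b: "emeasure content_measure (B \<inter> C) = ennreal b"
    by (simp add: b_def emeasure_eq_measure)
  obtain a' where a': "a = ennreal a'" "0 \<le> a'" "a' < b"
    using a unfolding BC[symmetric] b by (cases a) (auto simp: ennreal_less_iff)
  \<comment> \<open>Half the gap: \<open>C - U\<close> will have measure at least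
    \<open>b - e\<close>, which is still above \<open>a'\<close>.\<close>
  define e where "e = (b - a') / 2"
  have e: "e > 0" using a' by (simp add: e_def)
  obtain U where U: "open U" "(- B) \<inter> C \<subseteq> U" "inner_content U \<le> outer_content (- B) + ennreal e"
    using outer_content_approx[OF e] by blast
  have "outer_content (- B) = ennreal (1 - b)"
  proof -
    have "emeasure content_measure (- B) = 1 - ennreal b"
      using emeasure_compl[of B content_measure] B BC b emeasure_space_1
      by (simp add: Compl_eq_Diff_UNIV)
    then show ?thesis
      using B by (simp add: emeasure_content_measure ennreal_minus b_def flip: ennreal_1)
  qed
  then have "emeasure content_measure U \<le> ennreal (1 - b) + ennreal e"
    using U by (simp add: emeasure_content_measure outer_content_open)
  then have "ennreal (prob U) \<le> ennreal (1 - b + e)"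
    using e b_def by (simp add: emeasure_eq_measure)
  then have pU: "prob U \<le> 1 - b + e"
    using e b_def prob_le_1 by (subst (asm) ennreal_le_iff) auto
  have "prob C = 1"
    using emeasure_content_measure_C by (simp add: measure_def)
  then have "1 \<le> prob ((C - U) \<union> U)"
    using finite_measure_mono[of C "(C - U) \<union> U"] CB U(1) by auto
  also have "\<dots> \<le> prob (C - U) + prob U"
    using CB U(1) by (intro measure_Un_le) auto
  finally have "a' < prob (C - U)"
    using pU a' by (simp add: e_def field_simps)
  then show "\<exists>K. compact K \<and> K \<subseteq> B \<and> a < emeasure content_measure K"
    using U(2) a' by (intro exI[of _ "C - U"])
      (auto simp: emeasure_eq_measure compact_Diff_open[OF compact_C U(1)] ennreal_less_iff)
qed (simp_all add: prob_space_content_measure)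

end

section \<open>Left-invariant Radon measures on compact sets\<close>

definition sym_nhd :: "'a::topological_group_add set \<Rightarrow> bool" where
  "sym_nhd V \<longleftrightarrow> open V \<and> 0 \<in> V \<and> (\<forall>x\<in>V. - x \<in> V)"

lemma sym_nhdD:
  assumes "sym_nhd V" shows "open V" "0 \<in> V" "x \<in> V \<Longrightarrow> - x \<in> V"
  using assms by (auto simp: sym_nhd_def)

lemma sym_nhd_Int: "sym_nhd U \<Longrightarrow> sym_nhd V \<Longrightarrow> sym_nhd (U \<inter> V)"
  by (auto simp: sym_nhd_def)

lemma sym_nhd_UNIV: "sym_nhd UNIV"
  by (simp add: sym_nhd_def)

lemma sym_nhd_INT:
  assumes "finite I" "\<And>i. i \<in> I \<Longrightarrow> sym_nhd (V i)"
  shows "sym_nhd (\<Inter>i\<in>I. V i)"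
  using assms by (auto simp: sym_nhd_def)

lemma continuous_on_minus_group [continuous_intros]:
  fixes f :: "'c::topological_space \<Rightarrow> 'a::topological_group_add"
  assumes "continuous_on S f" shows "continuous_on S (\<lambda>x. - f x)"
  using assms unfolding continuous_on_def by (auto intro: tendsto_minus)

lemma open_preimage:
  "continuous_on UNIV f \<Longrightarrow> open U \<Longrightarrow> open {x. f x \<in> U}"
  using open_vimage[of U f] by (simp add: vimage_def)

lemma image_plus_left: "(+) a ` U = {x::'a::group_add. - a + x \<in> U}"
  by (auto intro!: image_eqI[where x="- a + _"] simp: add.assoc[symmetric])

lemma open_plus_left: "open U \<Longrightarrow> open ((+) a ` U)" for a :: "'a::topological_group_add"
  unfolding image_plus_left by (intro open_preimage continuous_intros)

lemma compact_plus_left: "compact U \<Longrightarrow> compact ((+) a ` U)" for a :: "'a::topological_group_add"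
  by (intro compact_continuous_image continuous_intros)

lemma sym_nhd_subset:
  fixes U :: "'a::topological_group_add set"
  assumes "open U" "0 \<in> U"
  obtains V where "sym_nhd V" "V \<subseteq> U"
proof
  show "sym_nhd (U \<inter> {x. - x \<in> U})"
    unfolding sym_nhd_def using assms by (auto intro!: open_Int open_preimage continuous_intros)
qed auto

lemma sym_nhd_half:
  fixes U :: "'a::topological_group_add set"
  assumes "open U" "0 \<in> U"
  obtains V where "sym_nhd V" "\<And>x y. x \<in> V \<Longrightarrow> y \<in> V \<Longrightarrow> x + y \<in> U"
proof -
  have "((\<lambda>x::'a \<times> 'a. fst x + snd x) \<longlongrightarrow> 0 + 0) (nhds 0 \<times>\<^sub>F nhds 0)"
    by (rule tendsto_add_Pair)
  then have "eventually (\<lambda>x. fst x + snd x \<in> U) (nhds (0::'a) \<times>\<^sub>F nhds (0::'a))"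
    using assms unfolding tendsto_def by simp
  then obtain P Q where PQ: "eventually P (nhds (0::'a))" "eventually Q (nhds (0::'a))"
      "\<And>x y. P x \<Longrightarrow> Q y \<Longrightarrow> x + y \<in> U"
    unfolding eventually_prod_filter by auto
  from PQ(1,2) obtain A B where AB: "open A" "0 \<in> A" "\<And>x. x \<in> A \<Longrightarrow> P x" "open B" "0 \<in> B" "\<And>x. x \<in> B \<Longrightarrow> Q x"
    unfolding eventually_nhds by blast
  obtain V where "sym_nhd V" "V \<subseteq> A \<inter> B"
    using sym_nhd_subset[of "A \<inter> B"] AB by blast
  then show thesis using that PQ(3) AB by blast
qed

lemma sym_nhd_third:
  fixes U :: "'a::topological_group_add set"
  assumes "open U" "0 \<in> U"
  obtains V where "sym_nhd V" "\<And>x y z. x \<in> V \<Longrightarrow> y \<in> V \<Longrightarrow> z \<in> V \<Longrightarrow> x + y + z \<in> U"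
proof -
  obtain W where W: "sym_nhd W" "\<And>x y. x \<in> W \<Longrightarrow> y \<in> W \<Longrightarrow> x + y \<in> U"
    using sym_nhd_half[OF assms] by blast
  obtain V where V: "sym_nhd V" "\<And>x y. x \<in> V \<Longrightarrow> y \<in> V \<Longrightarrow> x + y \<in> W"
    using sym_nhd_half[of W] W by (metis sym_nhd_def)
  show thesis
  proof (rule that[OF V(1)])
    fix x y z assume "x \<in> V" "y \<in> V" "z \<in> V"
    then show "x + y + z \<in> U"
      using W(2)[of "x + y" z] V(2)[of x y] V(2)[of z 0] sym_nhdD(2)[OF V(1)] by simp
  qed
qed

lemma sym_nhd_conj:
  fixes U :: "'a::topological_group_add set"
  assumes "finite F" "open U" "0 \<in> U"
  obtains V where "sym_nhd V" "\<And>p x. p \<in> F \<Longrightarrow> x \<in> V \<Longrightarrow> p + x - p \<in> U"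
proof -
  have "open (\<Inter>p\<in>F. {x. p + x - p \<in> U})"
    unfolding diff_conv_add_uminus using assms
    by (intro open_INT) (auto intro!: open_preimage continuous_intros)
  moreover have "0 \<in> (\<Inter>p\<in>F. {x. p + x - p \<in> U})" using assms by auto
  ultimately obtain V where "sym_nhd V" "V \<subseteq> (\<Inter>p\<in>F. {x. p + x - p \<in> U})"
    using sym_nhd_subset by blast
  then show thesis using that by blast
qed

lemma closure_approach_right:
  fixes A :: "'a::topological_group_add set"
  assumes "x \<in> closure A" "open V" "0 \<in> V"
  obtains v where "v \<in> V" "x + v \<in> A"
proof -
  have "open {y. - x + y \<in> V}" using assms by (intro open_preimage continuous_intros)
  then have "{y. - x + y \<in> V} \<inter> A \<noteq> {}"
  proof -
    have "x \<in> {y. - x + y \<in> V} \<inter> closure A" using assms by simp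
    then show ?thesis using open_Int_closure_eq_empty[OF \<open>open {y. - x + y \<in> V}\<close>] by blast
  qed
  then obtain a where "a \<in> A" "- x + a \<in> V" by auto
  then show thesis using that[of "-x + a"] by (simp add: add.assoc[symmetric])
qed

text \<open>Halve the neighbourhood at each point of \<open>K\<close>: one half leads from a centre
  of the finite subcover to \<open>k\<close>, the other is the freedom left for
  \<open>v\<close>.\<close>

lemma compact_sym_nhd_right:
  fixes K :: "'a::topological_group_add set"
  assumes K: "compact K" and O: "open O'" "K \<subseteq> O'"
  obtains V where "sym_nhd V" "\<And>k v. k \<in> K \<Longrightarrow> v \<in> V \<Longrightarrow> k + v \<in> O'"
proof -
  have "\<exists>V. sym_nhd V \<and> (\<forall>x\<in>V. \<forall>y\<in>V. k + (x + y) \<in> O')" if "k \<in> K" for k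
  proof -
    have "open {x. k + x \<in> O'}" using O by (intro open_preimage continuous_intros)
    moreover have "0 \<in> {x. k + x \<in> O'}" using that O by auto
    ultimately obtain V where "sym_nhd V" "\<And>x y. x \<in> V \<Longrightarrow> y \<in> V \<Longrightarrow> x + y \<in> {x. k + x \<in> O'}"
      by (rule sym_nhd_half) blast
    then show ?thesis by blast
  qed
  then obtain V where V: "\<And>k. k \<in> K \<Longrightarrow> sym_nhd (V k)"
      "\<And>k x y. k \<in> K \<Longrightarrow> x \<in> V k \<Longrightarrow> y \<in> V k \<Longrightarrow> k + (x + y) \<in> O'"
    by metis
  have "\<exists>I\<subseteq>K. finite I \<and> K \<subseteq> (\<Union>k\<in>I. (+) k ` V k)"
  proof (rule compactE_image[OF K])
    show "\<And>k. k \<in> K \<Longrightarrow> open ((+) k ` V k)" using V(1) by (intro open_plus_left) (auto simp: sym_nhd_def)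
    show "K \<subseteq> (\<Union>k\<in>K. (+) k ` V k)" using V(1) by (force simp: sym_nhd_def)
  qed blast
  then obtain I where I: "I \<subseteq> K" "finite I" "K \<subseteq> (\<Union>k\<in>I. (+) k ` V k)" by blast
  show thesis
  proof (rule that[of "\<Inter>k\<in>I. V k"])
    show "sym_nhd (\<Inter>k\<in>I. V k)" using I V(1) by (intro sym_nhd_INT) auto
    fix k v assume "k \<in> K" "v \<in> (\<Inter>k\<in>I. V k)"
    with I obtain j x where "j \<in> I" "x \<in> V j" "k = j + x" "v \<in> V j" by blast
    then show "k + v \<in> O'" using V(2)[of j x v] I by (auto simp: add.assoc)
  qed
qed

lemma compact_sym_nhd_left:
  fixes K :: "'a::topological_group_add set"
  assumes K: "compact K" and O: "open O'" "K \<subseteq> O'"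
  obtains V where "sym_nhd V" "\<And>k v. k \<in> K \<Longrightarrow> v \<in> V \<Longrightarrow> v + k \<in> O'"
proof -
  have "compact (uminus ` K)" using K by (intro compact_continuous_image continuous_intros)
  moreover have "open {x. - x \<in> O'}" using O by (intro open_preimage continuous_intros)
  ultimately obtain V where V: "sym_nhd V" "\<And>k v. k \<in> uminus ` K \<Longrightarrow> v \<in> V \<Longrightarrow> k + v \<in> {x. - x \<in> O'}"
    using O by (elim compact_sym_nhd_right[of "uminus ` K" "{x. - x \<in> O'}"]) auto
  show thesis
  proof (rule that[OF V(1)])
    fix k v assume "k \<in> K" "v \<in> V"
    then show "v + k \<in> O'"
      using V(2)[of "- k" "- v"] sym_nhdD(3)[OF V(1)] by (auto simp: minus_add)
  qed
qed

section \<open>Covering numbers by left translates\<close>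

definition covers :: "'a::group_add set \<Rightarrow> 'a set \<Rightarrow> 'a set \<Rightarrow> bool" where
  "covers U K S \<longleftrightarrow> finite S \<and> K \<subseteq> (\<Union>s\<in>S. (+) s ` U)"

text \<open>Haar's index \<open>(K : U)\<close>, counted with left translates so that left
  translation of \<open>K\<close> does not change it.\<close>

definition covering_number :: "'a::group_add set \<Rightarrow> 'a set \<Rightarrow> nat" where
  "covering_number U K = (LEAST n. \<exists>S. covers U K S \<and> card S = n)"

lemma covers_exists:
  assumes "sym_nhd U" "compact K" shows "\<exists>S. covers U K S"
proof -
  have "\<exists>I\<subseteq>K. finite I \<and> K \<subseteq> (\<Union>k\<in>I. (+) k ` U)"
  proof (rule compactE_image[OF assms(2)])
    show "\<And>k. k \<in> K \<Longrightarrow> open ((+) k ` U)" using assms(1) by (intro open_plus_left) (auto simp: sym_nhd_def)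
    show "K \<subseteq> (\<Union>k\<in>K. (+) k ` U)" using assms(1) by (force simp: sym_nhd_def)
  qed blast
  then show ?thesis by (auto simp: covers_def)
qed

lemma covering_number_le: "covers U K S \<Longrightarrow> covering_number U K \<le> card S"
  unfolding covering_number_def by (rule Least_le) auto

lemma covering_number_attained:
  assumes "sym_nhd U" "compact K"
  obtains S where "covers U K S" "card S = covering_number U K"
proof -
  have "\<exists>n S. covers U K S \<and> card S = n" using covers_exists[OF assms] by blast
  then show thesis using LeastI_ex[of "\<lambda>n. \<exists>S. covers U K S \<and> card S = n"] that
    unfolding covering_number_def by blast
qed

lemma covering_number_mono:
  assumes "sym_nhd U" "compact L" "K \<subseteq> L"
  shows "covering_number U K \<le> covering_number U L"
proof -
  obtain S where "covers U L S" "card S = covering_number U L"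
    using covering_number_attained assms by blast
  then show ?thesis using covering_number_le[of U K S] assms(3) by (auto simp: covers_def)
qed

lemma covering_number_Un:
  assumes "sym_nhd U" "compact K" "compact L"
  shows "covering_number U (K \<union> L) \<le> covering_number U K + covering_number U L"
proof -
  obtain S where S: "covers U K S" "card S = covering_number U K"
    using covering_number_attained assms by blast
  obtain T where T: "covers U L T" "card T = covering_number U L"
    using covering_number_attained assms by blast
  have "covers U (K \<union> L) (S \<union> T)" using S T by (auto simp: covers_def)
  then show ?thesis using covering_number_le[of U "K \<union> L" "S \<union> T"] card_Un_le[of S T] S T by linarith
qed

text \<open>A translate that cannot meet both sets serves only one of them, so an optimal cover of
  the union splits.\<close>

lemma covering_number_Un_disjoint:
  assumes U: "sym_nhd U" "compact K" "compact L"
    and sep: "\<And>s. (+) s ` U \<inter> K = {} \<or> (+) s ` U \<inter> L = {}"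
  shows "covering_number U K + covering_number U L \<le> covering_number U (K \<union> L)"
proof -
  obtain S where S: "covers U (K \<union> L) S" "card S = covering_number U (K \<union> L)"
    using covering_number_attained[of U "K \<union> L"] assms by blast
  let ?A = "{s\<in>S. (+) s ` U \<inter> K \<noteq> {}}" and ?B = "{s\<in>S. (+) s ` U \<inter> L \<noteq> {}}"
  have "covers U K ?A" "covers U L ?B" using S by (fastforce simp: covers_def)+
  then have "covering_number U K + covering_number U L \<le> card ?A + card ?B"
    by (intro add_mono covering_number_le)
  also have "\<dots> = card (?A \<union> ?B)"
    using S sep by (intro card_Un_disjoint[symmetric]) (auto simp: covers_def)
  also have "\<dots> \<le> card S" using S by (intro card_mono) (auto simp: covers_def)
  finally show ?thesis using S by simp
qed

lemma covering_number_translate_le: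
  assumes "sym_nhd U" "compact K"
  shows "covering_number U ((+) v ` K) \<le> covering_number U K"
proof -
  obtain S where S: "covers U K S" "card S = covering_number U K"
    using covering_number_attained assms by blast
  have "covers U ((+) v ` K) ((+) v ` S)"
    unfolding covers_def
  proof safe
    show "finite ((+) v ` S)" using S by (auto simp: covers_def)
    fix k assume "k \<in> K"
    then obtain s u where "s \<in> S" "u \<in> U" "k = s + u" using S by (auto simp: covers_def)
    then show "v + k \<in> (\<Union>s\<in>(+) v ` S. (+) s ` U)"
      by (auto intro!: bexI[of _ s] image_eqI[of _ _ u] simp: add.assoc)
  qed
  then have "covering_number U ((+) v ` K) \<le> card ((+) v ` S)" by (rule covering_number_le)
  also have "\<dots> = card S" by (intro card_image inj_onI) simp
  finally show ?thesis using S by simp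
qed

lemma covering_number_translate:
  assumes "sym_nhd U" "compact K"
  shows "covering_number U ((+) v ` K) = covering_number U K"
proof (rule antisym[OF covering_number_translate_le[OF assms]])
  have "(+) (- v) ` (+) v ` K = K" by (auto simp: image_image add.assoc[symmetric])
  then show "covering_number U K \<le> covering_number U ((+) v ` K)"
    using covering_number_translate_le[OF assms(1) compact_plus_left[OF assms(2)], of "- v" v] by simp
qed

lemma covering_number_pos:
  assumes "sym_nhd U" "compact K" "K \<noteq> {}"
  shows "covering_number U K > 0"
proof -
  obtain S where "covers U K S" "card S = covering_number U K"
    using covering_number_attained assms by blast
  then show ?thesis using assms(3) by (auto simp: covers_def card_gt_0_iff)
qed

section \<open>Invariant contents and measures as limits of covering ratios\<close>

text \<open>Normalising by \<open>C\<close> itself, which may have empty interior, bounds the ratio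
  by 1 on compact subsets of \<open>C\<close>. The value 0 elsewhere makes
  \<open>covering_ratio C U\<close> a point of the unit cube over all sets, where Tychonoff's
  theorem applies.\<close>

definition covering_ratio :: "'a::topological_group_add set \<Rightarrow> 'a set \<Rightarrow> 'a set \<Rightarrow> real" where
  "covering_ratio C U K = (if compact K \<and> K \<subseteq> C
    then real (covering_number U K) / real (covering_number U C) else 0)"

lemma compact_unit_cube: "compact {f :: 'i \<Rightarrow> real. \<forall>i. 0 \<le> f i \<and> f i \<le> 1}"
proof -
  have "compactin (product_topology (\<lambda>i::'i. euclidean) UNIV) (PiE UNIV (\<lambda>i. {0..1::real}))"
    by (subst compactin_PiE) auto
  then have "compact (PiE UNIV (\<lambda>i::'i. {0..1::real}))"
    by (simp add: euclidean_product_topology)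
  moreover have "PiE UNIV (\<lambda>i::'i. {0..1::real}) = {f. \<forall>i. 0 \<le> f i \<and> f i \<le> 1}"
    by (auto simp: PiE_def Pi_def)
  ultimately show ?thesis by simp
qed

lemma closed_Collect_coords:
  fixes K L M :: "'i"
  shows "closed {f :: 'i \<Rightarrow> real. f K \<le> f L}" "closed {f :: 'i \<Rightarrow> real. f K \<le> f L + f M}"
    "closed {f :: 'i \<Rightarrow> real. f L + f M \<le> f K}" "closed {f :: 'i \<Rightarrow> real. f K = c}"
  by (intro closed_Collect_le closed_Collect_eq continuous_intros continuous_on_product_coordinates)+

text \<open>A cluster point of the ratios as \<open>U\<close> shrinks. For given sets, each content
  axiom is a closed condition on finitely many coordinates, so it passes to the limit once it holds
  for all small \<open>U\<close>.\<close>

theorem left_invariant_content_exists: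
  fixes C :: "'a::topological_group_add set"
  assumes T2: "Hausdorff_space (euclidean :: 'a topology)" and C: "compact C" "C \<noteq> {}"
  obtains l where "compact_content C l"
    "\<And>K v. compact K \<Longrightarrow> K \<subseteq> C \<Longrightarrow> (+) v ` K \<subseteq> C \<Longrightarrow> l ((+) v ` K) = l K"
proof -
  let ?r = "covering_ratio C"
  define E where "E V = {?r U | U. sym_nhd U \<and> U \<subseteq> V}" for V :: "'a set"
  let ?B = "{f :: 'a set \<Rightarrow> real. \<forall>i. 0 \<le> f i \<and> f i \<le> 1}"
  have rB: "?r U \<in> ?B" if "sym_nhd U" for U
    using covering_number_mono[OF that C(1)] covering_number_pos[OF that C]
    by (auto simp: covering_ratio_def divide_simps)
  have "?B \<inter> (\<Inter>V\<in>{V. sym_nhd V}. closure (E V)) \<noteq> {}"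
  proof (rule compact_imp_fip_image[OF compact_unit_cube])
    fix I assume I: "finite I" "I \<subseteq> {V :: 'a set. sym_nhd V}"
    have s: "sym_nhd (\<Inter>V\<in>I. V)" using I by (intro sym_nhd_INT) auto
    have "?r (\<Inter>V\<in>I. V) \<in> (\<Inter>V\<in>I. closure (E V))"
      using s by (auto simp: E_def intro!: closure_subset[THEN subsetD])
    then show "?B \<inter> (\<Inter>V\<in>I. closure (E V)) \<noteq> {}" using rB[OF s] by blast
  qed auto
  then obtain l where l: "l \<in> ?B" "\<And>V. sym_nhd V \<Longrightarrow> l \<in> closure (E V)" by auto
  have transfer: "P l" if "closed {f. P f}" "sym_nhd V" "\<And>U. sym_nhd U \<Longrightarrow> U \<subseteq> V \<Longrightarrow> P (?r U)" for P V
  proof -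
    have "closure (E V) \<subseteq> {f. P f}" using that by (intro closure_minimal) (auto simp: E_def)
    then show ?thesis using l(2)[OF that(2)] by blast
  qed
  note cn = of_nat_0_less_iff[where 'a=real, THEN iffD2, OF covering_number_pos[OF _ C]]
  show thesis
  proof (rule that[of l])
    show "compact_content C l"
    proof
      show "Hausdorff_space (euclidean :: 'a topology)" "compact C" by fact+
      show "0 \<le> l K" for K using l(1) by auto
      show "l C = 1"
        by (rule transfer[OF closed_Collect_coords(4) sym_nhd_UNIV])
           (use C cn in \<open>auto simp: covering_ratio_def dest: covering_number_pos[OF _ C]\<close>)
    next
      fix K L assume KL: "compact K" "compact L" "K \<subseteq> L" "L \<subseteq> C"
      show "l K \<le> l L"
        by (rule transfer[OF closed_Collect_coords(1) sym_nhd_UNIV])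
           (use KL covering_number_mono[OF _ KL(2,3)] in \<open>auto simp: covering_ratio_def divide_right_mono\<close>)
    next
      fix K L assume KL: "compact K" "compact L" "K \<subseteq> C" "L \<subseteq> C"
      show "l (K \<union> L) \<le> l K + l L"
      proof (rule transfer[OF closed_Collect_coords(2) sym_nhd_UNIV])
        fix U :: "'a set" assume "sym_nhd U"
        then show "?r U (K \<union> L) \<le> ?r U K + ?r U L"
          using covering_number_Un[OF _ KL(1,2)] KL
          by (auto simp: covering_ratio_def compact_Un add_divide_distrib[symmetric] intro!: divide_right_mono
              simp flip: of_nat_add)
      qed
      assume dis: "K \<inter> L = {}"
      \<comment> \<open>For points \<open>x\<close>, \<open>y\<close> of one translate of a
        symmetric subset of \<open>V\<close>, the difference \<open>- x + y\<close> lies in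
        \<open>W\<close>, which cannot lead from \<open>K\<close> to \<open>L\<close>. So such a
        translate never meets both.\<close>
      have "open (- L)" using Hausdorff_compact_closed[OF T2 KL(2)] by (rule open_Compl)
      moreover have "K \<subseteq> - L" using dis by auto
      ultimately obtain W where W: "sym_nhd W" "\<And>k v. k \<in> K \<Longrightarrow> v \<in> W \<Longrightarrow> k + v \<in> - L"
        using compact_sym_nhd_right[OF KL(1)] by metis
      obtain V where V: "sym_nhd V" "\<And>x y. x \<in> V \<Longrightarrow> y \<in> V \<Longrightarrow> x + y \<in> W"
        using sym_nhd_half[of W] W by (metis sym_nhd_def)
      show "l K + l L \<le> l (K \<union> L)"
      proof (rule transfer[OF closed_Collect_coords(3) V(1)])
        fix U :: "'a set" assume U: "sym_nhd U" "U \<subseteq> V"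
        have "(+) s ` U \<inter> K = {} \<or> (+) s ` U \<inter> L = {}" for s
        proof (rule ccontr)
          assume "\<not> ((+) s ` U \<inter> K = {} \<or> (+) s ` U \<inter> L = {})"
          then obtain u u' where u: "u \<in> U" "s + u \<in> K" "u' \<in> U" "s + u' \<in> L" by auto
          have "- u + u' \<in> W" using u U V(2)[of "- u" u'] sym_nhdD(3)[OF U(1)] by auto
          then have "(s + u) + (- u + u') \<in> - L" using W(2) u by blast
          moreover have "(s + u) + (- u + u') = s + u'" by (simp add: add.assoc)
          ultimately show False using u by simp
        qed
        then show "?r U K + ?r U L \<le> ?r U (K \<union> L)"
          using covering_number_Un_disjoint[OF U(1) KL(1,2)] KL
          by (auto simp: covering_ratio_def compact_Un add_divide_distrib[symmetric] intro!: divide_right_mono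
              simp flip: of_nat_add)
      qed
    qed
  next
    fix K v assume K: "compact K" "K \<subseteq> C" "(+) v ` K \<subseteq> C"
    have "closed {f :: 'a set \<Rightarrow> real. f ((+) v ` K) = f K}"
      by (intro closed_Collect_eq continuous_on_product_coordinates)
    then show "l ((+) v ` K) = l K"
      by (rule transfer[OF _ sym_nhd_UNIV])
         (use K in \<open>auto simp: covering_ratio_def covering_number_translate compact_plus_left\<close>)
  qed
qed

text \<open>\<open>D\<close> and its translate are relatively open in \<open>C\<close>. Removing
  from the translate of an open \<open>U\<close> the compact complement in \<open>C\<close> of the
  translated \<open>D\<close> leaves an open set whose compact subsets in \<open>C\<close> are
  translates of compact subsets of \<open>U \<inter> D\<close>, where the content is invariant. The
  inequality for \<open>- v\<close> gives the converse.\<close>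

lemma compact_content_translate_le:
  fixes C :: "'a::topological_group_add set"
  assumes l: "compact_content C l"
    and inv: "\<And>K v. compact K \<Longrightarrow> K \<subseteq> C \<Longrightarrow> (+) v ` K \<subseteq> C \<Longrightarrow> l ((+) v ` K) = l K"
    and D: "D \<subseteq> C" "compact (C - D)" "(+) v ` D \<subseteq> C" "compact (C - (+) v ` D)"
    and E: "E \<subseteq> D"
  shows "compact_content.outer_content C l ((+) v ` E) \<le> compact_content.outer_content C l E"
proof -
  interpret compact_content C l by fact
  show ?thesis
    unfolding outer_content_def[of E]
  proof (rule INF_greatest, elim CollectE conjE)
    fix U assume U: "open U" "E \<inter> C \<subseteq> U"
    let ?O = "(+) v ` U - (C - (+) v ` D)"
    have op: "open ?O"
      using U(1) D(4) by (intro open_Diff open_plus_left Hausdorff_compact_closed[OF T2])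
    have "outer_content ((+) v ` E) \<le> inner_content ?O"
      using U(2) E D by (intro outer_content_le op) blast
    also have "\<dots> \<le> inner_content U"
      unfolding inner_content_def[of ?O]
    proof (rule SUP_least, elim CollectE conjE)
      fix K assume K: "compact K" "K \<subseteq> ?O \<inter> C"
      let ?L = "(+) (- v) ` K"
      have L: "?L \<subseteq> U \<inter> D"
        using K(2) by (fastforce simp: add.assoc[symmetric])
      have vL: "(+) v ` ?L = K" by (auto simp: image_image add.assoc[symmetric])
      have "l K = l ?L"
        using inv[of ?L v] L K D compact_plus_left[OF K(1), of "- v"] unfolding vL by blast
      also have "ennreal (l ?L) \<le> inner_content U"
        using L D by (intro inner_content_ge compact_plus_left K) auto
      finally show "ennreal (l K) \<le> inner_content U" .
    qed
    finally show "outer_content ((+) v ` E) \<le> inner_content U" .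
  qed
qed

theorem left_invariant_radon_measure_exists:
  fixes C :: "'a::topological_group_add set"
  assumes T2: "Hausdorff_space (euclidean :: 'a topology)" and C: "compact C" "C \<noteq> {}"
  obtains M where "radon_prob_measure M" "emeasure M C = 1"
    "\<And>D v K. D \<subseteq> C \<Longrightarrow> compact (C - D) \<Longrightarrow> (+) v ` D \<subseteq> C \<Longrightarrow> compact (C - (+) v ` D) \<Longrightarrow>
      compact K \<Longrightarrow> K \<subseteq> D \<Longrightarrow> emeasure M ((+) v ` K) = emeasure M K"
proof -
  obtain l where l: "compact_content C l"
    "\<And>K v. compact K \<Longrightarrow> K \<subseteq> C \<Longrightarrow> (+) v ` K \<subseteq> C \<Longrightarrow> l ((+) v ` K) = l K"
    using left_invariant_content_exists[OF assms] by blast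
  interpret compact_content C l by (rule l)
  show thesis
  proof (rule that[OF radon_content_measure emeasure_content_measure_C])
    fix D v K assume D: "D \<subseteq> C" "compact (C - D)" "(+) v ` D \<subseteq> C" "compact (C - (+) v ` D)"
      and K: "compact K" "K \<subseteq> D"
    have "outer_content ((+) v ` K) \<le> outer_content K"
      by (rule compact_content_translate_le[OF l D K(2)])
    moreover have "outer_content ((+) (- v) ` ((+) v ` K)) \<le> outer_content ((+) v ` K)"
      by (rule compact_content_translate_le[OF l, of "(+) v ` D"])
        (use D K in \<open>auto simp: image_image add.assoc[symmetric]\<close>)
    moreover have "(+) (- v) ` ((+) v ` K) = K"
      by (auto simp: image_image add.assoc[symmetric])
    ultimately have "outer_content ((+) v ` K) = outer_content K" by (metis antisym)
    then show "emeasure content_measure ((+) v ` K) = emeasure content_measure K"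
      using Hausdorff_compact_closed[OF T2] K(1) compact_plus_left[OF K(1), of v]
      by (simp add: emeasure_content_measure)
  qed
qed

section \<open>Partitions into null sets\<close>

text \<open>Read \<open>sm\<close> as small. The instance to come is a measure on all subsets of an
  index set, restricted to an atom, with the null sets as small sets.\<close>

locale sigma_prime_ideal =
  fixes sm :: "'i set \<Rightarrow> bool"
  assumes sm_subset: "\<And>S T. sm T \<Longrightarrow> S \<subseteq> T \<Longrightarrow> sm S"
    and sm_UN: "\<And>A :: nat \<Rightarrow> 'i set. (\<And>n. sm (A n)) \<Longrightarrow> sm (\<Union>n. A n)"
    and not_sm_UNIV: "\<not> sm UNIV"
    and sm_prime: "\<And>T. sm T \<or> sm (- T)"
    and sm_singleton: "\<And>i. sm {i}"
begin

lemma sm_empty: "sm {}"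
  using sm_subset[OF sm_singleton] by blast

lemma sm_Un: "sm S \<Longrightarrow> sm T \<Longrightarrow> sm (S \<union> T)"
  using sm_UN[of "\<lambda>n. if n = 0 then S else T"]
  by (rule sm_subset) (auto intro: exI[of _ 0] exI[of _ 1])

lemma sm_finite_UN: "finite I \<Longrightarrow> (\<And>i. i \<in> I \<Longrightarrow> sm (A i)) \<Longrightarrow> sm (\<Union>i\<in>I. A i)"
  by (induct I rule: finite_induct) (auto simp: sm_empty intro: sm_Un)

lemma complement_nonempty: "sm T \<Longrightarrow> \<exists>i. i \<notin> T"
  using not_sm_UNIV by (metis UNIV_eq_I)

text \<open>The ideal, pushed forward along \<open>\<theta>\<close>, is closed under unions indexed
  by the elements below any member of \<open>D\<close>. Well-order the indices and take the least
  \<open>\<eta>\<close> that bounds, up to a small set, some map with small fibres; \<open>D\<close>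
  is the initial segment below it (if there is no such \<open>\<eta>\<close>, the identity works).
  Were a union over the indices below \<open>\<xi>\<close> of small sets not small, sending each
  point to the index of a set that contains it would give such a map below
  \<open>\<xi>\<close>.\<close>

lemma reindex:
  obtains \<theta> :: "'i \<Rightarrow> 'i" and D :: "'i set" and lt :: "'i \<Rightarrow> 'i \<Rightarrow> bool" where
    "sm {i. \<theta> i \<notin> D}"
    "\<And>j. sm {i. \<theta> i = j}"
    "\<And>\<xi> N. \<xi> \<in> D \<Longrightarrow> (\<And>j. sm {i. \<theta> i \<in> N j}) \<Longrightarrow> sm {i. \<exists>j. lt j \<xi> \<and> \<theta> i \<in> N j}"
    "\<And>\<xi>. \<xi> \<in> D \<Longrightarrow> sm {i. \<not> lt \<xi> (\<theta> i)}"
proof -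
  obtain r :: "'i rel" where "well_order_on UNIV r" using well_order_on by blast
  then have lin: "linear_order_on UNIV r" and wf: "wf (r - Id)"
    by (auto simp: well_order_on_def)
  define lt where "lt i j \<longleftrightarrow> (i, j) \<in> r - Id" for i j
  have tot: "lt i j \<or> i = j \<or> lt j i" for i j
    using lin by (auto simp: linear_order_on_def total_on_def lt_def)
  define H where "H = {\<eta>. \<exists>\<theta> :: 'i \<Rightarrow> 'i. (\<forall>j. sm {i. \<theta> i = j}) \<and> sm {i. \<not> (lt (\<theta> i) \<eta> \<or> \<theta> i = \<eta>)}}"
  have add: "sm {i. \<exists>j. lt j \<xi> \<and> \<theta> i \<in> N j}"
    if xi: "\<xi> \<notin> H" and N: "\<And>j. sm {i. \<theta> i \<in> N j}" for \<xi> \<theta> N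
  proof (rule ccontr)
    define U where "U = {i. \<exists>j. lt j \<xi> \<and> \<theta> i \<in> N j}"
    assume "\<not> sm {i. \<exists>j. lt j \<xi> \<and> \<theta> i \<in> N j}"
    then have cU: "sm (- U)" using sm_prime[of U] by (auto simp: U_def)
    define \<theta>' where "\<theta>' i = (SOME j. lt j \<xi> \<and> \<theta> i \<in> N j)" for i
    have *: "lt (\<theta>' i) \<xi> \<and> \<theta> i \<in> N (\<theta>' i)" if "i \<in> U" for i
      using that someI_ex[of "\<lambda>j. lt j \<xi> \<and> \<theta> i \<in> N j"] by (auto simp: U_def \<theta>'_def)
    have "sm {i. \<theta>' i = j}" for j
      by (rule sm_subset[OF sm_Un[OF N[of j] cU]]) (use * in auto)
    moreover have "sm {i. \<not> (lt (\<theta>' i) \<xi> \<or> \<theta>' i = \<xi>)}"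
      by (rule sm_subset[OF cU]) (use * in auto)
    ultimately have "\<xi> \<in> H" by (auto simp: H_def)
    with xi show False by blast
  qed
  obtain \<theta> :: "'i \<Rightarrow> 'i" and D where D: "D \<inter> H = {}" and th: "\<And>j. sm {i. \<theta> i = j}" "sm {i. \<theta> i \<notin> D}"
  proof (cases "H = {}")
    case True
    then show thesis using that[of UNIV id] by (simp add: sm_empty sm_singleton)
  next
    case False
    then obtain \<eta> where eta: "\<eta> \<in> H" "\<And>y. lt y \<eta> \<Longrightarrow> y \<notin> H"
      using wf unfolding wf_eq_minimal lt_def by (metis ex_in_conv)
    then obtain \<theta> :: "'i \<Rightarrow> 'i" where th: "\<And>j. sm {i. \<theta> i = j}" "sm {i. \<not> (lt (\<theta> i) \<eta> \<or> \<theta> i = \<eta>)}"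
      by (auto simp: H_def)
    show thesis
    proof (rule that[of "{y. lt y \<eta>}" \<theta>])
      show "sm {i. \<theta> i \<notin> {y. lt y \<eta>}}"
        by (rule sm_subset[OF sm_Un[OF th(2) th(1)[of \<eta>]]]) auto
    qed (use eta th in auto)
  qed
  show thesis
  proof (rule that[of \<theta> D lt])
    fix \<xi> assume xi: "\<xi> \<in> D"
    then have xi': "\<xi> \<notin> H" using D by blast
    have "sm {i. \<exists>j. lt j \<xi> \<and> \<theta> i \<in> {j}}"
      by (rule add[OF xi']) (use th in simp)
    then show "sm {i. \<not> lt \<xi> (\<theta> i)}"
      by (rule sm_subset[OF sm_Un[OF _ th(1)[of \<xi>]]]) (use tot in auto)
  qed (use th add D in blast)+
qed

end

text \<open>A point lying in \<^term>\<open>n\<close> of the sets would violate the hypothesis, so integrating the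
  counting function gives the bound.\<close>

lemma (in prob_space) sum_prob_le:
  assumes A: "finite A" "\<And>i. i \<in> A \<Longrightarrow> K i \<in> events"
    and empty: "\<And>a. a \<subseteq> A \<Longrightarrow> card a = n \<Longrightarrow> space M \<inter> (\<Inter>i\<in>a. K i) = {}"
  shows "(\<Sum>i\<in>A. prob (K i)) \<le> real n"
proof -
  have "(\<Sum>i\<in>A. prob (K i)) = (\<integral>x. (\<Sum>i\<in>A. indicator (K i) x) \<partial>M)"
    using A by (subst Bochner_Integration.integral_sum) (auto simp: emeasure_eq_measure)
  also have "\<dots> \<le> (\<integral>x. real n \<partial>M)"
  proof (rule integral_mono)
    show "integrable M (\<lambda>x. \<Sum>i\<in>A. indicator (K i) x :: real)"
      using A by (intro Bochner_Integration.integrable_sum) (auto simp: emeasure_eq_measure)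
    fix x assume x: "x \<in> space M"
    have "(\<Sum>i\<in>A. indicator (K i) x :: real) = real (card {i\<in>A. x \<in> K i})"
      using A by (simp add: indicator_def sum.If_cases Int_def)
    also have "card {i\<in>A. x \<in> K i} \<le> n"
    proof (rule ccontr)
      assume "\<not> ?thesis"
      then obtain a where "a \<subseteq> {i\<in>A. x \<in> K i}" "card a = n"
        by (metis obtain_subset_with_card_n nat_le_linear)
      then show False using empty[of a] x by auto
    qed
    finally show "(\<Sum>i\<in>A. indicator (K i) x) \<le> real n" by simp
  qed simp
  also have "\<dots> = real n" by (simp add: prob_space)
  finally show ?thesis .
qed

context sigma_prime_ideal begin

text \<open>Call a finite index set good if, for every \<open>n\<close>, almost every choice of \<open>n\<close> further indices leaves
  the intersection of the compact sets nonempty. The empty set is good since the sets have measure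
  bounded below; a maximal set of indices all of whose finite subsets are good is unbounded by the
  additivity of the ideal, and by compactness it leaves a point in all tails.\<close>

lemma no_compact_tail_family:
  fixes \<psi> :: "'x::topological_space \<Rightarrow> 'i" and \<theta> :: "'i \<Rightarrow> 'i"
  assumes T2: "Hausdorff_space (euclidean :: 'x topology)"
    and M: "prob_space M" "sets M = sets borel"
    and D: "sm {i. \<theta> i \<notin> D}"
    and fib: "\<And>j. sm {i. \<theta> i = j}"
    and add: "\<And>\<xi> N. \<xi> \<in> D \<Longrightarrow> (\<And>j. sm {i. \<theta> i \<in> N j}) \<Longrightarrow> sm {i. \<exists>j. lt j \<xi> \<and> \<theta> i \<in> N j}"
    and K: "\<And>\<xi>. \<xi> \<in> D \<Longrightarrow> compact (K \<xi>)" "\<And>\<xi>. \<xi> \<in> D \<Longrightarrow> e < measure M (K \<xi>)"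
    and e: "e > 0"
    and tail: "\<And>\<xi> x. \<xi> \<in> D \<Longrightarrow> x \<in> K \<xi> \<Longrightarrow> \<theta> (\<psi> x) \<in> D \<and> lt \<xi> (\<theta> (\<psi> x))"
  shows False
proof -
  interpret prob_space M by fact
  have spM: "space M = UNIV" using sets_eq_imp_space_eq[OF M(2)] by simp
  define G where "G = rec_nat (\<lambda>a. (\<Inter>\<xi>\<in>a. K \<xi>) \<noteq> {})
    (\<lambda>n Gn a. sm {i. \<not> Gn (insert (\<theta> i) a)})"
  have G0: "G 0 a \<longleftrightarrow> (\<Inter>\<xi>\<in>a. K \<xi>) \<noteq> {}"
    and GS: "G (Suc n) a \<longleftrightarrow> sm {i. \<not> G n (insert (\<theta> i) a)}" for n a
    by (simp_all add: G_def)
  define good where "good a \<longleftrightarrow> (\<forall>n. G n a)" for a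
  have good_insert: "sm {i. \<not> good (insert (\<theta> i) a)}" if "good a" for a
  proof -
    have "sm (\<Union>n. {i. \<not> G n (insert (\<theta> i) a)})"
      using that by (intro sm_UN) (auto simp: good_def GS[symmetric])
    then show ?thesis by (rule sm_subset) (auto simp: good_def)
  qed
  have good_empty: "good {}"
    unfolding good_def
  proof (rule allI, rule ccontr)
    fix n assume n: "\<not> G n {}"
    \<comment> \<open>The ideal is prime, so where an "almost all" fails, the property itself fails
      at almost all indices. The failure of \<open>G n {}\<close> can thus be propagated greedily,
      until any \<open>n\<close> of the chosen indices give compact sets without a common
      point.\<close>
    have "\<exists>A. finite A \<and> card A = k \<and> A \<subseteq> D \<and> (\<forall>a\<subseteq>A. card a \<le> n \<longrightarrow> \<not> G (n - card a) a)" for k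
    proof (induct k)
      case 0 show ?case using n by (intro exI[of _ "{}"]) auto
    next
      case (Suc k)
      then obtain A where A: "finite A" "card A = k" "A \<subseteq> D"
        "\<And>a. a \<subseteq> A \<Longrightarrow> card a \<le> n \<Longrightarrow> \<not> G (n - card a) a" by blast
      let ?P = "{a. a \<subseteq> A \<and> card a < n}"
      have "sm {i. G (n - Suc (card a)) (insert (\<theta> i) a)}" if "a \<in> ?P" for a
      proof -
        have "Suc (n - Suc (card a)) = n - card a" using that by auto
        then have "\<not> sm {i. \<not> G (n - Suc (card a)) (insert (\<theta> i) a)}"
          using A(4)[of a] GS[of "n - Suc (card a)" a] that by auto
        then show ?thesis
          using sm_prime[of "{i. \<not> G (n - Suc (card a)) (insert (\<theta> i) a)}"] by (simp add: Collect_neg_eq)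
      qed
      then have "sm (\<Union>a\<in>?P. {i. G (n - Suc (card a)) (insert (\<theta> i) a)})"
        using A(1) by (intro sm_finite_UN) auto
      moreover have "sm (\<Union>j\<in>A. {i. \<theta> i = j})" using A(1) fib by (intro sm_finite_UN)
      ultimately have "sm ((\<Union>a\<in>?P. {i. G (n - Suc (card a)) (insert (\<theta> i) a)}) \<union> (\<Union>j\<in>A. {i. \<theta> i = j}) \<union> {i. \<theta> i \<notin> D})"
        using D by (intro sm_Un)
      from complement_nonempty[OF this] obtain i where
        "i \<notin> (\<Union>a\<in>?P. {i. G (n - Suc (card a)) (insert (\<theta> i) a)}) \<union> (\<Union>j\<in>A. {i. \<theta> i = j}) \<union> {i. \<theta> i \<notin> D}" ..
      then have i: "\<theta> i \<in> D" "\<theta> i \<notin> A"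
        "\<And>a. a \<subseteq> A \<Longrightarrow> card a < n \<Longrightarrow> \<not> G (n - Suc (card a)) (insert (\<theta> i) a)" by simp_all
      show ?case
      proof (intro exI[of _ "insert (\<theta> i) A"] conjI allI impI)
        fix b assume b: "b \<subseteq> insert (\<theta> i) A" "card b \<le> n"
        show "\<not> G (n - card b) b"
        proof (cases "\<theta> i \<in> b")
          case True
          have fb: "finite b" using b(1) A(1) finite_subset by blast
          have cb: "Suc (card (b - {\<theta> i})) = card b" by (rule card_Suc_Diff1[OF fb True])
          have "b - {\<theta> i} \<subseteq> A" using b(1) by blast
          moreover have "card (b - {\<theta> i}) < n" using cb b(2) by linarith
          ultimately show ?thesis using i(3)[of "b - {\<theta> i}"] unfolding cb insert_Diff[OF True] by blast
        next
          case False then have "b \<subseteq> A" using b(1) by blast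
          then show ?thesis using A(4) b(2) by blast
        qed
      qed (use i(1,2) A(1-3) in simp_all)
    qed
    \<comment> \<open>At least \<open>(n + 1) / e\<close> sets of measure above \<open>e\<close>
      have total measure at least \<open>n + 1\<close>, more than \<open>sum_prob_le\<close>
      permits.\<close>
    from this[of "nat \<lceil>(real n + 1) / e\<rceil>"] obtain A where A: "finite A" "card A = nat \<lceil>(real n + 1) / e\<rceil>" "A \<subseteq> D"
      "\<And>a. a \<subseteq> A \<Longrightarrow> card a \<le> n \<Longrightarrow> \<not> G (n - card a) a" by blast
    have "(\<Sum>\<xi>\<in>A. prob (K \<xi>)) \<le> real n"
    proof (rule sum_prob_le[OF A(1)])
      show "K \<xi> \<in> events" if "\<xi> \<in> A" for \<xi>
        using that A K(1) Hausdorff_compact_closed[OF T2, of "K \<xi>"] M(2) by auto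
      show "space M \<inter> (\<Inter>i\<in>a. K i) = {}" if "a \<subseteq> A" "card a = n" for a
        using A(4)[OF that(1)] that(2) by (simp add: G0)
    qed
    moreover have "real (card A) * e \<le> (\<Sum>\<xi>\<in>A. prob (K \<xi>))"
      using sum_mono[of A "\<lambda>_. e" "\<lambda>\<xi>. prob (K \<xi>)"] A(3) K(2) by (auto simp: subset_iff less_imp_le)
    moreover have "real n + 1 \<le> real (card A) * e"
      using real_nat_ceiling_ge[of "(real n + 1) / e"] unfolding A(2)[symmetric] pos_divide_le_eq[OF e] .
    ultimately show False by linarith
  qed
  define \<J> where "\<J> = {J. J \<subseteq> D \<and> (\<forall>a\<subseteq>J. finite a \<longrightarrow> good a)}"
  have "\<exists>J\<in>\<J>. \<forall>X\<in>\<J>. J \<subseteq> X \<longrightarrow> X = J"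
  proof (rule subset_Zorn_nonempty)
    show "\<J> \<noteq> {}" using good_empty by (auto simp: \<J>_def)
    fix \<C> assume C: "\<C> \<noteq> {}" "subset.chain \<J> \<C>"
    have "good a" if a: "a \<subseteq> \<Union>\<C>" "finite a" for a
    proof -
      have "\<exists>J\<in>\<C>. a \<subseteq> J" using a C finite_subset_Union_chain[of a \<C> \<J>] by metis
      then show ?thesis using C a by (auto simp: \<J>_def subset.chain_def)
    qed
    then show "\<Union>\<C> \<in> \<J>" using C by (auto simp: \<J>_def subset.chain_def)
  qed
  then obtain J where J: "J \<subseteq> D" "\<And>a. a \<subseteq> J \<Longrightarrow> finite a \<Longrightarrow> good a" "\<And>X. X \<in> \<J> \<Longrightarrow> J \<subseteq> X \<Longrightarrow> X = J"
    by (auto simp: \<J>_def)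
  show False
  proof (cases "\<exists>\<xi>\<in>D. \<forall>j\<in>J. lt j \<xi>")
    case True
    then obtain \<xi> where xi: "\<xi> \<in> D" "\<And>j. j \<in> J \<Longrightarrow> lt j \<xi>" by blast
    define N where "N a = {i. \<not> good (insert i a)}" for a
    have N: "sm {i. \<theta> i \<in> N a}" if "a \<subseteq> J" "finite a" for a
      using good_insert[OF J(2)[OF that]] by (simp add: N_def)
    \<comment> \<open>The finite subsets of \<open>J\<close> are not indexed by the elements below
      \<open>\<xi>\<close>, but they can be built one element at a time, each time at the cost of
      one union that \<open>add\<close> covers.\<close>
    have small: "sm {i. \<exists>a\<subseteq>J. finite a \<and> card a \<le> n \<and> \<theta> i \<in> N (b \<union> a)}" if "b \<subseteq> J" "finite b" for n b
      using that
    proof (induct n arbitrary: b)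
      case 0
      show ?case by (rule sm_subset[OF N[OF 0]]) auto
    next
      case (Suc n)
      define F where "F j = (if j \<in> J then {k. \<exists>a\<subseteq>J. finite a \<and> card a \<le> n \<and> k \<in> N (insert j b \<union> a)} else {})" for j
      have "sm {i. \<theta> i \<in> F j}" for j
        using Suc(1)[of "insert j b"] Suc(2,3) by (auto simp: F_def sm_empty)
      then have "sm {i. \<exists>j. lt j \<xi> \<and> \<theta> i \<in> F j}" by (rule add[OF xi(1)])
      then have "sm ({i. \<exists>j. lt j \<xi> \<and> \<theta> i \<in> F j} \<union> {i. \<theta> i \<in> N b})" using N[OF Suc(2,3)] by (rule sm_Un)
      then show ?case
      proof (rule sm_subset, safe)
        fix i a assume a: "a \<subseteq> J" "finite a" "card a \<le> Suc n" "\<theta> i \<in> N (b \<union> a)" "\<theta> i \<notin> N b"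
        then obtain j where j: "j \<in> a" by (metis ex_in_conv sup_bot.right_neutral)
        then have "card (a - {j}) \<le> n" "insert j b \<union> (a - {j}) = b \<union> a" using a by auto
        then have "\<theta> i \<in> F j" using a j by (auto simp: F_def intro!: exI[of _ "a - {j}"])
        then show "\<exists>j. lt j \<xi> \<and> \<theta> i \<in> F j" using xi(2) a j by blast
      qed
    qed
    have "sm (\<Union>n. {i. \<exists>a\<subseteq>J. finite a \<and> card a \<le> n \<and> \<theta> i \<in> N ({} \<union> a)})"
      by (intro sm_UN small) auto
    moreover have "sm {i. \<exists>j. lt j \<xi> \<and> \<theta> i \<in> {j}}"
      by (rule add[OF xi(1)]) (use fib in simp)
    ultimately have "sm ((\<Union>n. {i. \<exists>a\<subseteq>J. finite a \<and> card a \<le> n \<and> \<theta> i \<in> N ({} \<union> a)}) \<union>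
        {i. \<exists>j. lt j \<xi> \<and> \<theta> i \<in> {j}} \<union> {i. \<theta> i \<notin> D})" using D by (intro sm_Un)
    from complement_nonempty[OF this] obtain i where
      ni: "i \<notin> (\<Union>n. {i. \<exists>a\<subseteq>J. finite a \<and> card a \<le> n \<and> \<theta> i \<in> N ({} \<union> a)}) \<union>
        {i. \<exists>j. lt j \<xi> \<and> \<theta> i \<in> {j}} \<union> {i. \<theta> i \<notin> D}" ..
    then have i: "\<theta> i \<in> D" "\<not> lt (\<theta> i) \<xi>" by simp_all
    have i3: "good (insert (\<theta> i) a)" if "a \<subseteq> J" "finite a" for a
      using ni that by (force simp: N_def)
    have "insert (\<theta> i) J \<in> \<J>"
      unfolding \<J>_def
    proof (intro CollectI conjI allI impI)
      fix a assume a: "a \<subseteq> insert (\<theta> i) J" "finite a"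
      show "good a"
      proof (cases "\<theta> i \<in> a")
        case True
        then have "a = insert (\<theta> i) (a - {\<theta> i})" by blast
        then show ?thesis using i3[of "a - {\<theta> i}"] a by auto
      qed (use J(2) a in auto)
    qed (use i J in auto)
    then have "\<theta> i \<in> J" using J(3)[of "insert (\<theta> i) J"] by blast
    then show False using i xi by blast
  next
    case False
    have "D \<noteq> {}" using complement_nonempty[OF D] by auto
    then obtain j0 where j0: "j0 \<in> J" using False by blast
    have "K j0 \<inter> (\<Inter>j\<in>J. K j) \<noteq> {}"
    proof (rule compact_imp_fip_image)
      show "compact (K j0)" using K(1) J j0 by blast
      show "closed (K j)" if "j \<in> J" for j
        using K(1) J that Hausdorff_compact_closed[OF T2] by blast
      fix a assume a: "finite a" "a \<subseteq> J"
      have "G 0 (insert j0 a)" using J(2)[of "insert j0 a"] a j0 by (auto simp: good_def)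
      then show "K j0 \<inter> (\<Inter>j\<in>a. K j) \<noteq> {}" by (simp add: G0)
    qed
    \<comment> \<open>The index \<open>\<theta> (\<psi> x)\<close> of such a point would bound
      \<open>J\<close> in \<open>D\<close>.\<close>
    then obtain x where "\<And>j. j \<in> J \<Longrightarrow> x \<in> K j" by auto
    then have "\<theta> (\<psi> x) \<in> D" "\<forall>j\<in>J. lt j (\<theta> (\<psi> x))" using tail J(1) j0 by blast+
    then show False using False by blast
  qed
qed

end

section \<open>Atomless index measures, Lusin's theorem and Vitali's set\<close>

text \<open>\<open>main_part\<close> is a Borel subset of \<open>A\<close> of the same measure, so
  regularity passes to the completion. Negative \<open>r\<close> is allowed so that an error may be
  subtracted freely.\<close>

lemma radon_inner_regular:
  assumes M: "radon_prob_measure M" and A: "A \<in> sets (completion M)"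
    and r: "r < measure (completion M) A"
  obtains K where "compact K" "K \<subseteq> A" "r < measure M K"
proof (cases "r < 0")
  case True
  then show thesis using that[of "{}"] by simp
next
  case False
  interpret M: prob_space M using M by (simp add: radon_prob_measure_def)
  have mp: "main_part M A \<in> sets borel"
    using main_part_sets[OF A] M by (simp add: radon_prob_measure_def)
  have "measure (completion M) A = measure M (main_part M A)"
    using A by (simp add: measure_def)
  then have "ennreal r < emeasure M (main_part M A)"
    using r False by (simp add: M.emeasure_eq_measure ennreal_less_iff)
  then obtain K where K: "compact K" "K \<subseteq> main_part M A" "ennreal r < emeasure M K"
    using M mp unfolding radon_prob_measure_def by blast
  have "K \<subseteq> A" using K(2) main_part_null_part_Un[OF A] by blast
  moreover have "r < measure M K"
    using K(3) False by (simp add: M.emeasure_eq_measure ennreal_less_iff)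
  ultimately show thesis using that K(1) by blast
qed

text \<open>Split greedily, always almost maximising the smaller half. A branch whose intersection had
  positive measure could itself be split, so every cell along it would lose a fixed amount.\<close>

lemma atomless_real_index:
  fixes W :: "'i measure"
  assumes W: "finite_measure W" "sets W = UNIV"
    and split: "\<And>S. measure W S > 0 \<Longrightarrow> \<exists>T\<subseteq>S. measure W T > 0 \<and> measure W (S - T) > 0"
  obtains \<rho> :: "'i \<Rightarrow> real" where "\<And>r. measure W (\<rho> -` {r}) = 0"
proof -
  interpret finite_measure W by fact
  have [simp]: "S \<in> sets W" for S using W(2) by simp
  let ?w = "measure W"
  define m where "m S T = min (?w T) (?w (S - T))" for S T
  have "\<exists>C\<subseteq>S. \<forall>T\<subseteq>S. m S T \<le> 2 * m S C" for S
  proof -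
    let ?s = "SUP T\<in>Pow S. m S T"
    have bdd: "bdd_above (m S ` Pow S)"
    proof (rule bdd_aboveI)
      fix x assume "x \<in> m S ` Pow S"
      then obtain T where "x = m S T" by blast
      then have "x \<le> ?w T" by (simp add: m_def)
      also have "\<dots> \<le> ?w UNIV" by (intro finite_measure_mono) simp_all
      finally show "x \<le> ?w UNIV" .
    qed
    have up: "m S T \<le> ?s" if "T \<subseteq> S" for T using that by (intro cSUP_upper bdd) blast
    have nonneg: "0 \<le> m S T" for T by (simp add: m_def)
    show ?thesis
    proof (cases "?s > 0")
      case True
      then have "?s / 2 < ?s" by simp
      then obtain C where C: "C \<subseteq> S" "?s / 2 < m S C"
        using less_cSUP_iff[of "Pow S" "m S" "?s / 2", OF _ bdd] by blast
      have "m S T \<le> 2 * m S C" if "T \<subseteq> S" for T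
        using up[OF that] C(2) by linarith
      then show ?thesis using C(1) by blast
    next
      case False
      then have "m S T \<le> 2 * m S {}" if "T \<subseteq> S" for T
        using up[OF that] nonneg[of "{}"] by linarith
      then show ?thesis by blast
    qed
  qed
  then obtain c where c: "\<And>S. c S \<subseteq> S" "\<And>S T. T \<subseteq> S \<Longrightarrow> m S T \<le> 2 * m S (c S)" by metis
  define cell where "cell i = rec_nat UNIV (\<lambda>n C. if i \<in> c C then c C else C - c C)" for i
  have cell0: "cell i 0 = UNIV"
    and cellS: "cell i (Suc n) = (if i \<in> c (cell i n) then c (cell i n) else cell i n - c (cell i n))" for i n
    by (simp_all add: cell_def)
  define bits where "bits i = {n. i \<in> c (cell i n)}" for i
  have cell_eq: "cell i n = cell j n" if "bits i = bits j" for i j n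
  proof (induct n)
    case (Suc n)
    have "n \<in> bits i \<longleftrightarrow> n \<in> bits j" using that by simp
    with Suc show ?case by (simp add: cellS bits_def)
  qed (simp add: cell0)
  have mem: "i \<in> cell i n" for i n
    by (induct n) (auto simp: cell0 cellS)
  \<comment> \<open>Branches of the splitting tree are sets of naturals, which inject into the
    reals.\<close>
  obtain \<iota> :: "nat set \<Rightarrow> real" where inj: "inj \<iota>"
    using nat_sets_eqpoll_reals unfolding eqpoll_def by (auto simp: bij_betw_def)
  show thesis
  proof (rule that[of "\<iota> \<circ> bits"], rule ccontr)
    fix r assume ne: "?w ((\<iota> \<circ> bits) -` {r}) \<noteq> 0"
    define F where "F = (\<iota> \<circ> bits) -` {r}"
    have "?w F > 0" using ne by (simp add: F_def zero_less_measure_iff)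
    then obtain T where T: "T \<subseteq> F" "?w T > 0" "?w (F - T) > 0" using split by blast
    then obtain i where i: "i \<in> F" by (metis Diff_empty ex_in_conv measure_empty less_irrefl subset_empty)
    have F: "j \<in> F \<Longrightarrow> bits j = bits i" for j using i inj by (auto simp: F_def inj_eq)
    define \<delta> where "\<delta> = min (?w T) (?w (F - T))"
    have "\<delta> > 0" using T by (simp add: \<delta>_def)
    have sub: "F \<subseteq> cell i n" for n using F cell_eq mem by blast
    \<comment> \<open>\<open>T\<close> and its complement in the cell both have measure at least
      \<open>\<delta>\<close>; the factor 2 in the choice of \<open>c\<close> halves this bound for
      the actual split.\<close>
    have step: "?w (cell i (Suc n)) \<le> ?w (cell i n) - \<delta> / 2" for n
    proof -
      let ?C = "cell i n"
      have "\<delta> \<le> m ?C T"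
        unfolding \<delta>_def m_def using sub[of n] by (intro min.mono finite_measure_mono) auto
      also have "\<dots> \<le> 2 * m ?C (c ?C)" using T(1) sub[of n] by (intro c(2)) blast
      finally have "\<delta> / 2 \<le> ?w (c ?C)" "\<delta> / 2 \<le> ?w (?C - c ?C)" by (auto simp: m_def)
      moreover have "?w (?C - c ?C) = ?w ?C - ?w (c ?C)" using c(1)[of ?C] by (intro finite_measure_Diff) auto
      ultimately show ?thesis by (auto simp: cellS)
    qed
    have "?w (cell i n) \<le> ?w UNIV - real n * (\<delta> / 2)" for n
    proof (induct n)
      case (Suc n) then show ?case using step[of n] by (simp add: field_simps)
    qed (simp add: cell0)
    moreover obtain n where "?w UNIV < real n * (\<delta> / 2)"
      using reals_Archimedean3[of "\<delta> / 2"] \<open>\<delta> > 0\<close> by auto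
    ultimately show False using measure_nonneg[of W "cell i n"] by (metis diff_less_0_iff_less not_less order.trans)
  qed
qed

text \<open>The probability integral transform: by continuity each sublevel set
  \<open>{x. cdf D x \<le> t}\<close> with \<open>0 < t < 1\<close> is a half-line at whose endpoint
  the value is exactly \<open>t\<close>.\<close>

lemma uniform_of_continuous_cdf:
  assumes D: "real_distribution D" and diff: "\<And>r. measure D {r} = 0"
  shows "distr D borel (cdf D) = uniform_measure lborel {0..1::real}" (is "?U = ?V")
proof -
  interpret D: real_distribution D by fact
  have cont: "isCont (cdf D) r" for r using D.isCont_cdf diff by simp
  have meas: "cdf D \<in> borel_measurable borel"
    by (intro borel_measurable_mono monoI D.cdf_nondecreasing)
  have meas': "cdf D \<in> borel_measurable D" using meas by simp
  have U: "real_distribution ?U"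
    unfolding real_distribution_def real_distribution_axioms_def
    using D.prob_space_distr[OF meas'] by simp
  have V: "real_distribution ?V"
    unfolding real_distribution_def real_distribution_axioms_def
    by (auto intro!: prob_space_uniform_measure)
  have inside: "measure D {x. cdf D x \<le> t} = t" if t: "0 < t" "t < 1" for t
  proof -
    let ?A = "{x. cdf D x \<le> t}"
    obtain a where a: "cdf D a < t"
      using order_tendstoD(2)[OF D.cdf_lim_at_bot t(1)] by (auto simp: eventually_at_bot_linorder)
    obtain b where b: "cdf D b > t"
      using order_tendstoD(1)[OF D.cdf_lim_at_top_prob t(2)] by (auto simp: eventually_at_top_linorder)
    have bd: "x \<le> b" if "x \<in> ?A" for x
      using that b D.cdf_nondecreasing[of b x] by (cases "x \<le> b") auto
    have bdd: "bdd_above ?A" using bd by (rule bdd_aboveI)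
    have closed: "closed ?A"
      by (intro closed_Collect_le continuous_at_imp_continuous_on ballI cont continuous_on_const)
    define s where "s = Sup ?A"
    have sA: "s \<in> ?A"
      unfolding s_def using closed_contains_Sup[OF _ bdd closed] a by (metis (mono_tags, lifting) empty_iff less_imp_le mem_Collect_eq)
    have A: "?A = {..s}"
    proof (intro equalityI subsetI)
      show "x \<in> {..s}" if "x \<in> ?A" for x using cSup_upper[OF that bdd] by (simp add: s_def)
      show "x \<in> ?A" if "x \<in> {..s}" for x using D.cdf_nondecreasing[of x s] that sA by simp
    qed
    have "cdf D s \<ge> t"
    proof (rule ccontr)
      assume "\<not> ?thesis"
      then have "cdf D s < t" by simp
      then have "eventually (\<lambda>x. cdf D x < t) (at_right s)"
        using cont[of s] by (auto simp: isCont_def filterlim_at_split order_tendstoD)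
      then have "eventually (\<lambda>x. cdf D x < t \<and> s < x) (at_right s)"
        using eventually_at_right_less[of s] by (rule eventually_conj)
      then obtain x where "cdf D x < t" "s < x" using eventually_happens trivial_limit_at_right_real by blast
      then show False using A by (metis (mono_tags, lifting) atMost_iff less_imp_le mem_Collect_eq not_less)
    qed
    then show ?thesis using sA A by (simp add: cdf_def)
  qed
  have le1: "cdf D x \<le> 1" and ge0: "0 \<le> cdf D x" for x
    using D.cdf_bounded_prob D.cdf_nonneg by auto
  have "cdf ?U t = cdf ?V t" for t
  proof -
    have U_t: "cdf ?U t = measure D {x. cdf D x \<le> t}"
      using meas' by (simp add: cdf_def measure_distr vimage_def)
    have V_t: "cdf ?V t = measure lborel ({0..1} \<inter> {..t})"
      by (simp add: cdf_def measure_uniform_measure)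
    consider "t \<le> 0" | "0 < t" "t < 1" | "1 \<le> t" by linarith
    then show ?thesis
    proof cases
      case 1
      \<comment> \<open>At level 0 and below the sublevel set may be empty and have no endpoint, so
        it is squeezed by levels \<open>e\<close> close to 0.\<close>
      have "measure D {x. cdf D x \<le> t} \<le> e" if "0 < e" "e < 1" for e
      proof -
        have "{x. cdf D x \<le> e} \<in> sets D" using meas by simp
        then have "measure D {x. cdf D x \<le> t} \<le> measure D {x. cdf D x \<le> e}"
          using 1 that by (intro D.finite_measure_mono) auto
        then show ?thesis using inside[OF that] by simp
      qed
      then have "measure D {x. cdf D x \<le> t} \<le> 0"
        by (metis dense_ge_bounded zero_less_one)
      moreover have "{0..1} \<inter> {..t} \<subseteq> {0::real}" using 1 by auto
      then have "measure lborel ({0..1} \<inter> {..t}) = 0"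
        using 1 by (cases "t = 0") (auto simp: subset_singleton_iff)
      ultimately show ?thesis
        unfolding U_t V_t using measure_nonneg[of D "{x. cdf D x \<le> t}"] by linarith
    next
      case 2
      then have "{0..1} \<inter> {..t} = {0..t}" by auto
      then show ?thesis unfolding U_t V_t using inside[OF 2] 2 by simp
    next
      case 3
      then have "{x. cdf D x \<le> t} = space D" "{0..1} \<inter> {..t} = {0..1::real}"
        using le1 order_trans by fastforce+
      then show ?thesis unfolding U_t V_t using D.prob_space by simp
    qed
  qed
  then show ?thesis by (intro cdf_unique U V) auto
qed

text \<open>Lusin's argument: on a large compact set all the sets \<^term>\<open>{x. f x \<le> r}\<close> with rational
  \<^term>\<open>r\<close> become relatively clopen.\<close>

lemma radon_Lusin_real:
  fixes f :: "'a::topological_space \<Rightarrow> real"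
  assumes T2: "Hausdorff_space (euclidean :: 'a topology)"
    and M: "radon_prob_measure M" and f: "f \<in> borel_measurable (completion M)" and e: "e > 0"
  obtains K where "compact K" "measure M K > 1 - e" "continuous_on K f"
proof -
  interpret M: prob_space M using M by (simp add: radon_prob_measure_def)
  interpret N: prob_space "completion M" by (rule M.prob_space_completion)
  have sets: "sets M = sets borel" and sp: "space M = UNIV"
    using M sets_eq_imp_space_eq[of M borel] by (auto simp: radon_prob_measure_def)
  define q :: "nat \<Rightarrow> real" where "q n = real_of_rat (from_nat n)" for n
  have q: "\<exists>n. a < q n \<and> q n < b" if ab: "a < b" for a b :: real
  proof -
    obtain r where "a < real_of_rat r" "real_of_rat r < b" using of_rat_dense[OF ab] by blast
    then show ?thesis by (intro exI[of _ "to_nat r"]) (simp add: q_def)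
  qed
  have ms: "{x. f x \<le> r} \<in> sets (completion M)" "{x. r < f x} \<in> sets (completion M)" for r
    using measurable_sets[OF f, of "{..r}"] measurable_sets[OF f, of "{r<..}"] sp by (auto simp: vimage_def)
  have "\<exists>K L. compact K \<and> compact L \<and> K \<subseteq> {x. f x \<le> q n} \<and> L \<subseteq> {x. q n < f x} \<and>
      measure M (UNIV - (K \<union> L)) \<le> e / 2 * (1/2)^Suc n" for n
  proof -
    define d where "d = e / 2 * (1/2)^Suc n / 2"
    have d: "d > 0" using e by (simp add: d_def)
    obtain K where K: "compact K" "K \<subseteq> {x. f x \<le> q n}" "N.prob {x. f x \<le> q n} - d < measure M K"
      by (rule radon_inner_regular[OF M ms(1), of "N.prob {x. f x \<le> q n} - d" "q n"]) (use d in simp)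
    obtain L where L: "compact L" "L \<subseteq> {x. q n < f x}" "N.prob {x. q n < f x} - d < measure M L"
      by (rule radon_inner_regular[OF M ms(2), of "N.prob {x. q n < f x} - d" "q n"]) (use d in simp)
    have KL: "K \<in> sets M" "L \<in> sets M"
      using K(1) L(1) Hausdorff_compact_closed[OF T2] sets by auto
    have "K \<inter> L = {}" using K(2) L(2) by force
    then have "measure M (K \<union> L) = measure M K + measure M L"
      using KL by (intro M.finite_measure_Union) auto
    moreover have "N.prob {x. f x \<le> q n} + N.prob {x. q n < f x} = 1"
    proof -
      have "N.prob ({x. f x \<le> q n} \<union> {x. q n < f x}) = N.prob {x. f x \<le> q n} + N.prob {x. q n < f x}"
        by (intro N.finite_measure_Union ms) auto
      moreover have "{x. f x \<le> q n} \<union> {x. q n < f x} = space (completion M)" using sp by auto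
      ultimately show ?thesis using N.prob_space by simp
    qed
    moreover have "measure M (UNIV - (K \<union> L)) = 1 - measure M (K \<union> L)"
      using M.prob_compl[of "K \<union> L"] KL sp by auto
    ultimately have "measure M (UNIV - (K \<union> L)) \<le> 2 * d" using K(3) L(3) by linarith
    then show ?thesis using K L by (intro exI[of _ K] exI[of _ L]) (simp add: d_def)
  qed
  then obtain K L where KL: "\<And>n. compact (K n)" "\<And>n. compact (L n)" "\<And>n. K n \<subseteq> {x. f x \<le> q n}"
    "\<And>n. L n \<subseteq> {x. q n < f x}" "\<And>n. measure M (UNIV - (K n \<union> L n)) \<le> e / 2 * (1/2)^Suc n" by metis
  have cl: "closed (K n)" "closed (L n)" for n using KL Hausdorff_compact_closed[OF T2] by auto
  define C where "C = (\<Inter>n. K n \<union> L n)"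
  have clC: "closed C" unfolding C_def using cl by auto
  have compC: "compact C"
  proof -
    have "(K 0 \<union> L 0) \<inter> C = C" by (auto simp: C_def)
    then show ?thesis using compact_Int_closed[OF compact_Un[OF KL(1)[of 0] KL(2)[of 0]] clC] by simp
  qed
  have "measure M (\<Union>n. UNIV - (K n \<union> L n)) \<le> (\<Sum>n. measure M (UNIV - (K n \<union> L n)))"
  proof (rule M.finite_measure_subadditive_countably)
    show "range (\<lambda>n. UNIV - (K n \<union> L n)) \<subseteq> sets M" using cl sets by auto
    show "summable (\<lambda>n. measure M (UNIV - (K n \<union> L n)))"
      by (rule summable_comparison_test[of _ "\<lambda>n. e / 2 * (1/2)^Suc n"])
        (use KL(5) sums_summable[OF power_half_series] in \<open>auto intro!: summable_mult simp del: power_Suc\<close>)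
  qed
  also have "\<dots> \<le> (\<Sum>n. e / 2 * (1/2)^Suc n)"
  proof (rule suminf_le[OF KL(5)])
    show "summable (\<lambda>n. e / 2 * (1/2)^Suc n)"
      by (intro summable_mult sums_summable[OF power_half_series])
    then show "summable (\<lambda>n. measure M (UNIV - (K n \<union> L n)))"
      by (rule summable_comparison_test[rotated]) (use KL(5) in \<open>auto simp del: power_Suc\<close>)
  qed
  also have "\<dots> = e / 2"
    using sums_mult[OF power_half_series, of "e / 2"] by (simp add: sums_iff)
  finally have "measure M (UNIV - C) \<le> e / 2"
    by (simp add: C_def)
  moreover have "measure M (UNIV - C) = 1 - measure M C"
    using M.prob_compl[of C] clC sets sp by auto
  ultimately have mC: "measure M C > 1 - e" using e by linarith
  have "continuous_on C f"
    unfolding continuous_on_def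
  proof
    fix x assume x: "x \<in> C"
    show "(f \<longlongrightarrow> f x) (at x within C)"
    proof (rule order_tendstoI)
      fix a assume "a < f x"
      then obtain n where n: "a < q n" "q n < f x" using q by blast
      \<comment> \<open>Within \<open>C\<close>, being outside \<open>K n\<close> means lying in
        \<open>L n\<close>, so \<open>- K n\<close> is a neighbourhood of \<open>x\<close> on which
        \<open>f\<close> exceeds \<open>q n\<close> throughout \<open>C\<close>.\<close>
      have "x \<in> - K n" using n KL(3)[of n] by auto
      moreover have "a < f y" if "y \<in> - K n" "y \<in> C" for y
        using that n KL(4)[of n] by (force simp: C_def)
      ultimately show "eventually (\<lambda>y. a < f y) (at x within C)"
        unfolding eventually_at_topological using cl(1)[of n] by (intro exI[of _ "- K n"]) auto
    next
      fix a assume "f x < a"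
      then obtain n where n: "f x < q n" "q n < a" using q by blast
      have "x \<in> - L n" using n KL(4)[of n] by auto
      moreover have "f y < a" if "y \<in> - L n" "y \<in> C" for y
        using that n KL(3)[of n] by (force simp: C_def)
      ultimately show "eventually (\<lambda>y. f y < a) (at x within C)"
        unfolding eventually_at_topological using cl(2)[of n] by (intro exI[of _ "- L n"]) auto
    qed
  qed
  then show thesis using that compC mC by blast
qed

text \<open>By Lusin's theorem every set is approximated from inside by compact sets in the pushforward, which
  is therefore translation invariant on all sets; Vitali's set gives the contradiction.\<close>

lemma no_total_uniform_pushforward:
  fixes T :: "'a::topological_space \<Rightarrow> real"
  assumes T2: "Hausdorff_space (euclidean :: 'a topology)"
    and M: "radon_prob_measure M" and T: "\<And>S. T -` S \<in> sets (completion M)"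
    and unif: "distr (completion M) borel T = uniform_measure lborel {0..1}"
  shows False
proof -
  interpret M: prob_space M using M by (simp add: radon_prob_measure_def)
  interpret N: prob_space "completion M" by (rule M.prob_space_completion)
  have sets: "sets M = sets borel" and sp: "space M = UNIV"
    using M sets_eq_imp_space_eq[of M borel] by (auto simp: radon_prob_measure_def)
  have meas: "T \<in> borel_measurable (completion M)"
    using T sp by (auto simp: measurable_def)
  define q where "q S = N.prob (T -` S)" for S
  have q_borel: "q A = measure lborel ({0..1} \<inter> A)" if "A \<in> sets borel" for A
  proof -
    have "q A = measure (distr (completion M) borel T) A"
      using meas that sp by (simp add: q_def measure_distr)
    then show ?thesis using that by (simp add: unif measure_uniform_measure)
  qed
  have q_mono: "q A \<le> q B" if "A \<subseteq> B" for A B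
    unfolding q_def using that T by (intro N.finite_measure_mono) auto
  have inner: "\<exists>A. compact A \<and> A \<subseteq> S \<and> q S - e < q A" if e: "e > 0" for S e
  proof -
    obtain K where K: "compact K" "measure M K > 1 - e / 2" "continuous_on K T"
      by (rule radon_Lusin_real[OF T2 M meas, of "e / 2"]) (use e in simp)
    have KM: "K \<in> sets M" using K(1) Hausdorff_compact_closed[OF T2] sets by auto
    have UK: "UNIV - K \<in> sets (completion M)" using sets.compl_sets[OF KM] sp by simp
    have SK: "T -` S \<inter> K \<in> sets (completion M)" using KM T by (intro sets.Int) auto
    obtain L where L: "compact L" "L \<subseteq> T -` S \<inter> K" "N.prob (T -` S \<inter> K) - e / 2 < measure M L"
      by (rule radon_inner_regular[OF M SK, of "N.prob (T -` S \<inter> K) - e / 2"]) (use e in simp)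
    have "N.prob (T -` S) \<le> N.prob ((T -` S \<inter> K) \<union> (UNIV - K))"
      by (intro N.finite_measure_mono sets.Un SK UK) blast
    also have "\<dots> \<le> N.prob (T -` S \<inter> K) + N.prob (UNIV - K)"
      by (intro measure_Un_le SK UK)
    also have "N.prob (UNIV - K) = 1 - measure M K"
      using M.prob_compl[OF KM] sp sets.compl_sets[OF KM] by simp
    finally have "q S - e < measure M L" using K(2) L(3) unfolding q_def by linarith
    also have "measure M L = N.prob L"
      using L(1) Hausdorff_compact_closed[OF T2] sets by simp
    also have "\<dots> \<le> q (T ` L)"
      unfolding q_def using T by (intro N.finite_measure_mono) blast+
    finally have "q S - e < q (T ` L)" .
    moreover have "compact (T ` L)"
      using L(1,2) K(3) by (intro compact_continuous_image continuous_on_subset[of K T L]) blast+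
    moreover have "T ` L \<subseteq> S" using L(2) by blast
    ultimately show ?thesis by blast
  qed
  have shift: "q S \<le> q ((+) r ` S)" if S: "S \<subseteq> {0..1}" "(+) r ` S \<subseteq> {0..1}" for S r
  proof (rule field_le_epsilon)
    fix e :: real assume "e > 0"
    then obtain A where A: "compact A" "A \<subseteq> S" "q S - e < q A" using inner by blast
    have cA: "compact ((+) r ` A)" using A(1) by (rule compact_plus_left)
    have "q A = measure lborel A"
      using A S by (simp add: q_borel borel_compact Int_absorb1)
    also have "\<dots> = measure lebesgue A" using A(1) by (simp add: borel_compact)
    also have "\<dots> = measure lebesgue ((+) r ` A)" by (simp add: measure_translation)
    also have "\<dots> = measure lborel ((+) r ` A)" using cA by (simp add: borel_compact)
    also have "\<dots> = q ((+) r ` A)"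
    proof -
      have "(+) r ` A \<subseteq> {0..1}" using A S by blast
      then show ?thesis using cA by (simp add: q_borel borel_compact Int_absorb1)
    qed
    also have "\<dots> \<le> q ((+) r ` S)" using A by (intro q_mono) auto
    finally show "q S \<le> q ((+) r ` S) + e" using A(3) by linarith
  qed
  \<comment> \<open>Representatives modulo the rationals are taken in the left half of the unit
    interval, so that the translations used below stay where \<open>shift\<close> applies.\<close>
  define rep :: "real \<Rightarrow> real" where "rep x = (SOME y. y \<in> {0..1/2} \<and> x - y \<in> \<rat>)" for x
  have rep: "rep x \<in> {0..1/2} \<and> x - rep x \<in> \<rat>" for x
  proof -
    obtain p where p: "p \<in> \<rat>" "x - 1/2 < p" "p < x"
      using Rats_dense_in_real[of "x - 1/2" x] by auto
    then have "x - p \<in> {0..1/2} \<and> x - (x - p) \<in> \<rat>" by auto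
    then show ?thesis unfolding rep_def by (rule someI)
  qed
  have rep_eq: "rep x = rep y" if "x - y \<in> \<rat>" for x y
  proof -
    have "x - z \<in> \<rat> \<longleftrightarrow> y - z \<in> \<rat>" for z
      using Rats_diff[OF _ that, of "x - z"] Rats_add[OF that, of "y - z"] by (auto simp: algebra_simps)
    then show ?thesis by (simp add: rep_def)
  qed
  define V where "V = range rep"
  have V: "V \<subseteq> {0..1/2}" using rep by (auto simp: V_def)
  have V_eq: "v = v'" if "v \<in> V" "v' \<in> V" "v - v' \<in> \<rat>" for v v'
  proof -
    obtain x y where xy: "v = rep x" "v' = rep y" using \<open>v \<in> V\<close> \<open>v' \<in> V\<close> unfolding V_def by blast
    have "x - v \<in> \<rat>" "y - v' \<in> \<rat>" using rep[of x] rep[of y] xy by auto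
    then have "(x - v) + (v - v') - (y - v') \<in> \<rat>"
      using Rats_diff[OF Rats_add[OF _ that(3)]] by blast
    then show ?thesis using rep_eq[of x y] xy by simp
  qed
  have "q V = 0"
  proof (rule ccontr)
    assume "q V \<noteq> 0"
    then have pos: "q V > 0" by (simp add: q_def zero_less_measure_iff)
    \<comment> \<open>Distinct rationals of size at most 1/2: infinitely many disjoint translates of
      \<open>V\<close> fit into the unit interval.\<close>
    define r where "r n = 1 / (real n + 2)" for n
    have rV: "q V \<le> q ((+) (r n) ` V)" for n
    proof (rule shift)
      have "0 \<le> r n" "r n \<le> 1/2" by (auto simp: r_def field_simps)
      then show "(+) (r n) ` V \<subseteq> {0..1}" using V by force
    qed (use V in force)
    have disj: "disjoint_family_on (\<lambda>n. T -` (+) (r n) ` V) {..<k}" for k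
      unfolding disjoint_family_on_def
    proof safe
      fix m n x v v' assume mn: "m \<noteq> n" and v: "v \<in> V" "v' \<in> V" "T x = r m + v" "T x = r n + v'"
      have "v - v' = r n - r m" using v by simp
      moreover have "r n - r m \<in> \<rat>" by (auto simp: r_def)
      ultimately have "v = v'" using V_eq[OF v(1,2)] by simp
      then have "r n = r m" using v by simp
      with mn show "x \<in> {}" by (simp add: r_def)
    qed
    have "real k * q V \<le> 1" for k
    proof -
      have "real k * q V \<le> (\<Sum>n<k. q ((+) (r n) ` V))"
        using sum_mono[of "{..<k}" "\<lambda>_. q V", OF rV] by simp
      also have "\<dots> = N.prob (\<Union>n<k. T -` (+) (r n) ` V)"
        unfolding q_def using T disj by (intro N.finite_measure_finite_Union[symmetric]) auto
      finally show ?thesis using N.prob_le_1 order_trans by blast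
    qed
    moreover obtain k where "1 < real k * q V" using reals_Archimedean3[OF pos] by blast
    ultimately show False by (meson not_less)
  qed
  \<comment> \<open>The part of a rational translate inside the left half can be moved back into
    \<open>V\<close>; countably many such parts cover the left half, whose measure is 1/2.\<close>
  have null: "q ((+) r ` V \<inter> {0..1/2}) = 0" for r
  proof -
    let ?S = "(+) r ` V \<inter> {0..1/2}"
    have sub: "(+) (- r) ` ?S \<subseteq> V" by auto
    have "q ?S \<le> q ((+) (- r) ` ?S)"
    proof (rule shift)
      show "(+) (- r) ` ?S \<subseteq> {0..1}" using sub V by force
    qed force
    also have "\<dots> \<le> q V" using sub by (rule q_mono)
    finally show ?thesis using \<open>q V = 0\<close> measure_nonneg[of "completion M" "T -` ?S"] unfolding q_def by linarith
  qed
  have "T -` {0..1/2} = (\<Union>r\<in>\<rat>. T -` ((+) r ` V \<inter> {0..1/2}))"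
  proof (intro equalityI subsetI)
    fix x assume x: "x \<in> T -` {0..1/2}"
    have "T x = (T x - rep (T x)) + rep (T x)" by simp
    then have "T x \<in> (+) (T x - rep (T x)) ` V" unfolding V_def by blast
    with x rep[of "T x"] show "x \<in> (\<Union>r\<in>\<rat>. T -` ((+) r ` V \<inter> {0..1/2}))" by blast
  qed auto
  also have "\<dots> \<in> null_sets (completion M)"
    using countable_rat
  proof (rule null_sets_UN')
    show "T -` ((+) r ` V \<inter> {0..1/2}) \<in> null_sets (completion M)" for r
      using null[of r] T unfolding q_def by (intro null_setsI) (auto simp: N.emeasure_eq_measure)
  qed
  finally have "q {0..1/2} = 0" by (simp add: q_def measure_def null_sets_def)
  moreover have "q {0..1/2} = 1/2"
  proof -
    have "{0..1} \<inter> {0..1/2} = {0..1/2::real}" by auto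
    then show ?thesis by (simp add: q_borel)
  qed
  ultimately show False by simp
qed

text \<open>Null fibres make the distribution function of \<open>X\<close> continuous, and composing
  with it reaches the uniform case while all preimages remain measurable.\<close>

lemma no_total_diffuse_pushforward:
  fixes X :: "'a::topological_space \<Rightarrow> real"
  assumes T2: "Hausdorff_space (euclidean :: 'a topology)"
    and M: "radon_prob_measure M" and X: "\<And>S. X -` S \<in> sets (completion M)"
    and null: "\<And>r. measure (completion M) (X -` {r}) = 0"
  shows False
proof -
  interpret M: prob_space M using M by (simp add: radon_prob_measure_def)
  interpret N: prob_space "completion M" by (rule M.prob_space_completion)
  have sp: "space M = UNIV"
    using M sets_eq_imp_space_eq[of M borel] by (auto simp: radon_prob_measure_def)
  have meas: "X \<in> borel_measurable (completion M)"
    using X sp by (auto simp: measurable_def)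
  let ?D = "distr (completion M) borel X"
  have D: "real_distribution ?D"
    unfolding real_distribution_def real_distribution_axioms_def
    using N.prob_space_distr[OF meas] by simp
  have "measure ?D {r} = 0" for r using meas null[of r] sp by (simp add: measure_distr)
  then have unif: "distr ?D borel (cdf ?D) = uniform_measure lborel {0..1}"
    by (rule uniform_of_continuous_cdf[OF D])
  have "cdf ?D \<in> borel_measurable borel"
    by (intro borel_measurable_mono monoI finite_borel_measure.cdf_nondecreasing
        real_distribution.finite_borel_measure_M[OF D])
  then have "distr ?D borel (cdf ?D) = distr (completion M) borel (cdf ?D \<circ> X)"
    using meas by (intro distr_distr) auto
  then show False
    using no_total_uniform_pushforward[OF T2 M, of "cdf ?D \<circ> X"] X unif by (simp add: vimage_comp[symmetric])
qed

section \<open>The dichotomy between atomless measures and atoms\<close>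

text \<open>The image measure \<open>W\<close> is defined on all subsets of the index set. If every
  set of positive measure splits, a real index reduces to the diffuse case. Otherwise an atom
  \<open>S0\<close> yields a sigma-complete prime ideal, and compact sets inside the preimages of
  the tails contradict \<open>no_compact_tail_family\<close>.\<close>

theorem no_total_null_partition:
  fixes \<psi> :: "'a::topological_space \<Rightarrow> 'i"
  assumes T2: "Hausdorff_space (euclidean :: 'a topology)"
    and M: "radon_prob_measure M" and psi: "\<And>S. \<psi> -` S \<in> sets (completion M)"
    and null: "\<And>i. measure (completion M) (\<psi> -` {i}) = 0"
  shows False
proof -
  interpret M: prob_space M using M by (simp add: radon_prob_measure_def)
  interpret N: prob_space "completion M" by (rule M.prob_space_completion)
  have sets: "sets M = sets borel" and sp: "space M = UNIV"
    using M sets_eq_imp_space_eq[of M borel] by (auto simp: radon_prob_measure_def)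
  have meas: "\<psi> \<in> measurable (completion M) (count_space UNIV)"
    using psi sp by (auto simp: measurable_def)
  define W where "W = distr (completion M) (count_space UNIV) \<psi>"
  interpret W: prob_space W unfolding W_def by (rule N.prob_space_distr[OF meas])
  have setsW: "sets W = UNIV" by (simp add: W_def)
  then have [simp]: "S \<in> sets W" for S by simp
  have w: "measure W S = N.prob (\<psi> -` S)" for S
    using meas sp by (simp add: W_def measure_distr)
  show False
  proof (cases "\<forall>S. measure W S > 0 \<longrightarrow> (\<exists>T\<subseteq>S. measure W T > 0 \<and> measure W (S - T) > 0)")
    case True
    then obtain \<rho> :: "'i \<Rightarrow> real" where rho: "\<And>r. measure W (\<rho> -` {r}) = 0"
      using atomless_real_index[OF W.finite_measure_axioms setsW] by metis
    show False
      by (rule no_total_diffuse_pushforward[OF T2 M, of "\<rho> \<circ> \<psi>"])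
        (use psi rho w in \<open>simp_all add: vimage_comp[symmetric]\<close>)
  next
    case False
    then obtain S0 where S0: "measure W S0 > 0" and atom0: "\<And>T. T \<subseteq> S0 \<Longrightarrow> \<not> (measure W T > 0 \<and> measure W (S0 - T) > 0)"
      by blast
    then have atom: "measure W T = 0 \<or> measure W (S0 - T) = 0" if "T \<subseteq> S0" for T
      using that by (metis zero_less_measure_iff)
    define sm where "sm T \<longleftrightarrow> measure W (T \<inter> S0) = 0" for T
    interpret sigma_prime_ideal sm
    proof
      fix S T assume "sm T" "S \<subseteq> T"
      then show "sm S"
        using W.finite_measure_mono[of "S \<inter> S0" "T \<inter> S0"] measure_nonneg[of W "S \<inter> S0"] by (auto simp: sm_def)
    next
      fix A :: "nat \<Rightarrow> 'i set" assume "\<And>n. sm (A n)"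
      then have "(\<Union>n. A n \<inter> S0) \<in> null_sets W"
        by (intro null_sets_UN) (auto simp: sm_def null_sets_def W.emeasure_eq_measure)
      then show "sm (\<Union>n. A n)" by (simp add: sm_def measure_def null_sets_def UN_extend_simps del: UN_simps)
    next
      show "\<not> sm UNIV" using S0 by (simp add: sm_def)
      show "sm T \<or> sm (- T)" for T
      proof -
        have "S0 - T \<inter> S0 = - T \<inter> S0" by blast
        then show ?thesis using atom[of "T \<inter> S0"] by (simp add: sm_def)
      qed
      show "sm {i}" for i
        using W.finite_measure_mono[of "{i} \<inter> S0" "{i}"] measure_nonneg[of W "{i} \<inter> S0"] null[of i] w[of "{i}"]
        by (auto simp: sm_def)
    qed
    obtain \<theta> :: "'i \<Rightarrow> 'i" and D lt where th: "sm {i. \<theta> i \<notin> D}"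
      "\<And>j. sm {i. \<theta> i = j}"
      "\<And>\<xi> N. \<xi> \<in> D \<Longrightarrow> (\<And>j. sm {i. \<theta> i \<in> N j}) \<Longrightarrow> sm {i. \<exists>j. lt j \<xi> \<and> \<theta> i \<in> N j}"
      "\<And>\<xi>. \<xi> \<in> D \<Longrightarrow> sm {i. \<not> lt \<xi> (\<theta> i)}"
      using reindex by blast
    \<comment> \<open>The tail beyond \<open>\<xi>\<close> contains almost all of \<open>S0\<close>,
      so its preimage has at least the measure of \<open>S0\<close>; half of that leaves room for a
      compact subset and is a bound independent of \<open>\<xi>\<close>.\<close>
    have "\<exists>K. compact K \<and> K \<subseteq> \<psi> -` {i. \<theta> i \<in> D \<and> lt \<xi> (\<theta> i)} \<and> measure W S0 / 2 < measure M K"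
      if xi: "\<xi> \<in> D" for \<xi>
    proof -
      let ?A = "{i. \<theta> i \<in> D \<and> lt \<xi> (\<theta> i)}"
      have "sm (- ?A)"
        by (rule sm_subset[OF sm_Un[OF th(1) th(4)[OF xi]]]) auto
      then have z: "measure W (- ?A \<inter> S0) = 0" by (simp add: sm_def)
      have "measure W S0 \<le> measure W (?A \<union> (- ?A \<inter> S0))" by (intro W.finite_measure_mono) auto
      also have "\<dots> \<le> measure W ?A + measure W (- ?A \<inter> S0)" by (intro measure_Un_le) auto
      finally have "measure W S0 / 2 < N.prob (\<psi> -` ?A)" using z S0 w[of ?A] by linarith
      then show ?thesis by (rule radon_inner_regular[OF M psi]) blast
    qed
    then obtain K where K: "\<And>\<xi>. \<xi> \<in> D \<Longrightarrow> compact (K \<xi>)" "\<And>\<xi>. \<xi> \<in> D \<Longrightarrow> K \<xi> \<subseteq> \<psi> -` {i. \<theta> i \<in> D \<and> lt \<xi> (\<theta> i)}"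
      "\<And>\<xi>. \<xi> \<in> D \<Longrightarrow> measure W S0 / 2 < measure M (K \<xi>)" by metis
    show False
    proof (rule no_compact_tail_family[OF T2 M.prob_space_axioms sets th(1,2,3) K(1,3)])
      show "0 < measure W S0 / 2" using S0 by simp
    qed (use K(2) in blast)+
  qed
qed

section \<open>Universally measurable maps into topological groups\<close>

lemma universally_measurable_in_completion:
  assumes "universally_measurable_set A" "radon_prob_measure M"
  shows "A \<in> sets (completion M)"
proof -
  obtain B B' where B: "B \<in> sets borel" "B' \<in> sets borel" "B \<subseteq> A" "A \<subseteq> B'" "emeasure M (B' - B) = 0"
    using assms(1)[unfolded universally_measurable_set_def, rule_format, OF assms(2)] by blast
  have "sets M = sets borel" using assms(2) by (simp add: radon_prob_measure_def)
  then have "B' - B \<in> null_sets M" "B \<in> sets M" using B by (simp_all add: null_sets_def)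
  moreover have "A = B \<union> (A - B)" "A - B \<subseteq> B' - B" using B by blast+
  ultimately show ?thesis using sets_completionI by metis
qed

text \<open>Conditioning on a compact part of one layer of Stone's refinement must not leave the
  Radon measures, as universal measurability speaks of no others.\<close>

lemma radon_uniform_measure:
  assumes M: "radon_prob_measure M" and A: "A \<in> sets borel" "measure M A > 0"
  shows "radon_prob_measure (uniform_measure M A)"
proof -
  interpret M: prob_space M using M by (simp add: radon_prob_measure_def)
  have sets: "sets M = sets borel" using M by (simp add: radon_prob_measure_def)
  have um: "emeasure (uniform_measure M A) B = ennreal (measure M (A \<inter> B) / measure M A)" if "B \<in> sets borel" for B
    using that A sets by (simp add: M.emeasure_eq_measure divide_ennreal)
  show ?thesis
    unfolding radon_prob_measure_def
  proof (intro conjI ballI allI impI)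
    show "prob_space (uniform_measure M A)"
      using A sets by (intro prob_space_uniform_measure) (auto simp: M.emeasure_eq_measure)
    fix B :: "'a set" and a assume B: "B \<in> sets borel" "a < emeasure (uniform_measure M A) B"
    then obtain r where r: "a = ennreal r" "r \<ge> 0" "r < measure M (A \<inter> B) / measure M A"
      unfolding um[OF B(1)] by (cases a) (auto simp: ennreal_less_iff)
    then have "ennreal (r * measure M A) < emeasure M (A \<inter> B)"
      using A by (simp add: M.emeasure_eq_measure ennreal_less_iff pos_less_divide_eq)
    then obtain K where K: "compact K" "K \<subseteq> A \<inter> B" "ennreal (r * measure M A) < emeasure M K"
      using M A B unfolding radon_prob_measure_def by blast
    have KM: "K \<in> sets borel" using K(3) sets by (metis emeasure_notin_sets not_less_zero)
    have "A \<inter> K = K" using K(2) by blast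
    then have "a < emeasure (uniform_measure M A) K"
      unfolding um[OF KM] using K(3) r A by (simp add: M.emeasure_eq_measure ennreal_less_iff pos_less_divide_eq)
    then show "\<exists>K. compact K \<and> K \<subseteq> B \<and> a < emeasure (uniform_measure M A) K" using K by blast
  qed (simp add: sets)
qed

text \<open>The open sets \<^term>\<open>Q n z\<close> below are the layers of Stone's \<open>\<sigma>\<close>-discrete refinement of the
  cover by right translates of a neighbourhood of zero; each layer turns \<^term>\<open>f\<close> into a map
  onto a discrete index set.\<close>

theorem right_translate_positive_measure:
  fixes f :: "'a::topological_space \<Rightarrow> 'b::topological_group_add"
  assumes T2: "Hausdorff_space (euclidean :: 'a topology)"
    and M: "radon_prob_measure M" and f: "universally_measurable_fun f"
    and W: "open W" "0 \<in> W"
  obtains y K where "compact K" "K \<subseteq> {x. f x - y \<in> W}" "measure M K > 0"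
proof (rule ccontr)
  assume "\<not> thesis"
  then have neg: "\<not> measure M K > 0" if "compact K" "K \<subseteq> {x. f x - y \<in> W}" for y K
    using \<open>\<And>K y. compact K \<Longrightarrow> K \<subseteq> {x. f x - y \<in> W} \<Longrightarrow> 0 < measure M K \<Longrightarrow> thesis\<close> that by blast
  interpret M: prob_space M using M by (simp add: radon_prob_measure_def)
  interpret N: prob_space "completion M" by (rule M.prob_space_completion)
  have sets: "sets M = sets borel" and sp: "space M = UNIV"
    using M sets_eq_imp_space_eq[of M borel] by (auto simp: radon_prob_measure_def)
  obtain V0 where V0: "sym_nhd V0" "V0 \<subseteq> W" using sym_nhd_subset[OF W] .
  have "\<exists>V. \<forall>n. (sym_nhd (V n) \<and> V n \<subseteq> V0) \<and> (\<forall>x\<in>V (Suc n). \<forall>y\<in>V (Suc n). x + y \<in> V n)"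
  proof (rule dependent_nat_choice)
    fix U n assume U: "sym_nhd U \<and> U \<subseteq> V0"
    then obtain V where V: "sym_nhd V" "\<And>x y. x \<in> V \<Longrightarrow> y \<in> V \<Longrightarrow> x + y \<in> U"
      using sym_nhd_half[of U] sym_nhdD by metis
    then have "V \<subseteq> U" using sym_nhdD(2)[OF V(1)] by (metis add.right_neutral subsetI)
    then show "\<exists>V. (sym_nhd V \<and> V \<subseteq> V0) \<and> (\<forall>x\<in>V. \<forall>y\<in>V. x + y \<in> U)" using U V by blast
  qed (use V0 in blast)
  then obtain V where V: "\<And>n. sym_nhd (V n)" "\<And>n. V n \<subseteq> V0"
    "\<And>n x y. x \<in> V (Suc n) \<Longrightarrow> y \<in> V (Suc n) \<Longrightarrow> x + y \<in> V n" by blast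
  \<comment> \<open>\<open>P n\<close> is \<open>V n + ... + V 1\<close>; even with another copy of
    \<open>V n\<close> in front, the sum stays in \<open>V0\<close>.\<close>
  define P where "P = rec_nat {0} (\<lambda>n P. {a + p | a p. a \<in> V (Suc n) \<and> p \<in> P})"
  have P0: "P 0 = {0}" and PS: "P (Suc n) = {a + p | a p. a \<in> V (Suc n) \<and> p \<in> P n}" for n
    by (simp_all add: P_def)
  have VP: "a + p \<in> V0" if "a \<in> V n" "p \<in> P n" for a p n
    using that
  proof (induct n arbitrary: a p)
    case 0 then show ?case using V(2)[of 0] by (auto simp: P0)
  next
    case (Suc n)
    then obtain a' p' where "p = a' + p'" "a' \<in> V (Suc n)" "p' \<in> P n" by (auto simp: PS)
    then show ?case using Suc(1)[of "a + a'" p'] V(3)[of a n a'] Suc(2) by (simp add: add.assoc)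
  qed
  \<comment> \<open>For \<open>c\<close> in the plain translate \<open>W + z\<close> there need be
    no \<open>n\<close> with \<open>V n + c\<close> inside it, as the \<open>V n\<close> may fail to
    be a neighbourhood base. In the union of the sets \<open>P n + z\<close> there is: a point of
    level \<open>n\<close> may be moved by \<open>V (Suc n)\<close>.\<close>
  define A where "A z = {c. \<exists>n. c - z \<in> P n}" for z
  have AW: "A z \<subseteq> {c. c - z \<in> W}" for z
    using VP[of 0] V0(2) sym_nhdD(2)[OF V(1)] by (force simp: A_def)
  obtain r :: "'b rel" where "well_order_on UNIV r" using well_order_on by blast
  then have lin: "linear_order_on UNIV r" and wf: "wf (r - Id)"
    by (auto simp: well_order_on_def)
  define lt where "lt i j \<longleftrightarrow> (i, j) \<in> r - Id" for i j
  have tot: "lt i j \<or> i = j \<or> lt j i" for i j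
    using lin by (auto simp: linear_order_on_def total_on_def lt_def)
  \<comment> \<open>\<open>z\<close> is the first index with \<open>c\<close> in \<open>A z\<close>,
    and \<open>V n + c\<close> stays in \<open>A z\<close>. Hence points belonging to different
    \<open>z\<close> are never \<open>V n\<close>-close, and for fixed \<open>n\<close> their
    \<open>V (Suc n)\<close>-enlargements \<open>Q n z\<close> are disjoint.\<close>
  define E where "E n z = {c \<in> A z. (\<forall>z'. lt z' z \<longrightarrow> c \<notin> A z') \<and> (\<forall>a\<in>V n. a + c \<in> A z)}" for n z
  define Q where "Q n z = (\<Union>c\<in>E n z. {x. x - c \<in> V (Suc n)})" for n z
  have V_Suc: "V (Suc n) \<subseteq> V n" for n
    using V(3)[of _ n 0] sym_nhdD(2)[OF V(1)] by (metis add.right_neutral subsetI)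
  have openQ: "open (Q n z)" for n z
    unfolding Q_def diff_conv_add_uminus using sym_nhdD(1)[OF V(1)]
    by (intro open_UN ballI open_preimage continuous_intros) auto
  have QA: "Q n z \<subseteq> A z" for n z
  proof
    fix x assume "x \<in> Q n z"
    then obtain c where c: "c \<in> E n z" "x - c \<in> V (Suc n)" by (auto simp: Q_def)
    then have "(x - c) + c \<in> A z" using V_Suc[of n] unfolding E_def by blast
    then show "x \<in> A z" by simp
  qed
  have disj0: "Q n z \<inter> Q n z' = {}" if lt: "lt z z'" for n z z'
  proof (rule ccontr)
    assume "Q n z \<inter> Q n z' \<noteq> {}"
    then obtain x c c' where x: "c \<in> E n z" "c' \<in> E n z'" "x - c \<in> V (Suc n)" "x - c' \<in> V (Suc n)"
      by (auto simp: Q_def)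
    have "- (x - c') + (x - c) \<in> V n" by (intro V(3) sym_nhdD(3)[OF V(1)] x)
    then have "(- (x - c') + (x - c)) + c \<in> A z" using x(1) unfolding E_def by blast
    moreover have "(- (x - c') + (x - c)) + c = c'"
      unfolding add.assoc by simp
    ultimately show False using x(2) lt by (simp add: E_def)
  qed
  have disj: "z = z'" if "x \<in> Q n z" "x \<in> Q n z'" for n z z' x
    using tot[of z z']
  proof (elim disjE)
    assume "lt z z'" then show ?thesis using disj0[of z z' n] that by blast
  next
    assume "lt z' z" then show ?thesis using disj0[of z' z n] that by blast
  qed
  have cover: "\<exists>n z. c \<in> Q n z" for c
  proof -
    have "c \<in> A c" unfolding A_def using P0 by (auto intro: exI[of _ 0])
    then have "c \<in> {z. c \<in> A z}" by simp
    then obtain z where "z \<in> {z. c \<in> A z}" "\<And>z'. (z', z) \<in> r - Id \<Longrightarrow> z' \<notin> {z. c \<in> A z}"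
      by (rule wfE_min[OF wf]) blast
    then have z: "c \<in> A z" "\<And>z'. lt z' z \<Longrightarrow> c \<notin> A z'" by (simp_all add: lt_def)
    then obtain n where n: "c - z \<in> P n" by (auto simp: A_def)
    have "a + c \<in> A z" if "a \<in> V (Suc n)" for a
    proof -
      have "a + (c - z) \<in> P (Suc n)" unfolding PS using that n by blast
      then show ?thesis unfolding A_def by (auto simp: add_diff_eq)
    qed
    then have "c \<in> E (Suc n) z" using z by (auto simp: E_def)
    then have "c \<in> Q (Suc n) z" unfolding Q_def using sym_nhdD(2)[OF V(1)] by force
    then show ?thesis by blast
  qed
  define O' where "O' n S = (\<Union>z\<in>S. Q n z)" for n S
  have um: "universally_measurable_set (f -` O' n S)" for n S
    using f openQ unfolding universally_measurable_fun_def O'_def by blast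
  have "\<exists>n. N.prob (f -` O' n UNIV) > 0"
  proof (rule ccontr)
    assume "\<nexists>n. N.prob (f -` O' n UNIV) > 0"
    then have "N.prob (f -` O' n UNIV) = 0" for n
      by (metis zero_less_measure_iff)
    then have "(\<Union>n. f -` O' n UNIV) \<in> null_sets (completion M)"
      using universally_measurable_in_completion[OF um M]
      by (intro null_sets_UN) (auto simp: null_sets_def N.emeasure_eq_measure)
    moreover have "(\<Union>n. f -` O' n UNIV) = space (completion M)"
      using cover sp by (auto simp: O'_def)
    ultimately show False using N.emeasure_space_1 by (simp add: null_sets_def)
  qed
  then obtain n where n: "N.prob (f -` O' n UNIV) > 0" ..
  define B where "B = f -` O' n UNIV"
  have BN: "B \<in> sets (completion M)" unfolding B_def by (rule universally_measurable_in_completion[OF um M])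
  obtain B0 where B0: "compact B0" "B0 \<subseteq> B" "0 < measure M B0"
    by (rule radon_inner_regular[OF M BN, of 0]) (use n in \<open>simp add: B_def\<close>)
  have B0b: "B0 \<in> sets borel" using B0(1) Hausdorff_compact_closed[OF T2] by auto
  \<comment> \<open>Under this measure everything outside layer \<open>n\<close> is null, so the
    arbitrary values of the index map \<psi> there do no harm.\<close>
  define M' where "M' = uniform_measure M B0"
  have M': "radon_prob_measure M'" unfolding M'_def by (rule radon_uniform_measure[OF M B0b B0(3)])
  interpret M': prob_space M' using M' by (simp add: radon_prob_measure_def)
  interpret N': prob_space "completion M'" by (rule M'.prob_space_completion)
  have nullB0: "- B0 \<in> null_sets M'"
    using B0b sets by (auto simp: M'_def null_sets_def Compl_eq_Diff_UNIV)
  have nullsub: "S \<in> null_sets (completion M')" if "S \<inter> B = {}" for S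
    using null_sets_completion_subset[of S "- B0" M'] null_sets_completionI[OF nullB0] that B0(2) by blast
  define \<psi> where "\<psi> x = (SOME z. f x \<in> Q n z)" for x
  have psi: "f x \<in> Q n (\<psi> x)" if "x \<in> B" for x
    using that someI_ex[of "\<lambda>z. f x \<in> Q n z"] by (auto simp: B_def O'_def \<psi>_def)
  \<comment> \<open>Every union of the sets \<open>Q n z\<close> is open, so up to a null set the
    preimage of an arbitrary index set is the preimage of an open set under
    \<open>f\<close>.\<close>
  have psi_eq: "\<psi> -` S = f -` O' n S \<union> (\<psi> -` S - B)" for S
  proof (intro equalityI subsetI)
    fix x assume "x \<in> \<psi> -` S"
    then show "x \<in> f -` O' n S \<union> (\<psi> -` S - B)" using psi[of x] by (auto simp: O'_def)
  next
    fix x assume x: "x \<in> f -` O' n S \<union> (\<psi> -` S - B)"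
    show "x \<in> \<psi> -` S"
    proof (cases "x \<in> f -` O' n S")
      case True
      then obtain z where z: "z \<in> S" "f x \<in> Q n z" by (auto simp: O'_def)
      then have "x \<in> B" by (auto simp: B_def O'_def)
      then show ?thesis using psi disj z by (metis vimageI)
    qed (use x in blast)
  qed
  show False
  proof (rule no_total_null_partition[OF T2 M', of \<psi>])
    show "\<psi> -` S \<in> sets (completion M')" for S
    proof -
      have "\<psi> -` S - B \<in> null_sets (completion M')" by (rule nullsub) blast
      then show ?thesis
        by (subst psi_eq) (intro sets.Un universally_measurable_in_completion[OF um M'] null_setsD2)
    qed
    fix z
    have "N'.prob (f -` Q n z) = 0"
    proof (rule ccontr)
      assume "N'.prob (f -` Q n z) \<noteq> 0"
      then have pos: "0 < N'.prob (f -` Q n z)" by (simp add: zero_less_measure_iff)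
      have "f -` Q n z \<in> sets (completion M')"
        using universally_measurable_in_completion[OF um M', of n "{z}"] by (simp add: O'_def)
      then obtain K where K: "compact K" "K \<subseteq> f -` Q n z" "0 < measure M' K"
        by (rule radon_inner_regular[OF M' _ pos])
      have KM: "K \<in> sets M" using K(1) Hausdorff_compact_closed[OF T2] sets by auto
      then have "measure M' K = measure M (B0 \<inter> K) / measure M B0"
        using B0b sets B0(3) unfolding M'_def by (intro measure_uniform_measure) (auto simp: M.emeasure_eq_measure)
      then have "measure M (B0 \<inter> K) > 0" using K(3) B0(3) by (simp add: zero_less_divide_iff)
      moreover have "measure M (B0 \<inter> K) \<le> measure M K" using KM by (intro M.finite_measure_mono) auto
      ultimately have "measure M K > 0" by linarith
      moreover have "K \<subseteq> {x. f x - z \<in> W}" using K(2) QA AW by blast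
      ultimately show False using neg K(1) by blast
    qed
    then have "f -` Q n z \<in> null_sets (completion M')"
      using universally_measurable_in_completion[OF um M', of n "{z}"]
      by (simp add: O'_def null_sets_def N'.emeasure_eq_measure)
    moreover have "\<psi> -` {z} - B \<in> null_sets (completion M')" by (rule nullsub) blast
    ultimately have "f -` Q n z \<union> (\<psi> -` {z} - B) \<in> null_sets (completion M')"
      by (rule null_sets.Un)
    then show "N'.prob (\<psi> -` {z}) = 0"
      by (subst psi_eq) (simp add: O'_def null_sets_def measure_def)
  qed
qed

section \<open>Steinhaus's argument for piecewise translations\<close>

text \<open>\<open>K1\<close> and its image under the piecewise translation have equal measure and
  both lie in \<open>G\<close>, which is too small to hold them disjointly. At a common point,
  \<open>h (v i)\<close> is the difference of two elements of \<open>V + y\<close>. \<open>U\<close>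
  is fixed before the partition, because the partition used later is chosen according to
  \<open>U\<close>.\<close>

theorem piecewise_translation_Steinhaus:
  fixes h :: "'a::topological_group_add \<Rightarrow> 'b::topological_group_add" and C :: "'a set"
  assumes T2: "Hausdorff_space (euclidean :: 'a topology)"
    and hom: "\<And>x y. h (x + y) = h x + h y" and um: "universally_measurable_fun h"
    and C: "compact C" "C \<noteq> {}" and W: "open W" "0 \<in> W"
  obtains U where "sym_nhd U"
    "\<And>(I :: 'i set) P v s. finite I \<Longrightarrow> C = (\<Union>i\<in>I. P i) \<Longrightarrow> (\<And>i. i \<in> I \<Longrightarrow> compact (P i)) \<Longrightarrow>
      disjoint_family_on P I \<Longrightarrow> bij_betw s I I \<Longrightarrow> (\<And>i. i \<in> I \<Longrightarrow> v i \<in> U) \<Longrightarrow>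
      (\<And>i. i \<in> I \<Longrightarrow> (+) (v i) ` P i = P (s i)) \<Longrightarrow> \<exists>i\<in>I. h (v i) \<in> W"
proof -
  obtain M where M: "radon_prob_measure M" "emeasure M C = 1"
    and inv: "\<And>D v K. D \<subseteq> C \<Longrightarrow> compact (C - D) \<Longrightarrow> (+) v ` D \<subseteq> C \<Longrightarrow> compact (C - (+) v ` D) \<Longrightarrow>
      compact K \<Longrightarrow> K \<subseteq> D \<Longrightarrow> emeasure M ((+) v ` K) = emeasure M K"
    by (rule left_invariant_radon_measure_exists[OF T2 C]) blast
  interpret M: prob_space M using M by (simp add: radon_prob_measure_def)
  have sets: "sets M = sets borel" and sp: "space M = UNIV"
    using M sets_eq_imp_space_eq[of M borel] by (auto simp: radon_prob_measure_def)
  have compact_sets: "L \<in> sets M" if "compact L" for L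
    using Hausdorff_compact_closed[OF T2 that] sets by auto
  obtain V where V: "sym_nhd V" "\<And>x y. x \<in> V \<Longrightarrow> y \<in> V \<Longrightarrow> x + y \<in> W"
    by (rule sym_nhd_half[OF W]) blast
  obtain y K where K: "compact K" "K \<subseteq> {x. h x - y \<in> V}" "measure M K > 0"
    by (rule right_translate_positive_measure[OF T2 M(1) um sym_nhdD(1,2)[OF V(1)]]) blast
  define K1 where "K1 = K \<inter> C"
  have K1: "compact K1" "K1 \<subseteq> C"
    using K(1) Hausdorff_compact_closed[OF T2 C(1)] by (auto simp: K1_def compact_Int_closed)
  have "measure M C = 1" using M(2) by (simp add: measure_def)
  then have "measure M (UNIV - C) = 0" using M.prob_compl[OF compact_sets[OF C(1)]] sp by simp
  moreover have "measure M K \<le> measure M (K1 \<union> (UNIV - C))"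
    using compact_sets[OF K1(1)] sets.compl_sets[OF compact_sets[OF C(1)]] sp
    by (intro M.finite_measure_mono sets.Un) (auto simp: K1_def)
  moreover have "measure M (K1 \<union> (UNIV - C)) \<le> measure M K1 + measure M (UNIV - C)"
    using compact_sets[OF K1(1)] sets.compl_sets[OF compact_sets[OF C(1)]] sp by (intro measure_Un_le) simp_all
  ultimately have p: "measure M K1 > 0" using K(3) by linarith
  have "measure M (UNIV - K1) = 1 - measure M K1"
    using M.prob_compl[OF compact_sets[OF K1(1)]] sp by simp
  \<comment> \<open>Outer regularity by complementation: a compact \<open>L\<close> off
    \<open>K1\<close> of measure above \<open>1 - 2 * measure M K1\<close> leaves an open set around
    \<open>K1\<close> of measure below \<open>2 * measure M K1\<close>.\<close>
  then have "1 - 2 * measure M K1 < measure (completion M) (UNIV - K1)"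
    using p sets.compl_sets[OF compact_sets[OF K1(1)]] sp by simp
  moreover have "UNIV - K1 \<in> sets (completion M)"
    using sets.compl_sets[OF compact_sets[OF K1(1)]] sp by simp
  ultimately obtain L where L: "compact L" "L \<subseteq> UNIV - K1" "1 - 2 * measure M K1 < measure M L"
    using radon_inner_regular[OF M(1)] by blast
  define G where "G = UNIV - L"
  have G: "open G" "K1 \<subseteq> G" "measure M G < 2 * measure M K1"
    using L Hausdorff_compact_closed[OF T2 L(1)] M.prob_compl[OF compact_sets[OF L(1)]] sp
    by (auto simp: G_def Compl_eq_Diff_UNIV[symmetric])
  obtain U where U: "sym_nhd U" "\<And>k v. k \<in> K1 \<Longrightarrow> v \<in> U \<Longrightarrow> v + k \<in> G"
    by (rule compact_sym_nhd_left[OF K1(1) G(1,2)]) blast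
  show thesis
  proof (rule that[OF U(1)], rule ccontr)
    fix I :: "'i set" and P v s
    assume I: "finite I" "C = (\<Union>i\<in>I. P i)" "\<And>i. i \<in> I \<Longrightarrow> compact (P i)" "disjoint_family_on P I"
      and s: "bij_betw s I I" and v: "\<And>i. i \<in> I \<Longrightarrow> v i \<in> U"
      and vP: "\<And>i. i \<in> I \<Longrightarrow> (+) (v i) ` P i = P (s i)"
      and neg: "\<not> (\<exists>i\<in>I. h (v i) \<in> W)"
    have sI: "s i \<in> I" if "i \<in> I" for i using s that by (auto simp: bij_betw_def)
    have clopen: "compact (C - P i)" if "i \<in> I" for i
    proof -
      have "C - P i = (\<Union>j\<in>I - {i}. P j)"
        using I(2,4) that by (auto simp: disjoint_family_on_def)
      then show ?thesis using I(1,3) by (auto intro!: compact_UN)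
    qed
    define Q where "Q i = K1 \<inter> P i" for i
    have Q: "compact (Q i)" if "i \<in> I" for i
      using K1(1) Hausdorff_compact_closed[OF T2 I(3)[OF that]] by (auto simp: Q_def compact_Int_closed)
    have vQ: "compact ((+) (v i) ` Q i)" if "i \<in> I" for i
      using Q[OF that] by (rule compact_plus_left)
    have inv': "measure M ((+) (v i) ` Q i) = measure M (Q i)" if i: "i \<in> I" for i
    proof -
      have "emeasure M ((+) (v i) ` Q i) = emeasure M (Q i)"
      proof (rule inv[of "P i"])
        show "P i \<subseteq> C" "(+) (v i) ` P i \<subseteq> C" using I(2) i sI[OF i] unfolding vP[OF i] by auto
        show "compact (C - P i)" "compact (C - (+) (v i) ` P i)"
          using clopen i sI unfolding vP[OF i] by auto
        show "compact (Q i)" "Q i \<subseteq> P i" using Q i by (auto simp: Q_def)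
      qed
      then show ?thesis by (simp add: measure_def)
    qed
    have "K1 = (\<Union>i\<in>I. Q i)" using K1(2) I(2) by (auto simp: Q_def)
    moreover have "measure M (\<Union>i\<in>I. Q i) = (\<Sum>i\<in>I. measure M (Q i))"
    proof (rule M.finite_measure_finite_Union[OF I(1)])
      show "Q ` I \<subseteq> M.events" using Q compact_sets by blast
      show "disjoint_family_on Q I" using I(4) by (auto simp: disjoint_family_on_def Q_def)
    qed
    ultimately have sum: "measure M K1 = (\<Sum>i\<in>I. measure M (Q i))" by simp
    have "disjoint_family_on (\<lambda>i. (+) (v i) ` Q i) I"
      unfolding disjoint_family_on_def
    proof (intro ballI impI)
      fix i j assume ij: "i \<in> I" "j \<in> I" "i \<noteq> j"
      have "P (s i) \<inter> P (s j) = {}"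
      proof (rule disjoint_family_onD[OF I(4) sI sI])
        show "s i \<noteq> s j" using s ij inj_on_eq_iff[of s I i j] by (simp add: bij_betw_def)
      qed (use ij in auto)
      moreover have "(+) (v i) ` Q i \<subseteq> P (s i)" "(+) (v j) ` Q j \<subseteq> P (s j)"
        using vP ij by (auto simp: Q_def)
      ultimately show "(+) (v i) ` Q i \<inter> (+) (v j) ` Q j = {}" by blast
    qed
    then have "measure M (\<Union>i\<in>I. (+) (v i) ` Q i) = (\<Sum>i\<in>I. measure M ((+) (v i) ` Q i))"
      using I(1) vQ compact_sets by (intro M.finite_measure_finite_Union) auto
    also have "\<dots> = measure M K1" unfolding sum by (rule sum.cong) (auto simp: inv')
    finally have mQ: "measure M (\<Union>i\<in>I. (+) (v i) ` Q i) = measure M K1" .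
    have "K1 \<inter> (\<Union>i\<in>I. (+) (v i) ` Q i) = {}"
    proof (rule ccontr)
      assume "K1 \<inter> (\<Union>i\<in>I. (+) (v i) ` Q i) \<noteq> {}"
      then obtain i k where ik: "i \<in> I" "k \<in> K1" "v i + k \<in> K1" by (auto simp: Q_def)
      then have "h (v i + k) - y \<in> V" "h k - y \<in> V" using K(2) by (auto simp: K1_def)
      then have "(h (v i + k) - y) + - (h k - y) \<in> W" using V sym_nhdD(3) by blast
      moreover have "(h (v i + k) - y) + - (h k - y) = h (v i)"
        by (simp add: hom diff_conv_add_uminus add.assoc minus_add del: add_uminus_conv_diff)
      ultimately show False using neg ik by metis
    qed
    then have "measure M (K1 \<union> (\<Union>i\<in>I. (+) (v i) ` Q i)) = 2 * measure M K1"
      using compact_sets[OF K1(1)] vQ compact_sets I(1) mQ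
      by (subst M.finite_measure_Union) (auto intro!: sets.finite_UN)
    moreover have "K1 \<union> (\<Union>i\<in>I. (+) (v i) ` Q i) \<subseteq> G"
      using G(2) U(2) v by (auto simp: Q_def)
    then have "measure M (K1 \<union> (\<Union>i\<in>I. (+) (v i) ` Q i)) \<le> measure M G"
      using G(1) sets by (intro M.finite_measure_mono) auto
    ultimately show False using G(3) by linarith
  qed
qed

section \<open>Homomorphisms of topological groups\<close>

text \<open>\<^term>\<open>Q n A\<close> says that the closure of \<^term>\<open>A\<close> in the compact space lies in the
  \<^term>\<open>n\<close>-th open set of a sequence cutting out the \<open>G\<^sub>\<delta>\<close> copy of the group.\<close>

lemma cech_complete_sequence:
  assumes "cech_complete_in TYPE('a::topological_space) TYPE('k::t2_space)"
  obtains Q :: "nat \<Rightarrow> 'a::topological_space set \<Rightarrow> bool" where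
    "Hausdorff_space (euclidean :: 'a::topological_space topology)"
    "\<And>n A B. Q n A \<Longrightarrow> B \<subseteq> A \<Longrightarrow> Q n B"
    "\<And>n A B. Q n A \<Longrightarrow> Q n B \<Longrightarrow> Q n (A \<union> B)"
    "\<And>n x. \<exists>U. open U \<and> x \<in> U \<and> Q n U"
    "\<And>B. (\<And>n. Q n (B n)) \<Longrightarrow> (\<And>n. B (Suc n) \<subseteq> B n) \<Longrightarrow> compact (\<Inter>n. closure (B n))"
    "\<And>B U. (\<And>n. Q n (B n)) \<Longrightarrow> (\<And>n. B (Suc n) \<subseteq> B n) \<Longrightarrow> open U \<Longrightarrow> (\<Inter>n. closure (B n)) \<subseteq> U \<Longrightarrow>
      \<exists>n. B n \<subseteq> U"
proof -
  obtain S :: "'k set" where K: "compact (UNIV :: 'k set)" and S: "gdelta_in euclidean S" "(UNIV :: 'a set) homeomorphic S"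
    using assms by (auto simp: cech_complete_in_def)
  obtain e f where ef: "homeomorphism (UNIV :: 'a set) S e f"
    using S(2) by (auto simp: homeomorphic_def)
  have e: "continuous_on UNIV e" "range e = S" "\<And>x. f (e x) = x" "continuous_on S f" "\<And>y. y \<in> S \<Longrightarrow> e (f y) = y"
    using ef by (auto simp: homeomorphism_def)
  obtain \<U> where U: "countable \<U>" "\<And>G. G \<in> \<U> \<Longrightarrow> open G" "\<Inter>\<U> = S"
    using S(1) unfolding gdelta_in_alt intersection_of_def by auto
  \<comment> \<open>Adding \<open>UNIV\<close> keeps the family nonempty, so that it can be
    enumerated.\<close>
  define G where "G = from_nat_into (insert UNIV \<U>)"
  have "range G = insert UNIV \<U>" unfolding G_def by (rule range_from_nat_into) (use U in auto)
  then have G: "open (G n)" "(\<Inter>n. G n) = S" "S \<subseteq> G n" for n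
    using U by auto (metis UNIV_I image_eqI insert_iff open_UNIV rangeI)
  define Q where "Q n A \<longleftrightarrow> closure (e ` A) \<subseteq> G n" for n A
  have T2: "Hausdorff_space (euclidean :: 'k topology)"
    unfolding Hausdorff_space_def disjnt_def using hausdorff by simp blast
  have reg: "\<exists>U. open U \<and> x \<in> U \<and> closure U \<subseteq> V" if "open V" "x \<in> V" for x :: 'k and V
  proof -
    have "compact (- V)" using K that compact_Int_closed[of UNIV "- V"] by (simp add: closed_Compl)
    moreover have "{x} \<inter> - V = {}" using that by simp
    ultimately obtain U U' where U: "open U" "open U'" "{x} \<subseteq> U" "- V \<subseteq> U'" "U \<inter> U' = {}"
      by (rule Hausdorff_compact_separation[OF T2 compact_sing])
    have "closure U \<subseteq> - U'" using U(2,5) by (intro closure_minimal) (blast, simp add: closed_Compl)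
    then have "closure U \<subseteq> V" using U(4) by blast
    then show ?thesis using U(1,3) by blast
  qed
  have cl: "closure B = e -` closure (e ` B)" for B
  proof (intro equalityI subsetI)
    fix x assume "x \<in> closure B"
    then have "e x \<in> e ` closure B" by blast
    also have "\<dots> \<subseteq> closure (e ` B)"
      by (rule image_closure_subset[OF continuous_on_subset[OF e(1)]]) (auto intro: closure_subset[THEN subsetD])
    finally show "x \<in> e -` closure (e ` B)" by simp
  next
    fix x assume x: "x \<in> e -` closure (e ` B)"
    show "x \<in> closure B"
      unfolding closure_iff_nhds_not_empty
    proof (intro allI impI)
      fix A U assume A: "U \<subseteq> A" "open U" "x \<in> U"
      have "openin (top_of_set S) (S \<inter> f -` U)"
        using e(4) A(2) by (auto simp: continuous_on_open_gen intro: continuous_openin_preimage_gen)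
      then obtain V where V: "open V" "S \<inter> f -` U = S \<inter> V" by (auto simp: openin_open)
      have "e x \<in> V" using V e A by auto
      then have "V \<inter> e ` B \<noteq> {}"
        using x V(1) open_Int_closure_eq_empty[OF V(1), of "e ` B"] by auto
      then obtain b where "b \<in> B" "e b \<in> V" by auto
      then have "b \<in> U" using V e by (metis IntD2 IntI rangeI vimageD)
      then show "B \<inter> A \<noteq> {}" using A \<open>b \<in> B\<close> by blast
    qed
  qed
  have inS: "(\<Inter>n. closure (e ` B n)) \<subseteq> S" if "\<And>n. Q n (B n)" for B
    using that G(2) by (auto simp: Q_def)
  show thesis
  proof (rule that[of Q])
    show "Hausdorff_space (euclidean :: 'a topology)"
      unfolding Hausdorff_space_def
    proof (intro allI impI, elim conjE)
      fix x y :: 'a assume "x \<noteq> y"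
      then have "e x \<noteq> e y" using e(3) by metis
      then obtain U V where "open U" "open V" "e x \<in> U" "e y \<in> V" "U \<inter> V = {}"
        using hausdorff[of "e x" "e y"] by blast
      then show "\<exists>U V. openin euclidean U \<and> openin euclidean V \<and> x \<in> U \<and> y \<in> V \<and> disjnt U V"
        using open_vimage[OF _ e(1)] by (intro exI[of _ "e -` U"] exI[of _ "e -` V"]) (auto simp: disjnt_def)
    qed
    show "Q n B" if "Q n A" "B \<subseteq> A" for n A B
      using that closure_mono[of "e ` B" "e ` A"] by (auto simp: Q_def)
    show "Q n (A \<union> B)" if "Q n A" "Q n B" for n A B
      using that by (auto simp: Q_def image_Un)
    show "\<exists>U. open U \<and> x \<in> U \<and> Q n U" for n x
    proof -
      have "e x \<in> G n" using G(3) e(2) by blast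
      then obtain V where V: "open V" "e x \<in> V" "closure V \<subseteq> G n" using reg[OF G(1)] by blast
      have "closure (e ` (e -` V)) \<subseteq> closure V" by (intro closure_mono) auto
      then show ?thesis using V e(1) by (intro exI[of _ "e -` V"]) (auto simp: Q_def open_vimage)
    qed
  next
    fix B assume B: "\<And>n. Q n (B n)" "\<And>n. B (Suc n) \<subseteq> B n"
    let ?L = "\<Inter>n. closure (e ` B n)"
    have "closed ?L" by (rule closed_INT) simp
    then have L: "compact ?L" using K compact_Int_closed[of UNIV ?L] by simp
    \<comment> \<open>By \<open>inS\<close> the intersection of the closures taken in the compact
      space stays inside \<open>S\<close>, so \<open>f\<close> can carry it back as a compact
      set.\<close>
    have eq: "(\<Inter>n. closure (B n)) = f ` ?L"
    proof (intro equalityI subsetI)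
      fix x assume "x \<in> (\<Inter>n. closure (B n))"
      then have "e x \<in> ?L" by (auto simp: cl)
      then show "x \<in> f ` ?L" using e(3) by (metis image_eqI)
    next
      fix x assume "x \<in> f ` ?L"
      then obtain y where y: "y \<in> ?L" "x = f y" by blast
      then have "e x = y" using inS[OF B(1)] e(5) by blast
      then show "x \<in> (\<Inter>n. closure (B n))" using y by (simp add: cl)
    qed
    show "compact (\<Inter>n. closure (B n))"
      unfolding eq using L inS[OF B(1)] by (intro compact_continuous_image continuous_on_subset[OF e(4)])
    fix U :: "'a set" assume U: "open U" "(\<Inter>n. closure (B n)) \<subseteq> U"
    have "openin (top_of_set S) (S \<inter> f -` U)"
      using e(4) U(1) by (auto intro: continuous_openin_preimage_gen)
    then obtain V where V: "open V" "S \<inter> f -` U = S \<inter> V" by (auto simp: openin_open)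
    have LV: "?L \<subseteq> V" using inS[OF B(1)] U(2) V(2) unfolding eq by blast
    have "\<exists>n. closure (e ` B n) \<subseteq> V"
    proof (rule ccontr)
      assume neg: "\<nexists>n. closure (e ` B n) \<subseteq> V"
      have dec: "B n \<subseteq> B m" if "m \<le> n" for m n
        by (rule lift_Suc_antimono_le[of B, OF B(2) that])
      have "UNIV \<inter> (\<Inter>n. closure (e ` B n) - V) \<noteq> {}"
      proof (rule compact_imp_fip_image[OF K])
        show "closed (closure (e ` B n) - V)" for n using V(1) by (intro closed_Diff) auto
        fix I :: "nat set" assume I: "finite I"
        obtain m where m: "\<And>n. n \<in> I \<Longrightarrow> n \<le> m" using I by (metis Max_ge)
        have "closure (e ` B m) - V \<subseteq> (\<Inter>n\<in>I. closure (e ` B n) - V)"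
          using closure_mono[OF image_mono[OF dec[OF m]]] by blast
        then show "UNIV \<inter> (\<Inter>n\<in>I. closure (e ` B n) - V) \<noteq> {}" using neg by blast
      qed
      then show False using LV by blast
    qed
    then obtain n where "closure (e ` B n) \<subseteq> V" ..
    then have "e ` B n \<subseteq> V" by (rule order_trans[OF closure_subset])
    moreover have "e ` B n \<subseteq> S" unfolding e(2)[symmetric] by (rule image_mono) simp
    ultimately have "e ` B n \<subseteq> S \<inter> f -` U" unfolding V(2) by (rule Int_greatest[rotated])
    then have "f (e b) \<in> U" if "b \<in> B n" for b using that by blast
    then have "B n \<subseteq> U" by (simp add: e(3) subset_iff)
    then show "\<exists>n. B n \<subseteq> U" ..
  qed
qed

lemma additive_group_hom:
  fixes h :: "'a::group_add \<Rightarrow> 'b::group_add"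
  assumes hom: "\<And>x y. h (x + y) = h x + h y"
  shows "h 0 = 0" "h (- x) = - h x" "h (x - y) = h x - h y"
proof -
  have "h 0 + h 0 = h 0 + 0" using hom[of 0 0] by simp
  then show 0: "h 0 = 0" by (simp only: add_left_cancel)
  have m: "h (- x) = - h x" for x
    using hom[of "- x" x] 0 by (simp add: eq_neg_iff_add_eq_0)
  show "h (- x) = - h x" by (rule m)
  show "h (x - y) = h x - h y"
    using hom[of x "- y"] m[of y] by simp
qed

lemma additive_continuous:
  fixes h :: "'a::topological_group_add \<Rightarrow> 'b::topological_group_add"
  assumes hom: "\<And>x y. h (x + y) = h x + h y"
    and nhd: "\<And>V. open V \<Longrightarrow> 0 \<in> V \<Longrightarrow> \<exists>U. open U \<and> 0 \<in> U \<and> h ` U \<subseteq> V"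
  shows "continuous_on UNIV h"
  unfolding continuous_on_def
proof (intro ballI topological_tendstoI)
  fix x S assume S: "open S" "h x \<in> S"
  have "open {y. h x + y \<in> S}" using S by (intro open_preimage continuous_intros)
  then obtain U where U: "open U" "0 \<in> U" "h ` U \<subseteq> {y. h x + y \<in> S}" using nhd[of "{y. h x + y \<in> S}"] S by auto
  have "h z \<in> S" if "- x + z \<in> U" for z
  proof -
    have "h x + h (- x + z) \<in> S" using U(3) that by blast
    then show ?thesis by (simp add: hom[symmetric] add.assoc[symmetric])
  qed
  moreover have "open {z. - x + z \<in> U}" using U by (intro open_preimage continuous_intros)
  ultimately show "eventually (\<lambda>z. h z \<in> S) (at x within UNIV)"
    unfolding eventually_at_topological using U(2) by (intro exI[of _ "{z. - x + z \<in> U}"]) auto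
qed

section \<open>Choosing bad letters for a discontinuous homomorphism\<close>

text \<open>Conjugation is a homeomorphism, so every conjugate of \<open>A\<close> is again closed
  with empty interior; the open set is shrunk once for each \<open>q\<close>.\<close>

lemma avoid_conjugates_of_nowhere_dense:
  fixes A :: "'a::topological_group_add set"
  assumes A: "closed A" "\<And>G. open G \<Longrightarrow> G \<subseteq> A \<Longrightarrow> G = {}"
    and "finite F" and N: "open N" "N \<noteq> {}"
  shows "\<exists>G. open G \<and> G \<noteq> {} \<and> G \<subseteq> N \<and> (\<forall>q\<in>F. \<forall>g\<in>G. q + g - q \<notin> A)"
  using \<open>finite F\<close>
proof induct
  case empty
  then show ?case using N by blast
next
  case (insert q F)
  then obtain G where G: "open G" "G \<noteq> {}" "G \<subseteq> N" "\<forall>q\<in>F. \<forall>g\<in>G. q + g - q \<notin> A" by blast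
  let ?T = "G \<inter> {g. q + g + - q \<in> - A}"
  have "open ?T" using G(1) A(1) by (intro open_Int open_preimage continuous_intros) auto
  moreover have "?T \<noteq> {}"
  proof
    assume e: "?T = {}"
    have "{x. - q + x + q \<in> G} \<subseteq> A"
    proof
      fix x assume "x \<in> {x. - q + x + q \<in> G}"
      then have "q + (- q + x + q) + - q \<in> A" using e by blast
      then show "x \<in> A" by (simp add: add.assoc[symmetric])
    qed
    moreover have "open {x. - q + x + q \<in> G}" using G(1) by (intro open_preimage continuous_intros)
    ultimately have E: "{x. - q + x + q \<in> G} = {}" using A(2) by blast
    obtain g where "g \<in> G" using G(2) by blast
    then have "q + g - q \<in> {x. - q + x + q \<in> G}" by (simp add: diff_conv_add_uminus add.assoc del: add_uminus_conv_diff)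
    with E show False by blast
  qed
  moreover have "\<forall>p\<in>insert q F. \<forall>g\<in>?T. p + g - p \<notin> A" using G(4) by auto
  ultimately show ?case using G(3) by blast
qed

text \<open>Write \<open>u\<close> as \<open>- a + (a + u)\<close> and approximate both terms by
  elements that \<open>h\<close> maps into \<open>W\<close>. The approximation of
  \<open>a + u\<close> is fixed first, since the tolerance for \<open>a\<close> depends on
  it.\<close>

lemma minus_closure_subset:
  fixes h :: "'a::topological_group_add \<Rightarrow> 'b::topological_group_add"
  assumes hom: "\<And>x y. h (x + y) = h x + h y"
    and W: "\<And>x y. x \<in> W \<Longrightarrow> y \<in> W \<Longrightarrow> - x + y \<in> V"
    and a: "a \<in> closure (h -` W)" "a + u \<in> closure (h -` W)"
  shows "u \<in> closure (h -` V)"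
  unfolding closure_iff_nhds_not_empty
proof (intro allI impI)
  fix A G assume G: "G \<subseteq> A" "open G" "u \<in> G"
  have "open {v. u + v \<in> G}" using G(2) by (intro open_preimage continuous_intros)
  then obtain v' where v': "u + v' \<in> G" "(a + u) + v' \<in> h -` W"
    using closure_approach_right[OF a(2), of "{v. u + v \<in> G}"] G(3) by auto
  have "open {v. - v + (u + v') \<in> G}" using G(2) by (intro open_preimage continuous_intros)
  then obtain v where v: "- v + (u + v') \<in> G" "a + v \<in> h -` W"
    using closure_approach_right[OF a(1), of "{v. - v + (u + v') \<in> G}"] v'(1) by auto
  have "- (a + v) + ((a + u) + v') = - v + (u + v')"
    by (simp add: minus_add add.assoc del: add_uminus_conv_diff)
  then have "h (- v + (u + v')) = - h (a + v) + h ((a + u) + v')"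
    using hom additive_group_hom(2)[OF hom] by metis
  also have "\<dots> \<in> V" using W v(2) v'(2) by blast
  finally show "h -` V \<inter> A \<noteq> {}" using v(1) G(1) by blast
qed

text \<open>If the closures of the preimages of all neighbourhoods of \<open>0\<close> are neighbourhoods of \<open>0\<close>, a bad
  element can be replaced by one as small as desired whose image differs from the previous one by an
  arbitrarily small error; then all images lie near one fixed element, and conjugation by products of
  them hardly moves it. Otherwise finitely many conjugates of a nowhere dense set are avoided
  directly.\<close>

lemma discontinuity_strategy:
  fixes h :: "'a::topological_group_add \<Rightarrow> 'b::topological_group_add"
  assumes hom: "\<And>x y. h (x + y) = h x + h y" and disc: "\<not> continuous_on UNIV h"
  obtains W :: "'b set" and I :: "'a set \<Rightarrow> bool" where "sym_nhd W" "I {0}"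
    "\<And>F N. finite F \<Longrightarrow> I F \<Longrightarrow> open N \<Longrightarrow> 0 \<in> N \<Longrightarrow>
      \<exists>g\<in>N. (\<forall>q\<in>F. \<forall>w\<in>W. \<forall>w'\<in>W. h (q + g - q) \<noteq> w + w') \<and> I (F \<union> (\<lambda>q. q + g) ` F)"
proof (cases "\<forall>W. sym_nhd W \<longrightarrow> (\<exists>U. open U \<and> 0 \<in> U \<and> U \<subseteq> closure (h -` W))")
  case False
  then obtain W0 :: "'b set" where W0: "sym_nhd W0" "\<not> (\<exists>U. open U \<and> 0 \<in> U \<and> U \<subseteq> closure (h -` W0))"
    by blast
  obtain W1 where W1: "sym_nhd W1" "\<And>x y. x \<in> W1 \<Longrightarrow> y \<in> W1 \<Longrightarrow> x + y \<in> W0"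
    by (rule sym_nhd_half[OF sym_nhdD(1,2)[OF W0(1)]]) blast
  obtain W where W: "sym_nhd W" "\<And>x y. x \<in> W \<Longrightarrow> y \<in> W \<Longrightarrow> x + y \<in> W1"
    by (rule sym_nhd_half[OF sym_nhdD(1,2)[OF W1(1)]]) blast
  \<comment> \<open>At an interior point, differences would make the corresponding closure for
    \<open>W0\<close> a neighbourhood of 0.\<close>
  have nd: "G = {}" if G: "open G" "G \<subseteq> closure (h -` W1)" for G
  proof (rule ccontr)
    assume "G \<noteq> {}"
    then obtain a where a: "a \<in> G" by blast
    have "{u. a + u \<in> G} \<subseteq> closure (h -` W0)"
    proof
      fix u assume "u \<in> {u. a + u \<in> G}"
      then have au: "a \<in> closure (h -` W1)" "a + u \<in> closure (h -` W1)" using G(2) a by blast+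
      show "u \<in> closure (h -` W0)"
        by (rule minus_closure_subset[OF hom _ au]) (rule W1(2)[OF sym_nhdD(3)[OF W1(1)]])
    qed
    moreover have "open {u. a + u \<in> G}" using G(1) by (intro open_preimage continuous_intros)
    moreover have "0 \<in> {u. a + u \<in> G}" using a by simp
    ultimately show False using W0(2) by blast
  qed
  show thesis
  proof (rule that[of W "\<lambda>_. True"])
    fix F :: "'a set" and N :: "'a set" assume F: "finite F" and N: "open N" "0 \<in> N"
    have "N \<noteq> {}" using N(2) by blast
    from avoid_conjugates_of_nowhere_dense[OF closed_closure nd F N(1) this]
    obtain g where g: "g \<in> N" "\<forall>q\<in>F. q + g - q \<notin> closure (h -` W1)" by blast
    then have "\<forall>q\<in>F. h (q + g - q) \<notin> W1" using closure_subset[of "h -` W1"] by blast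
    then have "\<forall>q\<in>F. \<forall>w\<in>W. \<forall>w'\<in>W. h (q + g - q) \<noteq> w + w'" using W(2) by metis
    then show "\<exists>g\<in>N. (\<forall>q\<in>F. \<forall>w\<in>W. \<forall>w'\<in>W. h (q + g - q) \<noteq> w + w') \<and> True" using g(1) by blast
  qed (simp_all add: W)
next
  case True
  then have dense: "\<exists>U. open U \<and> 0 \<in> U \<and> U \<subseteq> closure (h -` W)" if "sym_nhd W" for W using that by blast
  note h = additive_group_hom[OF hom]
  have "\<exists>V. open V \<and> 0 \<in> V \<and> \<not> (\<exists>U. open U \<and> 0 \<in> U \<and> h ` U \<subseteq> V)"
  proof (rule ccontr)
    assume n: "\<nexists>V. open V \<and> 0 \<in> V \<and> \<not> (\<exists>U. open U \<and> 0 \<in> U \<and> h ` U \<subseteq> V)"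
    have "continuous_on UNIV h" by (rule additive_continuous[OF hom]) (use n in blast)
    with disc show False ..
  qed
  then obtain V where V: "open V" "0 \<in> V" "\<not> (\<exists>U. open U \<and> 0 \<in> U \<and> h ` U \<subseteq> V)" by blast
  obtain V1 where V1: "sym_nhd V1" "\<And>x y. x \<in> V1 \<Longrightarrow> y \<in> V1 \<Longrightarrow> x + y \<in> V"
    by (rule sym_nhd_half[OF V(1,2)]) blast
  obtain W where W: "sym_nhd W" "\<And>x y. x \<in> W \<Longrightarrow> y \<in> W \<Longrightarrow> x + y \<in> V1"
    by (rule sym_nhd_half[OF sym_nhdD(1,2)[OF V1(1)]]) blast
  \<comment> \<open>Badness with a margin: it survives left perturbations of \<open>h g\<close> by
    \<open>D + D\<close>. The next letter arises from \<open>g\<close> by two corrections; one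
    summand takes up the first, the other takes up the second together with the new margin.\<close>
  define far where "far F g D \<longleftrightarrow> (\<forall>q\<in>F. \<forall>d\<in>D. \<forall>d'\<in>D. \<forall>w\<in>W. \<forall>w'\<in>W.
    h q + (d + d') + h g - h q \<noteq> w + w')" for F g and D :: "'b set"
  have farD: "h (q + g - q) \<noteq> w + w'" if "far F g D" "sym_nhd D" "q \<in> F" "w \<in> W" "w' \<in> W" for F g D q w w'
  proof -
    have "h q + (0 + 0) + h g - h q \<noteq> w + w'"
      using that sym_nhdD(2)[OF that(2)] unfolding far_def by blast
    then show ?thesis by (simp add: hom h)
  qed
  \<comment> \<open>That \<open>g\<close> lies in the closure of the preimage of \<open>D\<close>
    means that a left factor with image in \<open>D\<close> can make \<open>g\<close> as small as
    desired. The state \<open>{0}\<close> precedes the first letter.\<close>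
  define I where "I F \<longleftrightarrow> F = {0} \<or> (\<exists>g D. sym_nhd D \<and> g \<in> closure (h -` D) \<and> far F g D)" for F
  show thesis
  proof (rule that[of W I])
    fix F :: "'a set" and N :: "'a set" assume F: "finite F" "I F" and N: "open N" "0 \<in> N"
    have "\<exists>g D. g \<in> N \<and> sym_nhd D \<and> g \<in> closure (h -` D) \<and> far (F \<union> (\<lambda>q. q + g) ` F) g D"
    proof (cases "F = {0}")
      case True
      obtain U where U: "open U" "0 \<in> U" "U \<subseteq> closure (h -` W)" using dense[OF W(1)] by blast
      obtain g where g: "g \<in> N" "g \<in> U" "h g \<notin> V"
      proof -
        have "open (N \<inter> U)" "0 \<in> N \<inter> U" using N U by auto
        then have "\<not> h ` (N \<inter> U) \<subseteq> V" using V(3) by blast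
        then show thesis using that by blast
      qed
      \<comment> \<open>The only conjugators are \<open>0\<close> and \<open>g\<close>, and both
        commute with \<open>g\<close>. A violation would make \<open>h g\<close> a sum of four
        elements of \<open>W\<close>, which lies in \<open>V\<close>.\<close>
      have "far (F \<union> (\<lambda>q. q + g) ` F) g W"
        unfolding far_def
      proof (intro ballI notI)
        fix q d d' w w' assume q: "q \<in> F \<union> (\<lambda>q. q + g) ` F" and m: "d \<in> W" "d' \<in> W" "w \<in> W" "w' \<in> W"
          and eq: "h q + (d + d') + h g - h q = w + w'"
        have 1: "- d' + - d \<in> V1" using m by (intro W(2) sym_nhdD(3)[OF W(1)])
        have 2: "w + w' \<in> V1" using m by (intro W(2))
        have "q = 0 \<or> q = g" using q True by auto
        then have "h g = (- d' + - d) + (w + w') \<or> h g = (w + w') + (- d' + - d)"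
        proof
          assume "q = 0"
          then have "(d + d') + h g = w + w'" using eq by (simp add: h)
          then have "(- d' + - d) + ((d + d') + h g) = (- d' + - d) + (w + w')" by simp
          then show ?thesis by (simp add: add.assoc del: add_uminus_conv_diff)
        next
          assume "q = g"
          then have "h g + (d + d') = w + w'" using eq by simp
          then have "(h g + (d + d')) + (- d' + - d) = (w + w') + (- d' + - d)" by simp
          then show ?thesis by (simp add: add.assoc del: add_uminus_conv_diff)
        qed
        then have "h g \<in> V" using V1(2) 1 2 by auto
        then show False using g(3) by blast
      qed
      then show ?thesis using g U(3) W(1) by blast
    next
      case False
      then obtain g D where D: "sym_nhd D" "g \<in> closure (h -` D)" "far F g D"
        using F(2) by (auto simp: I_def)
      obtain A where A: "sym_nhd A" "\<And>x y. x \<in> A \<Longrightarrow> y \<in> A \<Longrightarrow> x + y \<in> D"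
        by (rule sym_nhd_half[OF sym_nhdD(1,2)[OF D(1)]]) blast
      have approach: "\<exists>x. h x \<in> B \<and> x + g \<in> U" if B: "sym_nhd B" "g \<in> closure (h -` B)" and U: "open U" "0 \<in> U" for g B U
      proof -
        have "open {v. - v \<in> U}" using U by (intro open_preimage continuous_intros)
        then obtain v where v: "- v \<in> U" "g + v \<in> h -` B"
          using closure_approach_right[OF B(2), of "{v. - v \<in> U}"] U(2) by auto
        then have "h (- (g + v)) \<in> B" unfolding h(2) using sym_nhdD(3)[OF B(1)] by blast
        moreover have "- (g + v) + g = - v" by (simp add: minus_add add.assoc)
        ultimately show ?thesis using v(1) by metis
      qed
      obtain U1 where U1: "open U1" "0 \<in> U1" "U1 \<subseteq> closure (h -` A)" using dense[OF A(1)] by blast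
      obtain x where x: "h x \<in> D" "x + g \<in> U1" using approach[OF D(1,2) U1(1,2)] by blast
      \<comment> \<open>Two corrections are made because the new margin \<open>D'\<close> depends on
        conjugation by \<open>h k\<close>, so \<open>k\<close> must be known before the final letter
        \<open>x' + k\<close>. As \<open>k\<close> lies in the closure of the preimage of
        \<open>A\<close>, the second correction can have its image in \<open>A\<close>.\<close>
      define k where "k = x + g"
      obtain A1 where A1: "sym_nhd A1" "\<And>p x. p \<in> {h k} \<Longrightarrow> x \<in> A1 \<Longrightarrow> p + x - p \<in> A"
        by (rule sym_nhd_conj[of "{h k}", OF _ sym_nhdD(1,2)[OF A(1)]]) blast+
      obtain D' where D': "sym_nhd D'" "\<And>x y. x \<in> D' \<Longrightarrow> y \<in> D' \<Longrightarrow> x + y \<in> A \<inter> A1"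
        by (rule sym_nhd_half[OF sym_nhdD(1,2)[OF sym_nhd_Int[OF A(1) A1(1)]]]) blast
      obtain U2 where U2: "open U2" "0 \<in> U2" "U2 \<subseteq> closure (h -` D')" using dense[OF D'(1)] by blast
      have "k \<in> closure (h -` A)" using x U1 by (auto simp: k_def)
      then obtain x' where x': "h x' \<in> A" "x' + k \<in> N \<inter> U2"
        using approach[OF A(1), of k "N \<inter> U2"] N U2 by auto
      define g' where "g' = x' + k"
      have hk: "h k = h x + h g" and hg': "h g' = h x' + h k" by (simp_all add: k_def g'_def hom)
      have "far (F \<union> (\<lambda>q. q + g') ` F) g' D'"
        unfolding far_def
      proof (intro ballI notI)
        fix q d d' w w' assume q: "q \<in> F \<union> (\<lambda>q. q + g') ` F" and m: "d \<in> D'" "d' \<in> D'" "w \<in> W" "w' \<in> W"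
          and eq: "h q + (d + d') + h g' - h q = w + w'"
        have dd: "d + d' \<in> A" "h k + (d + d') - h k \<in> A" using D'(2)[OF m(1,2)] A1(2) by auto
        show False
          using q
        proof
          assume q: "q \<in> F"
          have "(d + d') + h x' \<in> D" using A(2) dd(1) x'(1) by blast
          then have "h q + (((d + d') + h x') + h x) + h g - h q \<noteq> w + w'"
            using D(3) q x(1) m(3,4) unfolding far_def by blast
          then show False using eq by (simp add: hg' hk add.assoc)
        next
          \<comment> \<open>For \<open>q = r + g'\<close>, conjugation by \<open>q\<close> amounts
            to conjugation by \<open>r\<close> with the margin now to the right of
            \<open>h g'\<close>; conjugating it by \<open>h k\<close> brings it back in front of
            \<open>h k\<close>.\<close>
          assume "q \<in> (\<lambda>q. q + g') ` F"
          then obtain r where r: "r \<in> F" "q = r + g'" by blast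
          have "h x' + (h k + (d + d') - h k) \<in> D" using A(2) dd(2) x'(1) by blast
          then have "h r + ((h x' + (h k + (d + d') - h k)) + h x) + h g - h r \<noteq> w + w'"
            using D(3) r(1) x(1) m(3,4) unfolding far_def by blast
          moreover have "h r + ((h x' + (h k + (d + d') - h k)) + h x) + h g - h r = h r + h x' + h k + (d + d') - h r"
          proof -
            have "(h x' + (h k + (d + d') - h k)) + h x + h g = h x' + (h k + (d + d') - h k) + h k"
              unfolding hk by (simp add: add.assoc)
            also have "\<dots> = h x' + (h k + (d + d'))" by (simp add: add.assoc diff_add_cancel)
            finally show ?thesis by (simp add: add.assoc)
          qed
          moreover have "h q + (d + d') + h g' - h q = h r + h x' + h k + (d + d') - h r"
          proof -
            have "h q + (d + d') + h g' - h q = (h r + h g' + (d + d')) + (h g' - (h r + h g'))"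
              unfolding r(2) hom by (simp add: add.assoc add_diff_eq)
            also have "h g' - (h r + h g') = - h r" by (simp add: diff_conv_add_uminus minus_add add.assoc[symmetric] del: add_uminus_conv_diff)
            finally show ?thesis by (simp add: hg' add.assoc)
          qed
          ultimately show False using eq by simp
        qed
      qed
      then show ?thesis using x'(2) D'(1) U2(3) by (auto simp: g'_def)
    qed
    then obtain g D where g: "g \<in> N" "sym_nhd D" "g \<in> closure (h -` D)" "far (F \<union> (\<lambda>q. q + g) ` F) g D" by blast
    then have "I (F \<union> (\<lambda>q. q + g) ` F)" by (auto simp: I_def)
    moreover have "\<forall>q\<in>F. \<forall>w\<in>W. \<forall>w'\<in>W. h (q + g - q) \<noteq> w + w'"
      using farD[OF g(4,2)] by blast
    ultimately show "\<exists>g\<in>N. (\<forall>q\<in>F. \<forall>w\<in>W. \<forall>w'\<in>W. h (q + g - q) \<noteq> w + w') \<and> I (F \<union> (\<lambda>q. q + g) ` F)"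
      using g(1) by blast
  qed (simp_all add: W I_def)
qed

section \<open>Infinite products of letters\<close>

lemma closure_sym_nhd_subset:
  assumes V: "sym_nhd V" and sum: "\<And>x y. x \<in> V \<Longrightarrow> y \<in> V \<Longrightarrow> x + y \<in> U"
  shows "closure V \<subseteq> U"
proof
  fix x assume x: "x \<in> closure V"
  obtain v where v: "v \<in> V" "x + v \<in> V"
    by (rule closure_approach_right[OF x sym_nhdD(1,2)[OF V]])
  have "(x + v) + - v \<in> U" by (rule sum[OF v(2) sym_nhdD(3)[OF V v(1)]])
  then show "x \<in> U" by simp
qed

text \<open>Lets compactness of an intersection of closures be used for the intersection
  itself.\<close>

lemma Inter_closure_eq:
  fixes U :: "nat \<Rightarrow> 'a::topological_space set"
  assumes "\<And>n. closure (U (Suc n)) \<subseteq> U n"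
  shows "(\<Inter>n. closure (U n)) = (\<Inter>n. U n)"
proof
  show "(\<Inter>n. U n) \<subseteq> (\<Inter>n. closure (U n))"
    by (intro INT_greatest order_trans[OF INT_lower closure_subset]) simp
  show "(\<Inter>n. closure (U n)) \<subseteq> (\<Inter>n. U n)"
  proof (rule INT_greatest)
    fix n
    have "(\<Inter>n. closure (U n)) \<subseteq> closure (U (Suc n))" by (rule INT_lower) simp
    then show "(\<Inter>n. closure (U n)) \<subseteq> U n" using assms by (rule order_trans)
  qed
qed

text \<open>The group-valued analogue of the Cantor set: all infinite products of letters
  \<open>0\<close> or \<open>g n\<close>, taken modulo the compact subgroup \<open>\<Inter>n. U n\<close>.\<close>

locale cantor_products =
  fixes g :: "nat \<Rightarrow> 'a::topological_group_add" and U :: "nat \<Rightarrow> 'a set"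
  assumes U: "\<And>n. sym_nhd (U n)"
    and sum: "\<And>n x y. x \<in> U (Suc n) \<Longrightarrow> y \<in> U (Suc n) \<Longrightarrow> x + y \<in> U n"
    and letter_sum: "\<And>n x y. x \<in> U (Suc n) \<Longrightarrow> y \<in> U (Suc n) \<Longrightarrow> g n + (x + y) \<in> U n"
    and letter_apart: "\<And>n x y. x \<in> U (Suc n) \<Longrightarrow> y \<in> U (Suc n) \<Longrightarrow> x + y \<noteq> g n"
begin

definition letter :: "nat \<Rightarrow> nat set \<Rightarrow> 'a" where
  "letter n \<alpha> = (if n \<in> \<alpha> then g n else 0)"

fun prefix :: "nat \<Rightarrow> nat set \<Rightarrow> 'a" where
  "prefix 0 \<alpha> = 0"
| "prefix (Suc n) \<alpha> = prefix n \<alpha> + letter n \<alpha>"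

definition box :: "nat \<Rightarrow> nat set \<Rightarrow> 'a set" where
  "box n \<alpha> = (+) (prefix n \<alpha>) ` U n"

definition products :: "'a set" where
  "products = (\<Inter>n. \<Union>\<alpha>. box n \<alpha>)"

definition kernel :: "'a set" where
  "kernel = (\<Inter>n. U n)"

lemma zero_U: "0 \<in> U n" and minus_U: "x \<in> U n \<Longrightarrow> - x \<in> U n" and open_U: "open (U n)"
  using U sym_nhdD by blast+

lemma U_Suc: "U (Suc n) \<subseteq> U n"
  using sum[OF _ zero_U] by fastforce

lemma U_antimono: "m \<le> n \<Longrightarrow> U n \<subseteq> U m"
  by (rule lift_Suc_antimono_le[of U, OF U_Suc])

lemma g_in_U: "g n \<in> U n"
  using letter_sum[OF zero_U zero_U, of n] by simp

lemma closure_U: "closure (U (Suc n)) \<subseteq> U n"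
  by (rule closure_sym_nhd_subset[OF U sum])

lemma kernel_eq: "(\<Inter>n. closure (U n)) = kernel"
  unfolding kernel_def by (rule Inter_closure_eq, rule closure_U)

lemma kernel_minus: "x \<in> kernel \<Longrightarrow> - x \<in> kernel"
  unfolding kernel_def by (simp add: minus_U)

lemma prefix_cong: "(\<And>k. k < n \<Longrightarrow> k \<in> \<alpha> \<longleftrightarrow> k \<in> \<beta>) \<Longrightarrow> prefix n \<alpha> = prefix n \<beta>"
  by (induct n) (simp_all add: letter_def)

lemma prefix_zero: "prefix n {} = 0"
  by (induct n) (simp_all add: letter_def)

lemma range_prefix_Suc: "range (prefix (Suc n)) = range (prefix n) \<union> (\<lambda>q. q + g n) ` range (prefix n)"
proof (intro equalityI subsetI)
  fix q assume "q \<in> range (prefix (Suc n))"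
  then obtain \<alpha> where "q = prefix n \<alpha> + letter n \<alpha>" by auto
  then have "q = prefix n \<alpha> \<or> q = prefix n \<alpha> + g n" by (simp add: letter_def)
  then show "q \<in> range (prefix n) \<union> (\<lambda>q. q + g n) ` range (prefix n)" by blast
next
  fix q assume "q \<in> range (prefix n) \<union> (\<lambda>q. q + g n) ` range (prefix n)"
  then obtain \<alpha> where \<alpha>: "q = prefix n \<alpha> \<or> q = prefix n \<alpha> + g n" by blast
  have "prefix n (\<alpha> - {n}) = prefix n \<alpha>" "prefix n (insert n \<alpha>) = prefix n \<alpha>"
    by (rule prefix_cong, auto)+
  then have "prefix (Suc n) (\<alpha> - {n}) = prefix n \<alpha>" "prefix (Suc n) (insert n \<alpha>) = prefix n \<alpha> + g n"
    by (simp_all add: letter_def)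
  then show "q \<in> range (prefix (Suc n))" using \<alpha> by (metis rangeI)
qed

lemma range_prefix_mono: "m \<le> n \<Longrightarrow> range (prefix m) \<subseteq> range (prefix n)"
  by (rule lift_Suc_mono_le[of "\<lambda>n. range (prefix n)"], unfold range_prefix_Suc, rule Un_upper1)

lemma letter_sum': "x \<in> U (Suc n) \<Longrightarrow> y \<in> U (Suc n) \<Longrightarrow> letter n \<alpha> + (x + y) \<in> U n"
  by (simp add: letter_def sum letter_sum)

text \<open>At the cost of one level a box has room for an extra error term; it will be a limit
  error for closures and a kernel error for exchanged letters.\<close>

lemma box_sum: "x \<in> U (Suc n) \<Longrightarrow> y \<in> U (Suc n) \<Longrightarrow> prefix (Suc n) \<alpha> + (x + y) \<in> box n \<alpha>"
  unfolding box_def using letter_sum'[of x n y \<alpha>]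
  by (intro image_eqI[of _ _ "letter n \<alpha> + (x + y)"]) (simp_all add: add.assoc)

lemma box_Suc: "box (Suc n) \<alpha> \<subseteq> box n \<alpha>"
proof
  fix x assume "x \<in> box (Suc n) \<alpha>"
  then obtain u where u: "u \<in> U (Suc n)" "x = prefix (Suc n) \<alpha> + u" unfolding box_def by blast
  then show "x \<in> box n \<alpha>" using box_sum[OF u(1) zero_U, of \<alpha>] by (simp only: add_0_right)
qed

lemma box_antimono: "m \<le> n \<Longrightarrow> box n \<alpha> \<subseteq> box m \<alpha>"
  by (rule lift_Suc_antimono_le[of "\<lambda>n. box n \<alpha>"]) (rule box_Suc)

lemma open_box: "open (box n \<alpha>)"
  unfolding box_def by (rule open_plus_left[OF open_U])

text \<open>If two words through the same point first differed at \<open>n\<close>, then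
  \<open>g n\<close> would be a difference of two elements of \<open>U (Suc n)\<close>, against
  \<open>letter_apart\<close>.\<close>

lemma box_unique: "x \<in> box n \<alpha> \<Longrightarrow> x \<in> box n \<beta> \<Longrightarrow> k < n \<Longrightarrow> k \<in> \<alpha> \<longleftrightarrow> k \<in> \<beta>"
proof (induct n arbitrary: k)
  case (Suc n)
  have eq: "j \<in> \<alpha> \<longleftrightarrow> j \<in> \<beta>" if "j < n" for j
    by (rule Suc(1)[OF subsetD[OF box_Suc Suc(2)] subsetD[OF box_Suc Suc(3)] that])
  obtain a where a: "a \<in> U (Suc n)" "x = prefix (Suc n) \<alpha> + a" using Suc(2) unfolding box_def by blast
  obtain b where b: "b \<in> U (Suc n)" "x = prefix (Suc n) \<beta> + b" using Suc(3) unfolding box_def by blast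
  have "prefix n \<alpha> + (letter n \<alpha> + a) = prefix n \<alpha> + (letter n \<beta> + b)"
    using a(2) b(2) prefix_cong[of n \<alpha> \<beta>, OF eq] by (simp add: add.assoc)
  then have l: "letter n \<alpha> + a = letter n \<beta> + b" by simp
  have ne: "g n + c \<noteq> d" if "c \<in> U (Suc n)" "d \<in> U (Suc n)" for c d
  proof
    assume "g n + c = d"
    then have "d + - c = g n" by (auto simp: add.assoc)
    then show False using letter_apart[OF that(2) minus_U[OF that(1)]] by blast
  qed
  have "n \<in> \<alpha> \<longleftrightarrow> n \<in> \<beta>"
    using l ne[OF a(1) b(1)] ne[OF b(1) a(1)] by (cases "n \<in> \<alpha>"; cases "n \<in> \<beta>") (simp_all add: letter_def)
  then show ?case using eq Suc(4) by (cases "k = n") simp_all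
qed simp

lemma closure_boxes: "closure (\<Union>\<alpha>. box (Suc n) \<alpha>) \<subseteq> (\<Union>\<alpha>. box n \<alpha>)"
proof
  fix x assume x: "x \<in> closure (\<Union>\<alpha>. box (Suc n) \<alpha>)"
  obtain v where v: "v \<in> U (Suc n)" "x + v \<in> (\<Union>\<alpha>. box (Suc n) \<alpha>)"
    by (rule closure_approach_right[OF x open_U[of "Suc n"] zero_U])
  then obtain \<alpha> u where u: "u \<in> U (Suc n)" "x + v = prefix (Suc n) \<alpha> + u" unfolding box_def by blast
  have "x = (x + v) + - v" by simp
  also have "\<dots> = prefix (Suc n) \<alpha> + (u + - v)" unfolding u(2) by (rule add.assoc)
  finally show "x \<in> (\<Union>\<alpha>. box n \<alpha>)" using box_sum[OF u(1) minus_U[OF v(1)], of \<alpha>] by auto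
qed

lemma products_eq: "(\<Inter>n. closure (\<Union>\<alpha>. box n \<alpha>)) = products"
  unfolding products_def by (rule Inter_closure_eq, rule closure_boxes)

lemma zero_products: "0 \<in> products"
  unfolding products_def box_def using zero_U prefix_zero by (auto intro!: exI[of _ "{}"] image_eqI[of _ _ 0])

text \<open>A letter inserted after the prefix \<open>q\<close> can be moved to the far left by
  conjugating it with \<open>q\<close>. The multiplier does not depend on later letters, so an
  exchange is a left translation on each piece.\<close>

lemma prefix_flip:
  assumes "n \<notin> \<beta>" "n < m"
  shows "prefix m (insert n \<beta>) = (prefix n \<beta> + g n - prefix n \<beta>) + prefix m \<beta>"
  using \<open>n < m\<close>
proof (induct m)
  case (Suc m)
  have c: "prefix n (insert n \<beta>) = prefix n \<beta>" by (rule prefix_cong) auto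
  show ?case
  proof (cases "n = m")
    case True
    then show ?thesis using assms(1) c by (simp add: letter_def)
  next
    case False
    then have "letter m (insert n \<beta>) = letter m \<beta>" by (simp add: letter_def)
    then show ?thesis using Suc False by (simp add: add.assoc)
  qed
qed simp

end

locale cantor_products_conj = cantor_products +
  assumes conj: "\<And>n \<alpha> x. x \<in> U (Suc n) \<Longrightarrow> prefix (Suc n) \<alpha> + x - prefix (Suc n) \<alpha> \<in> U n"
    and conj': "\<And>n \<alpha> x. x \<in> U (Suc n) \<Longrightarrow> - prefix (Suc n) \<alpha> + x + prefix (Suc n) \<alpha> \<in> U n"
begin

text \<open>A prefix of length \<open>n\<close> is also one of any greater length, so
  \<open>conj'\<close> can be applied at a level as deep as desired.\<close>

lemma kernel_conj:
  assumes "u \<in> kernel" shows "- prefix n \<alpha> + u + prefix n \<alpha> \<in> kernel"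
  unfolding kernel_def
proof
  fix k
  have "prefix n \<alpha> \<in> range (prefix (Suc (max n k)))"
    by (rule subsetD[OF range_prefix_mono rangeI]) simp
  then obtain \<beta> where "prefix n \<alpha> = prefix (Suc (max n k)) \<beta>" by blast
  moreover have "u \<in> U (Suc (max n k))" using assms by (simp add: kernel_def)
  ultimately have "- prefix n \<alpha> + u + prefix n \<alpha> \<in> U (max n k)" using conj' by metis
  then show "- prefix n \<alpha> + u + prefix n \<alpha> \<in> U k" using U_antimono[of k "max n k"] by auto
qed

definition flip :: "nat \<Rightarrow> nat set \<Rightarrow> nat set" where
  "flip n \<alpha> = (if n \<in> \<alpha> then \<alpha> - {n} else insert n \<alpha>)"

lemma flip_flip: "flip n (flip n \<alpha>) = \<alpha>"
  by (auto simp: flip_def)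

lemma prefix_n_flip: "prefix n (flip n \<alpha>) = prefix n \<alpha>"
  by (rule prefix_cong) (auto simp: flip_def)

definition piece :: "nat \<Rightarrow> nat set \<Rightarrow> 'a set" where
  "piece n \<alpha> = products \<inter> box (Suc n) \<alpha>"

text \<open>The multiplier that exchanges letter \<open>n\<close>: the conjugate of
  \<open>g n\<close> under the prefix, corrected by \<open>- u q\<close>. With \<open>u q\<close> in
  the kernel the correction preserves the pieces and can bring the multiplier into a prescribed
  neighbourhood; removing the letter takes the inverse.\<close>

definition flipper :: "nat \<Rightarrow> ('a \<Rightarrow> 'a) \<Rightarrow> nat set \<Rightarrow> 'a" where
  "flipper n u \<alpha> = (let q = prefix n \<alpha>; w = - u q + (q + g n - q) in if n \<in> \<alpha> then - w else w)"

lemma flipper_flip: "flipper n u (flip n \<alpha>) = - flipper n u \<alpha>"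
  unfolding flipper_def Let_def prefix_n_flip by (simp add: flip_def)

text \<open>The kernel correction stands on the left of a whole prefix. Conjugating by that prefix
  moves it to the right end, and there it is still in the kernel, hence in every
  \<open>U k\<close>.\<close>

lemma flipper_prefix:
  assumes u: "u (prefix n \<beta>) \<in> kernel" and m: "n < m"
  shows "\<exists>z\<in>kernel. flipper n u \<beta> + prefix m \<beta> = prefix m (flip n \<beta>) + z"
proof -
  define q where "q = prefix n \<beta>"
  define c where "c = q + g n - q"
  show ?thesis
  proof (cases "n \<in> \<beta>")
    case False
    define p where "p = prefix m (flip n \<beta>)"
    have p: "p = c + prefix m \<beta>"
      using prefix_flip[OF False m] False by (simp add: p_def flip_def c_def q_def)
    have "- p + - u q + p \<in> kernel" unfolding p_def q_def by (intro kernel_conj kernel_minus u)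
    moreover have "flipper n u \<beta> + prefix m \<beta> = p + (- p + - u q + p)"
    proof -
      have "flipper n u \<beta> + prefix m \<beta> = (- u q + c) + prefix m \<beta>"
        using False by (simp add: flipper_def Let_def q_def c_def)
      also have "\<dots> = - u q + p" unfolding p by (rule add.assoc)
      also have "\<dots> = p + (- p + - u q + p)" by (simp add: add.assoc del: add_uminus_conv_diff)
      finally show ?thesis .
    qed
    ultimately show ?thesis unfolding p_def by blast
  next
    case True
    define \<beta>0 where "\<beta>0 = \<beta> - {n}"
    have b: "\<beta> = insert n \<beta>0" "n \<notin> \<beta>0" "flip n \<beta> = \<beta>0" using True by (auto simp: \<beta>0_def flip_def)
    have q0: "prefix n \<beta>0 = q" unfolding q_def by (rule prefix_cong) (auto simp: \<beta>0_def)
    define p where "p = prefix m \<beta>"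
    have p: "p = c + prefix m \<beta>0"
      unfolding p_def b(1) prefix_flip[OF b(2) m] q0 c_def ..
    have z: "- p + u q + p \<in> kernel" unfolding p_def q_def by (intro kernel_conj u)
    have "flipper n u \<beta> + prefix m \<beta> = (- (- u q + c)) + p"
      using True by (simp add: flipper_def Let_def q_def c_def p_def)
    also have "\<dots> = - c + (u q + p)" by (simp add: minus_add add.assoc del: add_uminus_conv_diff)
    also have "u q + p = p + (- p + u q + p)" by (simp add: add.assoc del: add_uminus_conv_diff)
    also have "- c + \<dots> = (- c + p) + (- p + u q + p)" by (rule add.assoc[symmetric])
    also have "- c + p = prefix m \<beta>0" unfolding p by simp
    finally show ?thesis using z unfolding b(3) by blast
  qed
qed

text \<open>The kernel error costs one level of boxes, which is harmless because a point of
  \<open>products\<close> lies in boxes of every level.\<close>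

lemma flipper_piece_subset:
  assumes u: "u (prefix n \<alpha>) \<in> kernel"
  shows "(+) (flipper n u \<alpha>) ` piece n \<alpha> \<subseteq> piece n (flip n \<alpha>)"
proof safe
  fix x assume x: "x \<in> piece n \<alpha>"
  let ?v = "flipper n u \<alpha>"
  have key: "?v + x \<in> box m (flip n \<alpha>) \<or> ?v + x \<in> (\<Union>\<beta>. box m \<beta>)" and
    key': "m = Suc n \<Longrightarrow> ?v + x \<in> box m (flip n \<alpha>)" if m: "Suc n \<le> m" for m
  proof -
    have "x \<in> (\<Union>\<beta>. box (Suc m) \<beta>)" using x by (auto simp: piece_def products_def)
    then obtain \<beta> where \<beta>: "x \<in> box (Suc m) \<beta>" by blast
    then have "x \<in> box (Suc n) \<beta>" using box_antimono[of "Suc n" "Suc m" \<beta>] m by auto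
    moreover have "x \<in> box (Suc n) \<alpha>" using x by (simp add: piece_def)
    ultimately have ab: "k \<in> \<beta> \<longleftrightarrow> k \<in> \<alpha>" if "k < Suc n" for k using box_unique that by blast
    have qb: "prefix n \<beta> = prefix n \<alpha>" by (rule prefix_cong) (simp add: ab)
    have nb: "n \<in> \<beta> \<longleftrightarrow> n \<in> \<alpha>" by (simp add: ab)
    have fb: "flipper n u \<beta> = ?v" unfolding flipper_def qb nb ..
    obtain y where y: "y \<in> U (Suc m)" "x = prefix (Suc m) \<beta> + y" using \<beta> unfolding box_def by blast
    obtain z where z: "z \<in> kernel" "?v + prefix (Suc m) \<beta> = prefix (Suc m) (flip n \<beta>) + z"
      using flipper_prefix[of u n \<beta> "Suc m"] u m unfolding fb qb by auto
    have "?v + x = (?v + prefix (Suc m) \<beta>) + y" unfolding y(2) by (rule add.assoc[symmetric])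
    also have "\<dots> = prefix (Suc m) (flip n \<beta>) + (z + y)" unfolding z(2) by (rule add.assoc)
    also have "\<dots> \<in> box m (flip n \<beta>)" using z(1) y(1) by (intro box_sum) (auto simp: kernel_def)
    finally have in_box: "?v + x \<in> box m (flip n \<beta>)" .
    then show "?v + x \<in> box m (flip n \<alpha>) \<or> ?v + x \<in> (\<Union>\<beta>. box m \<beta>)" by blast
    assume "m = Suc n"
    moreover have "prefix (Suc n) (flip n \<beta>) = prefix (Suc n) (flip n \<alpha>)"
      by (rule prefix_cong) (auto simp: flip_def ab)
    ultimately show "?v + x \<in> box m (flip n \<alpha>)" using in_box by (simp add: box_def)
  qed
  have "?v + x \<in> (\<Union>\<beta>. box m \<beta>)" for m
  proof -
    have "?v + x \<in> (\<Union>\<beta>. box (max m (Suc n)) \<beta>)" using key[of "max m (Suc n)"] by auto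
    then show ?thesis using box_antimono[of m "max m (Suc n)"] by auto
  qed
  then show "?v + x \<in> piece n (flip n \<alpha>)" using key'[of "Suc n"] by (simp add: piece_def products_def)
qed

text \<open>The inverse multiplier belongs to the flipped word, so the inclusion applied there gives
  the converse.\<close>

lemma flipper_piece:
  assumes u: "u (prefix n \<alpha>) \<in> kernel"
  shows "(+) (flipper n u \<alpha>) ` piece n \<alpha> = piece n (flip n \<alpha>)"
proof (rule equalityI[OF flipper_piece_subset[of u, OF u]])
  have "(+) (flipper n u (flip n \<alpha>)) ` piece n (flip n \<alpha>) \<subseteq> piece n (flip n (flip n \<alpha>))"
    by (rule flipper_piece_subset) (simp add: prefix_n_flip u)
  then have sub: "- flipper n u \<alpha> + x \<in> piece n \<alpha>" if "x \<in> piece n (flip n \<alpha>)" for x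
    unfolding flipper_flip flip_flip using that by blast
  show "piece n (flip n \<alpha>) \<subseteq> (+) (flipper n u \<alpha>) ` piece n \<alpha>"
  proof
    fix x assume "x \<in> piece n (flip n \<alpha>)"
    then show "x \<in> (+) (flipper n u \<alpha>) ` piece n \<alpha>"
      using sub by (intro image_eqI[of _ _ "- flipper n u \<alpha> + x"]) (simp_all add: add.assoc[symmetric])
  qed
qed

lemma products_pieces: "products = (\<Union>\<alpha>\<in>Pow {..n}. piece n \<alpha>)"
proof (intro equalityI subsetI)
  fix x assume x: "x \<in> products"
  then have "x \<in> (\<Union>\<beta>. box (Suc n) \<beta>)" unfolding products_def by (rule INT_D) simp
  then obtain \<beta> where "x \<in> box (Suc n) \<beta>" by blast
  moreover have "prefix (Suc n) \<beta> = prefix (Suc n) (\<beta> \<inter> {..n})" by (rule prefix_cong) auto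
  ultimately have "x \<in> piece n (\<beta> \<inter> {..n})" using x by (simp add: piece_def box_def)
  moreover have "\<beta> \<inter> {..n} \<in> Pow {..n}" by simp
  ultimately show "x \<in> (\<Union>\<alpha>\<in>Pow {..n}. piece n \<alpha>)" by (rule UN_I[rotated])
next
  fix x assume "x \<in> (\<Union>\<alpha>\<in>Pow {..n}. piece n \<alpha>)"
  then show "x \<in> products" unfolding piece_def by blast
qed

lemma disjoint_pieces: "disjoint_family_on (piece n) (Pow {..n})"
  unfolding disjoint_family_on_def
proof (intro ballI impI, rule ccontr)
  fix \<alpha> \<beta> assume a: "\<alpha> \<in> Pow {..n}" "\<beta> \<in> Pow {..n}" "\<alpha> \<noteq> \<beta>" and "piece n \<alpha> \<inter> piece n \<beta> \<noteq> {}"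
  then obtain x where x: "x \<in> box (Suc n) \<alpha>" "x \<in> box (Suc n) \<beta>" unfolding piece_def by blast
  have "k \<in> \<alpha> \<longleftrightarrow> k \<in> \<beta>" for k
    using box_unique[OF x, of k] a(1,2) by (cases "k < Suc n") (auto simp: subset_iff)
  then show False using a(3) by blast
qed

text \<open>The other boxes of the same level are open and cut out exactly the rest of
  \<open>products\<close>.\<close>

lemma compact_piece:
  assumes "compact products" "\<alpha> \<subseteq> {..n}" shows "compact (piece n \<alpha>)"
proof -
  let ?O = "\<Union>\<beta>\<in>Pow {..n} - {\<alpha>}. box (Suc n) \<beta>"
  have "piece n \<alpha> = products - ?O"
  proof (intro equalityI subsetI)
    fix x assume x: "x \<in> piece n \<alpha>"
    have "x \<notin> box (Suc n) \<beta>" if "\<beta> \<in> Pow {..n} - {\<alpha>}" for \<beta>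
    proof
      assume "x \<in> box (Suc n) \<beta>"
      then have "x \<in> piece n \<alpha> \<inter> piece n \<beta>" using x by (simp add: piece_def)
      then show False
        using disjoint_family_onD[OF disjoint_pieces, of \<alpha> n \<beta>] assms(2) that by auto
    qed
    then show "x \<in> products - ?O" using x unfolding piece_def by blast
  next
    fix x assume x: "x \<in> products - ?O"
    then have "x \<in> (\<Union>\<beta>\<in>Pow {..n}. piece n \<beta>)" unfolding products_pieces[symmetric] by blast
    then obtain \<beta> where \<beta>: "\<beta> \<in> Pow {..n}" "x \<in> piece n \<beta>" by blast
    then have "\<beta> = \<alpha>" using x unfolding piece_def by blast
    then show "x \<in> piece n \<alpha>" using \<beta>(2) by simp
  qed
  moreover have "open ?O" by (intro open_UN ballI open_box)
  ultimately show ?thesis using compact_Diff_open[OF assms(1)] by simp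
qed

end

section \<open>Construction of the letters and the contradiction\<close>

theorem theorem1p2:
  fixes h :: "'a::topological_group_add \<Rightarrow> 'b::topological_group_add"
  assumes "cech_complete_in TYPE('a) TYPE('k::t2_space)"
    and "\<And>x y. h (x + y) = h x + h y"
    and "universally_measurable_fun h"
  shows "continuous_on UNIV h"
proof (rule ccontr)
  assume disc: "\<not> continuous_on UNIV h"
  note hom = assms(2) and um = assms(3)
  note h = additive_group_hom[OF hom]
  obtain W I where W: "sym_nhd W" and I0: "I {0}"
    and strategy: "\<And>F N. finite F \<Longrightarrow> I F \<Longrightarrow> open N \<Longrightarrow> 0 \<in> N \<Longrightarrow>
      \<exists>g\<in>N. (\<forall>q\<in>F. \<forall>w\<in>W. \<forall>w'\<in>W. h (q + g - q) \<noteq> w + w') \<and> I (F \<union> (\<lambda>q. q + g) ` F)"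
    by (rule discontinuity_strategy[OF hom disc]) blast
  obtain Q :: "nat \<Rightarrow> 'a set \<Rightarrow> bool" where T2: "Hausdorff_space (euclidean :: 'a topology)"
    and Q_sub: "\<And>n A B. Q n A \<Longrightarrow> B \<subseteq> A \<Longrightarrow> Q n B"
    and Q_Un: "\<And>n A B. Q n A \<Longrightarrow> Q n B \<Longrightarrow> Q n (A \<union> B)"
    and Q_local: "\<And>n x. \<exists>U. open U \<and> x \<in> U \<and> Q n U"
    and Q_compact: "\<And>B. (\<And>n. Q n (B n)) \<Longrightarrow> (\<And>n. B (Suc n) \<subseteq> B n) \<Longrightarrow> compact (\<Inter>n. closure (B n))"
    and Q_tail: "\<And>B U. (\<And>n. Q n (B n)) \<Longrightarrow> (\<And>n. B (Suc n) \<subseteq> B n) \<Longrightarrow> open U \<Longrightarrow>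
      (\<Inter>n. closure (B n)) \<subseteq> U \<Longrightarrow> \<exists>n. B n \<subseteq> U"
    by (rule cech_complete_sequence[OF assms(1)]) blast
  have Q_UN: "Q n (\<Union>i\<in>J. A i)" if "finite J" "\<And>i. i \<in> J \<Longrightarrow> Q n (A i)" for n and J :: "'a set" and A
    using that
  proof (induct J rule: finite_induct)
    case empty
    then show ?case using Q_local[where n = n] Q_sub by fastforce
  next
    case (insert i J)
    then show ?case using Q_Un by simp
  qed
  \<comment> \<open>A compact subgroup \<open>H0\<close> is fixed before any letter: the
    neighbourhood \<open>Us\<close> for which \<open>h\<close> is small on
    \<open>H0 \<inter> Us\<close> must be known when the later sets \<open>U n\<close> are chosen,
    whose intersection then lies in \<open>H0 \<inter> Us\<close>.\<close>
  have "\<exists>U. \<forall>n. (sym_nhd (U n) \<and> Q n (U n)) \<and> (\<forall>x\<in>U (Suc n). \<forall>y\<in>U (Suc n). x + y \<in> U n)"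
  proof (rule dependent_nat_choice)
    obtain U :: "'a set" where U: "open U" "0 \<in> U" "Q 0 U" using Q_local by blast
    obtain V where "sym_nhd V" "V \<subseteq> U" by (rule sym_nhd_subset[OF U(1,2)])
    then show "\<exists>V. sym_nhd V \<and> Q 0 V" using Q_sub[OF U(3)] by blast
  next
    fix U n assume U: "sym_nhd U \<and> Q n U"
    obtain V where V: "sym_nhd V" "\<And>x y. x \<in> V \<Longrightarrow> y \<in> V \<Longrightarrow> x + y \<in> U"
      by (rule sym_nhd_half[of U]) (use U in \<open>auto simp: sym_nhd_def\<close>)
    obtain Z :: "'a set" where Z: "open Z" "0 \<in> Z" "Q (Suc n) Z" using Q_local by blast
    obtain Z' where Z': "sym_nhd Z'" "Z' \<subseteq> Z" by (rule sym_nhd_subset[OF Z(1,2)])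
    have "sym_nhd (V \<inter> Z')" by (rule sym_nhd_Int[OF V(1) Z'(1)])
    moreover have "Q (Suc n) (V \<inter> Z')" by (rule Q_sub[OF Z(3)]) (use Z'(2) in blast)
    ultimately show "\<exists>V. (sym_nhd V \<and> Q (Suc n) V) \<and> (\<forall>x\<in>V. \<forall>y\<in>V. x + y \<in> U)"
      using V(2) by blast
  qed
  then obtain U0 where U0: "\<And>n. sym_nhd (U0 n)" "\<And>n. Q n (U0 n)"
    "\<And>n x y. x \<in> U0 (Suc n) \<Longrightarrow> y \<in> U0 (Suc n) \<Longrightarrow> x + y \<in> U0 n" by blast
  define H0 where "H0 = (\<Inter>n. U0 n)"
  have U0_Suc: "U0 (Suc n) \<subseteq> U0 n" for n
    using closure_sym_nhd_subset[OF U0(1) U0(3)] closure_subset by (rule order_trans[rotated])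
  have H0_zero: "0 \<in> H0" unfolding H0_def using sym_nhdD(2)[OF U0(1)] by simp
  have H0_compact: "compact H0"
    using Q_compact[of U0, OF U0(2) U0_Suc] Inter_closure_eq[of U0, OF closure_sym_nhd_subset[OF U0(1) U0(3)]]
    by (simp add: H0_def)
  have H0_add: "x + y \<in> H0" if "x \<in> H0" "y \<in> H0" for x y
    using that U0(3) by (simp add: H0_def)
  have H0_minus: "- x \<in> H0" if "x \<in> H0" for x
    using that sym_nhdD(3)[OF U0(1)] by (simp add: H0_def)
  have H0_translate: "(+) u ` H0 = H0" if "u \<in> H0" for u
  proof
    show "(+) u ` H0 \<subseteq> H0" using H0_add that by blast
    show "H0 \<subseteq> (+) u ` H0"
    proof
      fix x assume "x \<in> H0"
      then have "- u + x \<in> H0" by (intro H0_add H0_minus that)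
      then show "x \<in> (+) u ` H0" by (intro image_eqI[of _ _ "- u + x"]) (simp_all add: add.assoc[symmetric])
    qed
  qed
  obtain Us where Us: "sym_nhd Us"
    and Us_stein: "\<And>(I :: nat set set) P v s. finite I \<Longrightarrow> H0 = (\<Union>i\<in>I. P i) \<Longrightarrow> (\<And>i. i \<in> I \<Longrightarrow> compact (P i)) \<Longrightarrow>
      disjoint_family_on P I \<Longrightarrow> bij_betw s I I \<Longrightarrow> (\<And>i. i \<in> I \<Longrightarrow> v i \<in> Us) \<Longrightarrow>
      (\<And>i. i \<in> I \<Longrightarrow> (+) (v i) ` P i = P (s i)) \<Longrightarrow> \<exists>i\<in>I. h (v i) \<in> W"
    by (rule piecewise_translation_Steinhaus[OF T2 hom um H0_compact _ sym_nhdD(1,2)[OF W]])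
      (use H0_zero in blast)+
  \<comment> \<open>A single piece: translation by \<open>u\<close> maps the compact group
    \<open>H0\<close> onto itself.\<close>
  have H0_small: "h u \<in> W" if "u \<in> H0" "u \<in> Us" for u
    using Us_stein[of "{{}}" "\<lambda>_. H0" id "\<lambda>_. u"] H0_compact H0_translate that
    by (simp add: disjoint_family_on_def)
  \<comment> \<open>A state consists of the prefixes formed so far and the current neighbourhood.
    The \<open>Q n\<close> clause makes the union of the boxes of level \<open>n\<close> admissible
    for \<open>Q_compact\<close>; the clause for \<open>n = 0\<close> starts the identification of
    \<open>F n\<close> with the range of \<open>prefix n\<close>.\<close>
  define P where "P n = (\<lambda>(F, U). finite F \<and> 0 \<in> F \<and> I F \<and> sym_nhd U \<and> U \<subseteq> U0 n \<inter> Us \<and>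
    (\<forall>p\<in>F. Q n ((+) p ` U)) \<and> (n = 0 \<longrightarrow> F = {0}))" for n
  define step where "step g = (\<lambda>(F, U) (F', U'). F' = F \<union> (\<lambda>q. q + g) ` F \<and>
      (\<forall>q\<in>F. \<forall>w\<in>W. \<forall>w'\<in>W. h (q + g - q) \<noteq> w + w') \<and>
      (\<forall>x\<in>U'. \<forall>y\<in>U'. x + y \<in> U \<and> g + (x + y) \<in> U \<and> x + y \<noteq> g) \<and>
      (\<forall>p\<in>F'. \<forall>x\<in>U'. p + x - p \<in> U \<and> - p + x + p \<in> U))" for g
  have "\<exists>s. \<forall>n. P n (s n) \<and> (\<exists>g. step g (s n) (s (Suc n)))"
  proof (rule dependent_nat_choice)
    have "U0 0 \<inter> Us \<subseteq> U0 0 \<inter> Us" "Q 0 ((+) 0 ` (U0 0 \<inter> Us))"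
      using Q_sub[OF U0(2)[of 0], of "U0 0 \<inter> Us"] by auto
    then have "P 0 ({0}, U0 0 \<inter> Us)"
      unfolding P_def using I0 sym_nhd_Int[OF U0(1) Us] by auto
    then show "\<exists>x. P 0 x" ..
  next
    fix s n assume "P n s"
    then obtain F U where s: "s = (F, U)" and F: "finite F" "0 \<in> F" "I F" and U: "sym_nhd U" "U \<subseteq> U0 n \<inter> Us"
      "\<forall>p\<in>F. Q n ((+) p ` U)" unfolding P_def by auto
    \<comment> \<open>Three summands: the new letter and two elements of the next
      neighbourhood.\<close>
    obtain N where N: "sym_nhd N" "\<And>x y z. x \<in> N \<Longrightarrow> y \<in> N \<Longrightarrow> z \<in> N \<Longrightarrow> x + y + z \<in> U"
      by (rule sym_nhd_third[OF sym_nhdD(1,2)[OF U(1)]]) blast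
    obtain g where g: "g \<in> N" "\<forall>q\<in>F. \<forall>w\<in>W. \<forall>w'\<in>W. h (q + g - q) \<noteq> w + w'" "I (F \<union> (\<lambda>q. q + g) ` F)"
      using strategy[OF F(1,3) sym_nhdD(1,2)[OF N(1)]] by blast
    define F' where "F' = F \<union> (\<lambda>q. q + g) ` F"
    have F': "finite F'" using F(1) by (simp add: F'_def)
    \<comment> \<open>The conjugator \<open>0\<close> shows that \<open>g\<close> is nonzero, so
      some neighbourhood \<open>Z\<close> of \<open>0\<close> omits \<open>g\<close>; this provides
      \<open>letter_apart\<close>.\<close>
    have "h (0 + g - 0) \<noteq> 0 + 0" using g(2) F(2) sym_nhdD(2)[OF W] by blast
    then have "g \<noteq> 0" using h(1) by auto
    then obtain Z where Z: "open Z" "0 \<in> Z" "g \<notin> Z"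
      using T2 unfolding Hausdorff_space_def disjnt_def by (metis disjoint_iff open_openin UNIV_I topspace_euclidean)
    obtain V1 where V1: "sym_nhd V1" "\<And>x y. x \<in> V1 \<Longrightarrow> y \<in> V1 \<Longrightarrow> x + y \<in> Z"
      by (rule sym_nhd_half[OF Z(1,2)]) blast
    have "finite (F' \<union> uminus ` F')" using F' by simp
    then obtain V2 where V2: "sym_nhd V2" "\<And>p x. p \<in> F' \<union> uminus ` F' \<Longrightarrow> x \<in> V2 \<Longrightarrow> p + x - p \<in> U"
      by (rule sym_nhd_conj[OF _ sym_nhdD(1,2)[OF U(1)]]) blast
    have "\<exists>V. sym_nhd V \<and> Q (Suc n) ((+) p ` V)" for p
    proof -
      obtain G where G: "open G" "p \<in> G" "Q (Suc n) G" using Q_local by blast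
      have "open {x. p + x \<in> G}" "0 \<in> {x. p + x \<in> G}" using G by (auto intro!: open_preimage continuous_intros)
      then obtain V where V: "sym_nhd V" "V \<subseteq> {x. p + x \<in> G}" by (rule sym_nhd_subset)
      have "Q (Suc n) ((+) p ` V)" by (rule Q_sub[OF G(3)]) (use V(2) in blast)
      then show ?thesis using V(1) by blast
    qed
    then obtain V3 where V3: "\<And>p. sym_nhd (V3 p)" "\<And>p. Q (Suc n) ((+) p ` V3 p)" by metis
    define U' where "U' = N \<inter> V1 \<inter> V2 \<inter> (\<Inter>p\<in>F'. V3 p) \<inter> U0 (Suc n) \<inter> Us"
    have U': "sym_nhd U'"
      unfolding U'_def by (intro sym_nhd_Int sym_nhd_INT N(1) V1(1) V2(1) V3(1) U0(1) Us F')
    have "P (Suc n) (F', U')"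
    proof -
      have "Q (Suc n) ((+) p ` U')" if "p \<in> F'" for p
        by (rule Q_sub[OF V3(2)[of p]]) (use that in \<open>auto simp: U'_def\<close>)
      moreover have "U' \<subseteq> U0 (Suc n) \<inter> Us" by (auto simp: U'_def)
      ultimately show ?thesis unfolding P_def using F' F(2) g(3) U' by (simp add: F'_def)
    qed
    moreover have "step g s (F', U')"
    proof -
      have 1: "x + y \<in> U \<and> g + (x + y) \<in> U \<and> x + y \<noteq> g" if "x \<in> U'" "y \<in> U'" for x y
      proof -
        have "x \<in> N" "y \<in> N" "x + y \<in> Z" using that V1(2) by (auto simp: U'_def)
        then show ?thesis
          using N(2)[of x y 0] N(2)[OF g(1), of x y] sym_nhdD(2)[OF N(1)] Z(3) by (auto simp: add.assoc)
      qed
      have 2: "p + x - p \<in> U \<and> - p + x + p \<in> U" if "p \<in> F'" "x \<in> U'" for p x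
      proof -
        have "x \<in> V2" using that by (simp add: U'_def)
        then show ?thesis using V2(2)[of p x] V2(2)[of "- p" x] that(1) by simp
      qed
      show ?thesis unfolding step_def s prod.case using 1 2 g(2) by (simp add: F'_def)
    qed
    ultimately show "\<exists>s'. P (Suc n) s' \<and> (\<exists>g. step g s s')" by blast
  qed
  then obtain s g where s: "\<And>n. P n (s n)" "\<And>n. step (g n) (s n) (s (Suc n))" by metis
  define F where "F n = fst (s n)" for n
  define U where "U n = snd (s n)" for n
  have sFU: "s n = (F n, U n)" for n by (simp add: F_def U_def)
  have F: "finite (F n)" "0 \<in> F n" and U_sym: "sym_nhd (U n)" and U_U0: "U n \<subseteq> U0 n" and U_Us: "U n \<subseteq> Us"
    and QF: "\<And>p. p \<in> F n \<Longrightarrow> Q n ((+) p ` U n)" and F0: "F 0 = {0}" for n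
    using s(1)[of n] s(1)[of 0] unfolding sFU P_def by auto
  have F_Suc: "F (Suc n) = F n \<union> (\<lambda>q. q + g n) ` F n"
    and bad: "\<And>q w w'. q \<in> F n \<Longrightarrow> w \<in> W \<Longrightarrow> w' \<in> W \<Longrightarrow> h (q + g n - q) \<noteq> w + w'"
    and Usum: "\<And>x y. x \<in> U (Suc n) \<Longrightarrow> y \<in> U (Suc n) \<Longrightarrow> x + y \<in> U n \<and> g n + (x + y) \<in> U n \<and> x + y \<noteq> g n"
    and Uconj: "\<And>p x. p \<in> F (Suc n) \<Longrightarrow> x \<in> U (Suc n) \<Longrightarrow> p + x - p \<in> U n \<and> - p + x + p \<in> U n" for n
    using s(2)[of n] unfolding sFU step_def by auto
  interpret cantor_products g U
    by standard (use U_sym Usum in auto)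
  have F_prefix: "range (prefix n) = F n" for n
  proof (induct n)
    case 0 show ?case by (simp add: F0)
  next
    case (Suc n) then show ?case unfolding range_prefix_Suc F_Suc by simp
  qed
  interpret cantor_products_conj g U
    by standard (use Uconj F_prefix in blast)+
  have "compact products"
    unfolding products_eq[symmetric]
  proof (rule Q_compact)
    show "Q n (\<Union>\<alpha>. box n \<alpha>)" for n
    proof -
      have "(\<Union>\<alpha>. box n \<alpha>) = (\<Union>p\<in>F n. (+) p ` U n)"
        unfolding F_prefix[symmetric] box_def by simp
      then show ?thesis using Q_UN[OF F(1) QF] by simp
    qed
    show "(\<Union>\<alpha>. box (Suc n) \<alpha>) \<subseteq> (\<Union>\<alpha>. box n \<alpha>)" for n
      by (rule UN_mono[OF subset_refl box_Suc])
  qed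
  note compact = this
  have products_ne: "products \<noteq> {}" using zero_products by blast
  obtain Ut where Ut: "sym_nhd Ut"
    and Ut_stein: "\<And>(I :: nat set set) P v s. finite I \<Longrightarrow> products = (\<Union>i\<in>I. P i) \<Longrightarrow> (\<And>i. i \<in> I \<Longrightarrow> compact (P i)) \<Longrightarrow>
      disjoint_family_on P I \<Longrightarrow> bij_betw s I I \<Longrightarrow> (\<And>i. i \<in> I \<Longrightarrow> v i \<in> Ut) \<Longrightarrow>
      (\<And>i. i \<in> I \<Longrightarrow> (+) (v i) ` P i = P (s i)) \<Longrightarrow> \<exists>i\<in>I. h (v i) \<in> W"
    by (rule piecewise_translation_Steinhaus[OF T2 hom um compact products_ne sym_nhdD(1,2)[OF W]]) blast
  \<comment> \<open>The sets \<open>U m\<close> shrink to the kernel and not to \<open>0\<close>, so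
    conjugates of late letters enter \<open>Ut\<close> only after a correction by a kernel
    element.\<close>
  let ?G = "\<Union>u\<in>kernel. (+) u ` Ut"
  have "\<exists>m. U m \<subseteq> ?G"
  proof (rule Q_tail)
    show "Q n (U n)" for n using QF[OF F(2), of n] by simp
    show "U (Suc n) \<subseteq> U n" for n by (rule U_Suc)
    show "open ?G" using sym_nhdD(1)[OF Ut] by (intro open_UN ballI open_plus_left)
    show "(\<Inter>n. closure (U n)) \<subseteq> ?G"
      unfolding kernel_eq using sym_nhdD(2)[OF Ut] by (force intro: image_eqI[of _ _ 0])
  qed
  then obtain m where m: "U m \<subseteq> ?G" ..
  \<comment> \<open>One level further, since conjugation by prefixes takes \<open>U (Suc m)\<close>
    only into \<open>U m\<close>.\<close>
  define n where "n = Suc m"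
  have "\<exists>u\<in>kernel. - u + (q + g n - q) \<in> Ut" if "q \<in> F n" for q
  proof -
    have "q + g n - q \<in> U m" using Uconj[of q m "g n"] that g_in_U[of n] by (simp add: n_def)
    then obtain u t where "u \<in> kernel" "t \<in> Ut" "q + g n - q = u + t" using m by blast
    then show ?thesis by (intro bexI[of _ u]) (simp_all add: add.assoc[symmetric])
  qed
  then obtain u where u: "\<And>q. q \<in> F n \<Longrightarrow> u q \<in> kernel" "\<And>q. q \<in> F n \<Longrightarrow> - u q + (q + g n - q) \<in> Ut"
    by metis
  have pF: "prefix n \<alpha> \<in> F n" for \<alpha> unfolding F_prefix[symmetric] by simp
  have "\<exists>\<alpha>\<in>Pow {..n}. h (flipper n u \<alpha>) \<in> W"
  proof (rule Ut_stein)
    show "products = (\<Union>\<alpha>\<in>Pow {..n}. piece n \<alpha>)" by (rule products_pieces)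
    show "compact (piece n \<alpha>)" if "\<alpha> \<in> Pow {..n}" for \<alpha> using compact_piece[OF compact] that by blast
    show "disjoint_family_on (piece n) (Pow {..n})" by (rule disjoint_pieces)
    show "bij_betw (flip n) (Pow {..n}) (Pow {..n})"
      by (rule bij_betw_byWitness[of _ "flip n"]) (auto simp: flip_flip, auto simp: flip_def split: if_splits)
    show "flipper n u \<alpha> \<in> Ut" for \<alpha>
      using u(2)[OF pF[of \<alpha>]] sym_nhdD(3)[OF Ut] unfolding flipper_def Let_def by (simp del: minus_add)
    show "(+) (flipper n u \<alpha>) ` piece n \<alpha> = piece n (flip n \<alpha>)" for \<alpha>
      by (rule flipper_piece) (rule u(1)[OF pF])
  qed simp
  then obtain \<alpha> where \<alpha>: "h (flipper n u \<alpha>) \<in> W" by blast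
  define q where "q = prefix n \<alpha>"
  define w where "w = - u q + (q + g n - q)"
  have "flipper n u \<alpha> = w \<or> flipper n u \<alpha> = - w" unfolding flipper_def Let_def w_def q_def by simp
  then have "h w \<in> W" using \<alpha> sym_nhdD(3)[OF W, of "h (- w)"] h(2)[of w] by auto
  moreover have "h (u q) \<in> W"
  proof (rule H0_small)
    have k: "u q \<in> kernel" unfolding q_def by (rule u(1)[OF pF])
    show "u q \<in> H0" using k U_U0 unfolding H0_def kernel_def by blast
    show "u q \<in> Us" using k U_Us unfolding kernel_def by blast
  qed
  \<comment> \<open>Both summands lie in \<open>W\<close>, the first by smallness on
    \<open>H0\<close> and the second by Steinhaus, whereas \<open>g n\<close> was chosen to keep
    this conjugate's image out of \<open>W + W\<close>.\<close>
  moreover have "h (q + g n - q) = h (u q) + h w"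
    unfolding w_def hom[symmetric] by (simp add: add.assoc[symmetric])
  ultimately show False using bad[OF pF[of \<alpha>, folded q_def]] by blast
qed

end
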